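(* For all integers $k\ge1$ and $n\ge0$, $$e_4(7^kn+\delta_{7,k})\equiv0\pmod{7^k}.$$
   Context: $q=e^{2\pi i\tau}$, $(q;q)_\infty=\prod_{n\ge1}(1-q^n)$, $E_4(\tau)=1+240\sum_{n\ge1}\sigma_3(n)q^n$ with $\sigma_3(n)=\sum_{d\mid n}d^3$. The numbers $e_4(n)$ are defined by $\sum_{n\ge0}e_4(n)q^n=E_4(\tau)/(q;q)_\infty$. For a prime $\ell\ge5$ and $k\ge1$, $\delta_{\ell,k}$ is the integer with $0<\delta_{\ell,k}<\ell^k$ and $24\delta_{\ell,k}\equiv1\pmod{\ell^k}$. *)

theory Defs
  imports
    "HOL-Analysis.Analysis"
    "HOL-Computational_Algebra.Computational_Algebra"
    "HOL-Number_Theory.Number_Theory"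
begin

text \<open>
  The \<open>q\<close>-series are formal power series in \<open>q = fps_X\<close> with integer coefficients; infinite
  products are taken in the \<open>q\<close>-adic topology of \<^typ>\<open>int fps\<close>.
\<close>

definition sigma3 :: "nat \<Rightarrow> nat" where
  "sigma3 n = (\<Sum>d | d dvd n. d ^ 3)"

definition E4 :: "int fps" where
  "E4 = 1 + 240 * Abs_fps (\<lambda>n. if n \<ge> 1 then int (sigma3 n) else 0)"

definition qq_inf :: "int fps" where
  "qq_inf = (\<Prod>n. 1 - fps_X ^ Suc n)"

text \<open>
  Since \<^typ>\<open>int\<close> is not a field, the quotient by \<open>qq_inf\<close> (whose constant term is \<open>1\<close>) is
  multiplication by its inverse in \<^typ>\<open>int fps\<close>; the second argument of \<open>fps_right_inverse\<close> is
  the constant term of that inverse. The lemmas \<open>qq_inf_has_prod\<close> and \<open>e4_unique\<close> below confirm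
  that the product converges and that the quotient is the intended one.
\<close>

definition e4 :: "nat \<Rightarrow> int" where
  "e4 n = fps_nth (E4 * fps_right_inverse qq_inf 1) n"

definition delta :: "nat \<Rightarrow> nat \<Rightarrow> nat" where
  "delta l k = (THE d. 0 < d \<and> d < l ^ k \<and> [24 * d = 1] (mod l ^ k))"

lemma qq_inf_aux:
  "(\<lambda>n. 1 - fps_X ^ Suc n :: int fps) has_prod qq_inf \<and> fps_nth qq_inf 0 = 1"
proof -
  let ?f = "\<lambda>n. 1 - fps_X ^ Suc n :: int fps"
  have nth0: "fps_nth (?f n) 0 = 1" for n
    by simp
  have nz: "?f n \<noteq> 0" for n
    using nth0[of n] by (metis fps_zero_nth zero_neq_one)
  have sd: "subdegree (?f k - 1) > n" if "k > n" for n k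
  proof -
    have "?f k - 1 = - (fps_X ^ Suc k)"
      by simp
    then show ?thesis
      using that by (simp only: subdegree_uminus fps_X_power_subdegree)
  qed
  obtain P where P: "(\<lambda>n. \<Prod>k\<le>n. ?f k) \<longlonglongrightarrow> P"
    using tendsto_prod_fps[of ?f "\<lambda>n. n", OF nz sd] by blast
  have prod0: "fps_nth (\<Prod>k\<le>n. ?f k) 0 = 1" for n
    by (induction n) (simp_all add: fps_mult_nth)
  have P0: "fps_nth P 0 = 1"
  proof -
    have "eventually (\<lambda>n. fps_nth (\<Prod>k\<le>n. ?f k) 0 = fps_nth P 0) sequentially"
      using P unfolding tendsto_fps_iff by blast
    then obtain n where "fps_nth (\<Prod>k\<le>n. ?f k) 0 = fps_nth P 0"
      unfolding eventually_sequentially by blast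
    then show ?thesis
      using prod0 by simp
  qed
  have "P \<noteq> 0"
    using P0 by auto
  then have raw: "raw_has_prod ?f 0 P"
    using P by (simp add: raw_has_prod_def del: power_Suc)
  have uniq: "Q = P" if "?f has_prod Q" for Q
  proof -
    have "raw_has_prod ?f 0 Q"
      using that nz unfolding has_prod_def by blast
    then have "(\<lambda>n. \<Prod>k\<le>n. ?f k) \<longlonglongrightarrow> Q"
      by (simp add: raw_has_prod_def del: power_Suc)
    then show ?thesis
      using P LIMSEQ_unique by blast
  qed
  have hp: "?f has_prod P"
    using raw unfolding has_prod_def by blast
  have "qq_inf = P"
    unfolding qq_inf_def prodinf_def
    by (rule the_equality[where P = "\<lambda>p. ?f has_prod p", OF hp uniq])
  with hp P0 show ?thesis
    by simp
qed

lemma qq_inf_has_prod: "(\<lambda>n. 1 - fps_X ^ Suc n) has_prod qq_inf"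
  and qq_inf_nth_0: "fps_nth qq_inf 0 = 1"
  using qq_inf_aux by blast+

lemma e4_unique: "f = e4 \<longleftrightarrow> Abs_fps f * qq_inf = E4"
proof -
  have inv: "qq_inf * fps_right_inverse qq_inf 1 = 1"
    by (rule fps_right_inverse) (simp add: qq_inf_nth_0)
  have e4: "Abs_fps e4 = E4 * fps_right_inverse qq_inf 1"
    by (simp add: fps_eq_iff e4_def)
  have e4': "Abs_fps e4 * qq_inf = E4"
    unfolding e4 using inv by (metis mult.assoc mult.commute mult_1_right)
  have "qq_inf \<noteq> 0"
    using qq_inf_nth_0 by auto
  then have "Abs_fps f * qq_inf = E4 \<longleftrightarrow> Abs_fps f = Abs_fps e4"
    using e4' by (metis mult_right_cancel)
  also have "\<dots> \<longleftrightarrow> f = e4"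
    by (auto simp: fps_eq_iff)
  finally show ?thesis ..
qed

lemma delta_ex1:
  fixes l k :: nat
  assumes "prime l" "l \<ge> 5" "k \<ge> 1"
  shows "\<exists>!d. 0 < d \<and> d < l ^ k \<and> [24 * d = 1] (mod l ^ k)"
proof -
  have "\<not> l dvd 24"
  proof
    assume "l dvd 24"
    then have "l dvd 2 ^ 3 * 3"
      by simp
    then have "l dvd 2 \<or> l dvd 3"
      using assms(1) prime_dvd_mult_iff prime_dvd_power by blast
    then show False
      using assms(2) by (auto dest: dvd_imp_le)
  qed
  then have cop: "coprime 24 (l ^ k)"
    using assms(1) by (metis coprime_commute coprime_power_right_iff prime_imp_coprime_nat)
  have gt: "l ^ k > 1"
    using assms by (intro one_less_power) auto
  obtain x where x: "[24 * x = 1] (mod l ^ k)"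
    using cong_solve_coprime_nat[OF cop] by auto
  define d where "d = x mod l ^ k"
  have d: "[24 * d = 1] (mod l ^ k)"
    using x unfolding d_def cong_def by (simp add: mod_mult_right_eq)
  have "d \<noteq> 0"
  proof
    assume "d = 0"
    then show False
      using d gt unfolding cong_def by (metis mod_0 mod_less mult_0_right zero_neq_one)
  qed
  moreover have "d < l ^ k"
    using gt unfolding d_def by (intro mod_less_divisor) linarith
  moreover have "d' = d" if "d' < l ^ k" "[24 * d' = 1] (mod l ^ k)" for d'
  proof -
    have "[24 * d' = 24 * d] (mod l ^ k)"
      using cong_trans[OF that(2) cong_sym[OF d]] .
    then have "[d' = d] (mod l ^ k)"
      using cong_mult_lcancel_nat[OF cop] by simp
    then show ?thesis
      using that(1) \<open>d < l ^ k\<close> by (simp add: cong_def)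
  qed
  ultimately show ?thesis
    using d by (intro ex1I[of _ d]) blast+
qed

lemma delta_props:
  assumes "prime l" "l \<ge> 5" "k \<ge> 1"
  shows "0 < delta l k \<and> delta l k < l ^ k \<and> [24 * delta l k = 1] (mod l ^ k)"
  unfolding delta_def using theI'[OF delta_ex1[OF assms]] .

end

(*
  The forms F_i = E_4^(3i+1) / eta^(24i+1) all have weight 7/2 and the multiplier of 1/eta, and
  they span the weakly holomorphic forms of this type. The Hecke operator T(49) sends the
  coefficient sequence f(e) of F_i to f(49 e - 2) + 49 eps(e) f(e) + 7^5 f((e + 2) / 49). Its
  image is again a combination of the F_j; comparing principal parts, the three terms give three
  groups of F_j of different lengths, whose divisibility by 1, 7^2 and 7^5 compensates the
  growth of j. An induction on k that lowers k by 2 reduces the theorem to k = 1. For k = 1 the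
  cusp form E_4 eta^48 of weight 28 is used: modulo 7 it is E_4 / eta times a series in q^7, and
  the Hecke operator T_7 preserves the two-dimensional space of cusp forms of weight 28, so two
  coefficients decide.

  Linear relations between forms are proved by the vanishing of a modular function that tends to
  zero at the cusp (maximum modulus principle). The transformation laws come from rearranging
  the Eisenstein series, and only the matrices in two explicit tables of cosets are needed.
*)
theory Submission
  imports Defs "HOL-Complex_Analysis.Complex_Analysis" "HOL-Real_Asymp.Real_Asymp"
begin

section \<open>Lattice sums and Eisenstein series\<close>

text \<open>Since E_4^3 / eta^24 = j, the family is (E_4 / eta) * j^i. No finite part of it is
  stable: T(49) turns the leading index - i into - (49 i + 2), so the congruences for E_4 / eta
  alone cannot be iterated and the induction has to treat all i at once. It closes because the
  indices beyond i come only with the factor 7^5, while the power of 7 required for the index 49 i +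
  2 exceeds that for i by just 2. The constants are those of a Hecke operator of square index in
  weight lambda + 1/2 with lambda = 3: 7^(2 lambda - 1) = 7^5 and 7^(lambda - 1) = 49. The shift 2
  is (49 - 1) / 24. One step consumes two powers of 7, so the exponent 1 is out of its reach. For it
  E_4 / eta is multiplied by eta^49, because 49 is the least r divisible by 7 with r = 1 modulo 24:
  then E_4 eta^(r - 1) has level one and trivial multiplier, and (q;q)^r is a seventh power.\<close>

definition nome :: "complex \<Rightarrow> complex" where
  "nome \<tau> = exp (2 * of_real pi * \<i> * \<tau>)"

section \<open>The nome and the reflection formulas of the polygamma functions\<close>

lemma nome_eq_1_iff: "nome z = 1 \<longleftrightarrow> z \<in> \<int>"
proof
  assume "nome z = 1"
  then obtain n :: int where n: "2 * pi * Re z = of_int (2 * n) * pi" "Im z = 0"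
    unfolding nome_def exp_eq_1 by auto
  then have "z = of_int n" by (simp add: complex_eq_iff)
  then show "z \<in> \<int>" by simp
next
  assume "z \<in> \<int>"
  then obtain n where "z = of_int n" by (auto elim: Ints_cases)
  then show "nome z = 1"
    unfolding nome_def exp_eq_1 by (auto intro!: exI[of _ n])
qed

lemma has_field_derivative_nome:
  "(nome has_field_derivative 2 * of_real pi * \<i> * nome z) (at z within A)"
  unfolding nome_def by (auto intro!: derivative_eq_intros)

text \<open>The logarithmic derivative of Gamma z * Gamma (1 - z) = pi / sin (pi z). The cotangent
  is written through the nome, so that every later formula is a rational function of q.\<close>

lemma Digamma_reflection:
  fixes z :: complex
  assumes "z \<notin> \<int>"
  shows "Digamma z - Digamma (1 - z) = of_real pi * \<i> * (1 + nome z) / (1 - nome z)"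
proof -
  have z: "z \<notin> \<int>\<^sub>\<le>\<^sub>0" "1 - z \<notin> \<int>\<^sub>\<le>\<^sub>0"
    using assms Ints_diff[of 1 "1 - z"] nonpos_Ints_subset_Ints by auto
  have s: "sin (of_real pi * z) \<noteq> 0"
    using assms by (auto simp: sin_eq_0)
  have 1: "((\<lambda>z. Gamma z * Gamma (1 - z)) has_field_derivative
      Gamma z * Gamma (1 - z) * (Digamma z - Digamma (1 - z))) (at z)"
    using z by (auto intro!: derivative_eq_intros simp: algebra_simps)
  have "(\<lambda>z. Gamma z * Gamma (1 - z)) = (\<lambda>z::complex. of_real pi / sin (of_real pi * z))"
    using Gamma_reflection_complex by (intro ext) auto
  moreover have "((\<lambda>z. of_real pi / sin (of_real pi * z)) has_field_derivative
      - (of_real pi * of_real pi * cos (of_real pi * z) / (sin (of_real pi * z))^2)) (at z)"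
    using s by (auto intro!: derivative_eq_intros simp: power2_eq_square)
  ultimately have "Gamma z * Gamma (1 - z) * (Digamma z - Digamma (1 - z)) =
      - (of_real pi * of_real pi * cos (of_real pi * z) / (sin (of_real pi * z))^2)"
    using 1 DERIV_unique by metis
  then have "of_real pi / sin (of_real pi * z) * (Digamma z - Digamma (1 - z)) =
      of_real pi / sin (of_real pi * z) * (- of_real pi * cos (of_real pi * z) / sin (of_real pi * z))"
    unfolding Gamma_reflection_complex by (simp add: power2_eq_square)
  then have "Digamma z - Digamma (1 - z) = - of_real pi * cos (of_real pi * z) / sin (of_real pi * z)"
    using s by (subst (asm) mult_left_cancel) auto
  also have "\<dots> = of_real pi * \<i> * (1 + nome z) / (1 - nome z)"
  proof -
    \<comment> \<open>\<open>w\<close> is a square root of the nome; sine and cosine are rational in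
      it.\<close>
    define w where "w = exp (\<i> * (of_real pi * z))"
    have w: "w \<noteq> 0" "nome z = w^2"
      by (simp_all add: w_def nome_def power2_eq_square flip: exp_add)
         (simp add: algebra_simps)
    have c: "cos (of_real pi * z) = (w + 1 / w) / 2" "sin (of_real pi * z) = (w - 1 / w) / (2 * \<i>)"
      by (simp_all add: w_def cos_exp_eq sin_exp_eq exp_minus field_simps)
    have n: "w^2 \<noteq> 1" using assms w nome_eq_1_iff by metis
    have "w - 1 / w \<noteq> 0" using n w by (simp add: field_simps power2_eq_square)
    then show ?thesis unfolding w(2) c using w n
      by (simp add: divide_simps power2_eq_square) (simp add: algebra_simps)?
  qed
  finally show ?thesis .
qed

lemma Polygamma_reflection:
  fixes z :: complex
  assumes z: "z \<notin> \<int>"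
  shows "Polygamma 1 z + Polygamma 1 (1 - z) = - 4 * of_real pi ^ 2 * nome z / (1 - nome z)^2"
    and "Polygamma 3 z + Polygamma 3 (1 - z) =
      16 * of_real pi ^ 4 * nome z * (1 + 4 * nome z + nome z ^ 2) / (1 - nome z)^4"
proof -
  \<comment> \<open>\<open>v\<close> satisfies v' = 2 pi i (v^2 - v), so each derivative of the
    reflection formula is again a polynomial in \<open>v\<close> and no quotient has to be
    differentiated.\<close>
  define v where "v = (\<lambda>z. 1 / (1 - nome z))"
  have op: "open (- \<int> :: complex set)" using closed_Ints by auto
  have nz: "z \<notin> \<int>\<^sub>\<le>\<^sub>0" "1 - z \<notin> \<int>\<^sub>\<le>\<^sub>0" "1 - nome z \<noteq> 0" if "z \<notin> \<int>" for z
    using that Ints_diff[of 1 "1 - z"] nonpos_Ints_subset_Ints nome_eq_1_iff[of z] by auto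
  have dv: "(v has_field_derivative 2 * of_real pi * \<i> * (v z ^ 2 - v z)) (at z)"
    if "z \<notin> \<int>" for z
  proof -
    define a where "a = nome z"
    have a: "1 - a \<noteq> 0" using nz[OF that] by (simp add: a_def)
    have "((\<lambda>z. 1 - nome z) has_field_derivative 0 - 2 * of_real pi * \<i> * a) (at z)"
      unfolding a_def by (intro DERIV_diff DERIV_const has_field_derivative_nome)
    from DERIV_inverse'[OF this] a
    have "(v has_field_derivative
        - (inverse (1 - a) * (0 - 2 * of_real pi * \<i> * a) * inverse (1 - a))) (at z)"
      by (simp add: v_def inverse_eq_divide a_def)
    also have "- (inverse (1 - a) * (0 - 2 * of_real pi * \<i> * a) * inverse (1 - a)) =
        2 * of_real pi * \<i> * ((1 / (1 - a))^2 - 1 / (1 - a))"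
    proof -
      define u where "u = 1 - a"
      have u: "u \<noteq> 0" "a = 1 - u" using a by (auto simp: u_def)
      show ?thesis unfolding u(2) using u(1) by (simp add: field_simps power2_eq_square)
    qed
    finally show ?thesis by (simp add: v_def a_def)
  qed
  note [derivative_intros] = dv[THEN DERIV_chain2]
  have D: "f' = g'" if "\<And>z. z \<notin> \<int> \<Longrightarrow> f z = g z" "z \<notin> \<int>" "(f has_field_derivative f') (at z)"
      "(g has_field_derivative g') (at z)" for f g :: "complex \<Rightarrow> complex" and f' g' z
  proof -
    have "(g has_field_derivative f') (at z)"
      using has_field_derivative_transform_within_open[OF that(3) op] that by auto
    then show ?thesis using DERIV_unique that by blast
  qed
  have 0: "Polygamma 0 z - Polygamma 0 (1 - z) = of_real pi * \<i> * (2 * v z - 1)"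
    if z: "z \<notin> \<int>" for z :: complex
    using nz[OF z] by (simp add: Digamma_reflection[OF z] v_def field_simps)
  have 1: "Polygamma 1 z + Polygamma 1 (1 - z) = - 4 * of_real pi ^ 2 * (v z ^ 2 - v z)"
    if z: "z \<notin> \<int>" for z :: complex
    by (rule D[OF 0 z]) (use nz[OF z] z in
      \<open>auto intro!: derivative_eq_intros simp: algebra_simps power2_eq_square\<close>)
  have 2: "Polygamma 2 z - Polygamma 2 (1 - z) =
     - 8 * \<i> * of_real pi ^ 3 * (2 * v z ^ 3 - 3 * v z ^ 2 + v z)"
    if z: "z \<notin> \<int>" for z :: complex
    by (rule D[OF 1 z]) (use nz[OF z] z in
      \<open>auto intro!: derivative_eq_intros simp: algebra_simps eval_nat_numeral\<close>)
  have 3: "Polygamma 3 z + Polygamma 3 (1 - z) =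
     16 * of_real pi ^ 4 * (6 * v z ^ 4 - 12 * v z ^ 3 + 7 * v z ^ 2 - v z)"
    if z: "z \<notin> \<int>" for z :: complex
    by (rule D[OF 2 z]) (use nz[OF z] z in
      \<open>auto intro!: derivative_eq_intros simp: algebra_simps eval_nat_numeral\<close>)
  define u where "u = 1 - nome z"
  have u: "u \<noteq> 0" "nome z = 1 - u" "v z = 1 / u"
    using nz[OF z] by (simp_all add: u_def v_def)
  show "Polygamma 1 z + Polygamma 1 (1 - z) = - 4 * of_real pi ^ 2 * nome z / (1 - nome z)^2"
    using u(1) unfolding 1[OF z] u(2,3) by (simp add: field_simps eval_nat_numeral)
  show "Polygamma 3 z + Polygamma 3 (1 - z) =
      16 * of_real pi ^ 4 * nome z * (1 + 4 * nome z + nome z ^ 2) / (1 - nome z)^4"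
    using u(1) unfolding 3[OF z] u(2,3) by (simp add: field_simps eval_nat_numeral)
qed

section \<open>Sums over all integers and the Lipschitz formulas\<close>

lemma has_sum_int_split:
  fixes f :: "int \<Rightarrow> complex"
  assumes "summable (\<lambda>k. norm (f (int k)))" "summable (\<lambda>k. norm (f (- int (Suc k))))"
  shows "(f has_sum ((\<Sum>k. f (int k)) + (\<Sum>k. f (- int (Suc k))))) UNIV"
    and "(\<lambda>n. norm (f n)) summable_on UNIV"
proof -
  have u: "UNIV = range int \<union> range (\<lambda>k. - int (Suc k))"
  proof safe
    fix n :: int assume n: "n \<notin> range (\<lambda>k. - int (Suc k))"
    have "n \<ge> 0"
    proof (rule ccontr)
      assume "\<not> n \<ge> 0"
      then have "n = - int (Suc (nat (- n - 1)))" by simp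
      with n show False by blast
    qed
    then show "n \<in> range int" by (metis nonneg_int_cases range_eqI)
  qed auto
  have inj: "inj int" "inj (\<lambda>k. - int (Suc k))" by (auto simp: inj_def)
  have d: "range int \<inter> range (\<lambda>k. - int (Suc k)) = {}" by auto
  have "(f has_sum (\<Sum>k. f (int k))) (range int)"
    by (subst has_sum_reindex[OF inj(1)]) (use norm_summable_imp_has_sum[OF assms(1)]
      summable_sums[OF summable_norm_cancel[OF assms(1)]] in \<open>simp add: o_def\<close>)
  moreover have "(f has_sum (\<Sum>k. f (- int (Suc k)))) (range (\<lambda>k. - int (Suc k)))"
    by (subst has_sum_reindex[OF inj(2)]) (use norm_summable_imp_has_sum[OF assms(2)]
      summable_sums[OF summable_norm_cancel[OF assms(2)]] in \<open>simp add: o_def\<close>)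
  ultimately show "(f has_sum ((\<Sum>k. f (int k)) + (\<Sum>k. f (- int (Suc k))))) UNIV"
    unfolding u using d by (rule has_sum_Un_disjoint)
  then show "(\<lambda>n. norm (f n)) summable_on UNIV"
    using summable_on_iff_abs_summable_on_complex has_sum_imp_summable by blast
qed

lemma summable_norm_shifted_inverse_power:
  fixes z :: complex
  assumes "p \<ge> 2"
  shows "summable (\<lambda>k. norm (1 / (z + of_nat k) ^ p))"
proof (rule summable_comparison_test_ev)
  define N where "N = nat \<lceil>2 * norm z\<rceil> + 2"
  show "\<forall>\<^sub>F k in sequentially. norm (norm (1 / (z + of_nat k) ^ p)) \<le> 2 ^ p * inverse (real k ^ p)"
    using eventually_ge_at_top[of N]
  proof eventually_elim
    case (elim k)
    have k: "2 * norm z \<le> real k" "k > 0" using elim unfolding N_def by linarith+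
    have "real k / 2 \<le> norm (z + of_nat k)"
      using k norm_triangle_ineq2[of "of_nat k" "- z"] by (simp add: add.commute)
    then have "(real k / 2) ^ p \<le> norm (z + of_nat k) ^ p" by (intro power_mono) auto
    moreover have "0 < (real k / 2) ^ p" using k by auto
    ultimately have "1 / norm (z + of_nat k) ^ p \<le> 1 / (real k / 2) ^ p"
      by (intro divide_left_mono mult_pos_pos) auto
    then show ?case using k by (simp add: norm_divide norm_power field_simps)
  qed
  show "summable (\<lambda>k. 2 ^ p * inverse (real k ^ p))"
    using assms by (intro summable_mult inverse_power_summable)
qed

lemma summable_on_int_shifted_inverse_power:
  fixes z :: complex
  assumes "p \<ge> 2"
  shows "(\<lambda>n::int. norm (1 / (z + of_int n) ^ p)) summable_on UNIV"
    and has_sum_int_shifted_inverse_power: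
    "((\<lambda>n::int. 1 / (z + of_int n) ^ p) has_sum
        ((\<Sum>k. inverse ((z + of_nat k) ^ p)) + (-1)^p * (\<Sum>k. inverse ((1 - z + of_nat k) ^ p)))) UNIV"
proof -
  have e: "1 / (z + of_int (- int (Suc k))) ^ p = (-1)^p * (1 / (1 - z + of_nat k) ^ p)" for k
  proof -
    have "z + of_int (- int (Suc k)) = - 1 * (1 - z + of_nat k)" by simp
    then show ?thesis by (simp only: power_mult_distrib) (simp add: uminus_power_if)
  qed
  have s: "summable (\<lambda>k. norm (1 / (1 - z + of_nat k) ^ p))"
    by (rule summable_norm_shifted_inverse_power[OF assms])
  have s1: "summable (\<lambda>k. norm (1 / (z + of_int (int k)) ^ p))"
    using summable_norm_shifted_inverse_power[OF assms, of z] by simp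
  have s2: "summable (\<lambda>k. norm (1 / (z + of_int (- int (Suc k))) ^ p))"
    unfolding e norm_mult using s by (simp only: norm_power norm_minus_cancel norm_one power_one mult_1_left)
  note * = has_sum_int_split[OF s1 s2]
  show "(\<lambda>n::int. norm (1 / (z + of_int n) ^ p)) summable_on UNIV" by (rule *)
  have "(\<Sum>k. 1 / (z + of_int (- int (Suc k))) ^ p) = (-1)^p * (\<Sum>k. 1 / (1 - z + of_nat k) ^ p)"
    unfolding e by (rule suminf_mult) (rule summable_norm_cancel[OF s])
  with *(1) show "((\<lambda>n::int. 1 / (z + of_int n) ^ p) has_sum
        ((\<Sum>k. inverse ((z + of_nat k) ^ p)) + (-1)^p * (\<Sum>k. inverse ((1 - z + of_nat k) ^ p)))) UNIV"
    by (simp add: inverse_eq_divide)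
qed

text \<open>The terms n >= 0 and n < 0 form polygamma series at z and at 1 - z, so the reflection
  formulas evaluate the sum. The orders 2 and 4 are those of E_2 and E_4.\<close>

lemma Lipschitz_formula:
  fixes z :: complex
  assumes "z \<notin> \<int>"
  shows "((\<lambda>n::int. 1 / (z + of_int n)^2) has_sum (- 4 * of_real pi ^ 2 * nome z / (1 - nome z)^2)) UNIV"
    and "((\<lambda>n::int. 1 / (z + of_int n)^4) has_sum
      (8 / 3 * of_real pi ^ 4 * nome z * (1 + 4 * nome z + nome z ^ 2) / (1 - nome z)^4)) UNIV"
proof -
  note r = Polygamma_reflection[OF assms]
  show "((\<lambda>n::int. 1 / (z + of_int n)^2) has_sum (- 4 * of_real pi ^ 2 * nome z / (1 - nome z)^2)) UNIV"
    using has_sum_int_shifted_inverse_power[of 2 z] unfolding r(1)[symmetric]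
    by (simp add: Polygamma_def numeral_2_eq_2)
  have p3: "Polygamma 3 w = 6 * (\<Sum>k. inverse ((w + of_nat k) ^ 4))" for w :: complex
    by (simp add: Polygamma_def fact_numeral)
  have "(8 / 3 * of_real pi ^ 4 * nome z * (1 + 4 * nome z + nome z ^ 2) / (1 - nome z)^4) =
    (Polygamma 3 z + Polygamma 3 (1 - z)) / 6" unfolding r(2) by simp
  also have "\<dots> = (\<Sum>k. inverse ((z + of_nat k) ^ 4)) + (\<Sum>k. inverse ((1 - z + of_nat k) ^ 4))"
    unfolding p3 by simp
  finally show "((\<lambda>n::int. 1 / (z + of_int n)^4) has_sum
      (8 / 3 * of_real pi ^ 4 * nome z * (1 + 4 * nome z + nome z ^ 2) / (1 - nome z)^4)) UNIV"
    using has_sum_int_shifted_inverse_power[of 4 z] by simp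
qed

text \<open>The cotangent series itself does not converge unconditionally over the integers, but a
  difference of two of them has terms of order 1 / n^2. \<open>W z\<close> is pi cot (pi z).\<close>

lemma cot_difference_has_sum:
  fixes z w :: complex
  assumes "z \<notin> \<int>" "w \<notin> \<int>"
  defines "W \<equiv> (\<lambda>z. - of_real pi * \<i> * (1 + nome z) / (1 - nome z))"
  shows "((\<lambda>n::int. 1 / (z + of_int n) - 1 / (w + of_int n)) has_sum (W z - W w)) UNIV"
proof -
  have nz: "z + of_int n \<noteq> 0" "w + of_int n \<noteq> 0" for n :: int
    using assms(1,2) by (metis Ints_minus Ints_of_int add.inverse_inverse add_eq_0_iff2)+
  have W: "W z = Digamma (1 - z) - Digamma z" if "z \<notin> \<int>" for z
  proof -
    have "W z = - (Digamma z - Digamma (1 - z))"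
      unfolding Digamma_reflection[OF that] W_def by simp
    then show ?thesis by simp
  qed
  define f where "f = (\<lambda>n::int. 1 / (z + of_int n) - 1 / (w + of_int n))"
  have f: "f n = (w - z) * (1 / ((z + of_int n) * (w + of_int n)))" for n
    using nz[of n] unfolding f_def by (simp add: field_simps)
  have b: "norm (f n) \<le> norm (w - z) * (norm (1 / (z + of_int n) ^ 2) + norm (1 / (w + of_int n) ^ 2))" for n
  proof -
    define a c where "a = norm (1 / (z + of_int n))" and "c = norm (1 / (w + of_int n))"
    have "a * c \<le> a^2 + c^2"
    proof -
      have "0 \<le> a * c" unfolding a_def c_def by simp
      then show ?thesis using sum_squares_bound[of a c] by linarith
    qed
    moreover have "norm (f n) = norm (w - z) * (a * c)"
      unfolding f a_def c_def norm_mult by (simp add: norm_divide norm_mult)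
    moreover have "norm (1 / (z + of_int n) ^ 2) = a^2" "norm (1 / (w + of_int n) ^ 2) = c^2"
      by (simp_all add: a_def c_def norm_divide norm_power power_divide)
    ultimately show ?thesis by (simp add: mult_left_mono)
  qed
  have "(\<lambda>n. norm (w - z) * (norm (1 / (z + of_int n) ^ 2) + norm (1 / (w + of_int n) ^ 2))) summable_on (UNIV::int set)"
    by (intro summable_on_cmult_right summable_on_add summable_on_int_shifted_inverse_power) auto
  then have fs: "(\<lambda>n. norm (f n)) summable_on UNIV"
    by (rule Infinite_Sum.abs_summable_on_comparison_test') (use b in auto)
  have inj: "inj int" "inj (\<lambda>k. - int (Suc k))" by (auto simp: inj_def)
  have "(\<lambda>n. norm (f n)) summable_on range int" "(\<lambda>n. norm (f n)) summable_on range (\<lambda>k. - int (Suc k))"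
    using fs by (rule summable_on_subset_banach, simp)+
  then have "(\<lambda>k. norm (f (int k))) summable_on UNIV" "(\<lambda>k. norm (f (- int (Suc k)))) summable_on UNIV"
    using summable_on_reindex[OF inj(1), of "\<lambda>n. norm (f n)"]
      summable_on_reindex[OF inj(2), of "\<lambda>n. norm (f n)"] by (simp_all add: o_def)
  then have s: "summable (\<lambda>k. norm (f (int k)))" "summable (\<lambda>k. norm (f (- int (Suc k))))"
    by (auto intro: summable_on_imp_summable)
  have D: "(\<lambda>k. 1 / (a + of_nat k) - 1 / (b + of_nat k)) sums (Digamma b - Digamma a)"
    if "a \<noteq> 0" "b \<noteq> 0" for a b :: complex
    using sums_diff[OF summable_sums[OF summable_Digamma[OF that(2)]] summable_sums[OF summable_Digamma[OF that(1)]]]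
    by (simp add: Digamma_def inverse_eq_divide)
  have "(\<lambda>k. f (int k)) sums (Digamma w - Digamma z)"
    unfolding f_def using D[of z w] nz[of 0] by simp
  moreover have "(\<lambda>k. f (- int (Suc k))) sums (Digamma (1 - z) - Digamma (1 - w))"
  proof -
    have "f (- int (Suc k)) = 1 / (1 - w + of_nat k) - 1 / (1 - z + of_nat k)" for k
    proof -
      have e: "z + of_int (- int (Suc k)) = - (1 - z + of_nat k)" "w + of_int (- int (Suc k)) = - (1 - w + of_nat k)"
        by simp_all
      show ?thesis unfolding f_def e by (simp only: divide_minus_right) simp
    qed
    moreover have "1 - z \<noteq> 0" "1 - w \<noteq> 0" using assms(1,2) by auto
    ultimately show ?thesis using D[of "1 - w" "1 - z"] by simp
  qed
  ultimately have "(\<Sum>k. f (int k)) + (\<Sum>k. f (- int (Suc k))) = W z - W w"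
    using W[OF assms(1)] W[OF assms(2)] by (simp add: sums_unique[symmetric])
  with has_sum_int_split(1)[OF s] show ?thesis unfolding f_def by simp
qed

section \<open>Absolute convergence of lattice sums\<close>

text \<open>The squared modulus of m tau + n is a positive definite quadratic form in (m, n), hence
  dominates a multiple of m^2 + n^2.\<close>

lemma lattice_norm_lower_bound:
  assumes "Im \<tau> > 0"
  obtains \<delta> where "\<delta> > 0" "\<And>m n :: real. \<delta> * (m^2 + n^2) \<le> norm (of_real m * \<tau> + of_real n) ^ 2"
proof -
  define x y where "x = Re \<tau>" and "y = Im \<tau>"
  have y: "y > 0" using assms by (simp add: y_def)
  define K where "K = 1 / y^2 + 2 + 2 * x^2 / y^2"
  have K: "K > 0" using y unfolding K_def by (simp add: add_pos_nonneg)
  have "m^2 + n^2 \<le> K * norm (of_real m * \<tau> + of_real n) ^ 2" for m n :: real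
  proof -
    define N where "N = (m * x + n)^2 + (m * y)^2"
    have N: "norm (of_real m * \<tau> + of_real n) ^ 2 = N"
      unfolding cmod_power2 by (simp add: N_def x_def y_def)
    have "m^2 * y^2 \<le> N" unfolding N_def by (simp add: power_mult_distrib)
    then have m: "m^2 \<le> N / y^2" using y by (simp add: field_simps)
    have "n^2 \<le> 2 * (m * x + n)^2 + 2 * (m * x)^2"
      using zero_le_power2[of "2 * m * x + n"] by (simp add: power2_eq_square algebra_simps)
    also have "2 * (m * x + n)^2 \<le> 2 * N" unfolding N_def by simp
    also have "2 * (m * x)^2 = 2 * x^2 * m^2" by (simp add: power_mult_distrib)
    also have "\<dots> \<le> 2 * x^2 * (N / y^2)" using m by (intro mult_left_mono) auto
    finally have "m^2 + n^2 \<le> N / y^2 + (2 * N + 2 * x^2 * (N / y^2))" using m by linarith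
    also have "\<dots> = K * N" by (simp add: K_def algebra_simps)
    finally show ?thesis using N by simp
  qed
  then have "1 / K * (m^2 + n^2) \<le> norm (of_real m * \<tau> + of_real n) ^ 2" for m n :: real
    using K by (simp add: field_simps)
  with K that[of "1 / K"] show ?thesis by simp
qed

text \<open>The common majorant for the weights 4 and 2. Being a product it reduces to one variable,
  and it is finite at the origin.\<close>

lemma summable_on_int_pairs_inverse:
  "(\<lambda>(m, n). C * (1 / ((1 + (real_of_int m)^2) * (1 + (real_of_int n)^2)))) summable_on UNIV"
proof -
  \<comment> \<open>The shift by the imaginary unit gives |i + n|^2 = 1 + n^2, which makes the
    one-variable series an instance of the shifted inverse squares.\<close>
  have "norm (1 / (\<i> + of_int n) ^ 2) = 1 / (1 + (real_of_int n)^2)" for n :: int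
    by (simp add: norm_divide norm_power cmod_power2)
  then have s: "(\<lambda>n::int. 1 / (1 + (real_of_int n)^2)) summable_on UNIV"
    using summable_on_int_shifted_inverse_power[of 2 \<i>] by simp
  have p: "(\<lambda>(m, n). f m * f n) summable_on UNIV \<times> UNIV"
    if f: "f summable_on UNIV" "\<And>n. f n \<ge> 0" for f :: "int \<Rightarrow> real"
    by (rule summable_on_SigmaI[where g = "\<lambda>m. f m * infsum f UNIV"])
       (use f in \<open>auto intro!: has_sum_cmult_right has_sum_infsum summable_on_cmult_left\<close>)
  have "(\<lambda>(m::int, n::int). 1 / (1 + (real_of_int m)^2) * (1 / (1 + (real_of_int n)^2))) summable_on UNIV \<times> UNIV"
    by (rule p[OF s]) simp
  from summable_on_cmult_right[OF this, of C] show ?thesis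
    by (simp add: case_prod_unfold)
qed

text \<open>With a = m^2 and b = n^2 this is (1 + a) (1 + b) <= (1 + a + b)^2 <= 4 (a + b)^2. The
  last step uses a + b >= 1, true for integers that are not both 0.\<close>

lemma lattice_inverse_bound:
  fixes m n :: int
  assumes "\<delta> > 0" "(m, n) \<noteq> (0, 0)"
  shows "1 / (\<delta> * (real_of_int m ^ 2 + real_of_int n ^ 2))^2 \<le>
    4 / \<delta>^2 * (1 / ((1 + (real_of_int m)^2) * (1 + (real_of_int n)^2)))"
proof -
  define a b where "a = real_of_int m ^ 2" and "b = real_of_int n ^ 2"
  have "m^2 + n^2 \<ge> 1"
    using assms(2) by (metis int_one_le_iff_zero_less sum_power2_gt_zero_iff)
  then have "real_of_int (m^2 + n^2) \<ge> 1" by linarith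
  then have ab: "a + b \<ge> 1" "a \<ge> 0" "b \<ge> 0" by (simp_all add: a_def b_def)
  have "(1 + a) * (1 + b) \<le> (1 + (a + b)) * (1 + (a + b))"
    using ab by (intro mult_mono) auto
  also have "\<dots> \<le> (2 * (a + b)) * (2 * (a + b))" using ab by (intro mult_mono) auto
  finally have "\<delta>^2 * ((1 + a) * (1 + b)) \<le> \<delta>^2 * (4 * (a + b)^2)"
    by (intro mult_left_mono) (simp_all add: power2_eq_square algebra_simps)
  moreover have "\<delta>^2 * ((1 + a) * (1 + b)) > 0" "\<delta> * (a + b) > 0" using ab assms(1) by auto
  ultimately show ?thesis unfolding a_def[symmetric] b_def[symmetric]
    using ab assms(1) by (simp add: divide_simps power_mult_distrib)
qed

lemma summable_on_G4:
  assumes "Im \<tau> > 0"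
  shows "(\<lambda>(m, n). 1 / (of_int m * \<tau> + of_int n)^4) summable_on UNIV"
proof -
  obtain \<delta> where \<delta>: "\<delta> > 0" "\<And>m n :: real. \<delta> * (m^2 + n^2) \<le> norm (of_real m * \<tau> + of_real n) ^ 2"
    using lattice_norm_lower_bound[OF assms] by blast
  have "(\<lambda>x. norm (case x of (m, n) \<Rightarrow> 1 / (of_int m * \<tau> + of_int n)^4)) summable_on UNIV"
  proof (rule Infinite_Sum.abs_summable_on_comparison_test'[OF summable_on_int_pairs_inverse[of "4 / \<delta>^2"]], clarify)
    fix m n :: int
    show "norm (1 / (of_int m * \<tau> + of_int n)^4) \<le>
      4 / \<delta>^2 * (1 / ((1 + (real_of_int m)^2) * (1 + (real_of_int n)^2)))"
    \<comment> \<open>The origin stays in the index set: its term is 1 / 0 = 0.\<close>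
    proof (cases "(m, n) = (0, 0)")
      case False
      let ?w = "of_int m * \<tau> + of_int n" and ?s = "\<delta> * (real_of_int m ^ 2 + real_of_int n ^ 2)"
      have "?s > 0" using False \<delta> by (auto simp: sum_power2_gt_zero_iff)
      moreover have "?s \<le> norm ?w ^ 2" using \<delta>(2)[of "of_int m" "of_int n"] by simp
      ultimately have "1 / (norm ?w ^ 2)^2 \<le> 1 / ?s^2"
        by (intro divide_left_mono power_mono mult_pos_pos) (auto simp: less_le_trans)
      also note lattice_inverse_bound[OF \<delta>(1) False]
      finally show ?thesis by (simp add: norm_divide norm_power)
    qed auto
  qed
  then show ?thesis using summable_on_iff_abs_summable_on_complex by blast
qed

text \<open>The sum of 1 / w^2 over the lattice does not converge absolutely. Subtracting 1 / (w^2 -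
  1/4) raises the decay to order 4, and the subtracted term equals 1 / (w - 1/2) - 1 / (w + 1/2), so
  it telescopes. The offset 1/2 keeps its poles off the integers.\<close>

lemma summable_on_G2:
  assumes "Im \<tau> > 0"
  shows "(\<lambda>(m, n). 1 / (of_int m * \<tau> + of_int n)^2 - 1 / ((of_int m * \<tau> + of_int n)^2 - 1/4)) summable_on UNIV"
proof -
  obtain \<delta> where \<delta>: "\<delta> > 0" "\<And>m n :: real. \<delta> * (m^2 + n^2) \<le> norm (of_real m * \<tau> + of_real n) ^ 2"
    using lattice_norm_lower_bound[OF assms] by blast
  have "(\<lambda>x. norm (case x of (m, n) \<Rightarrow> 1 / (of_int m * \<tau> + of_int n)^2 - 1 / ((of_int m * \<tau> + of_int n)^2 - 1/4))) summable_on UNIV"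
  \<comment> \<open>The summand 4 in the constant covers the origin, where the term is 0 - 1 / (-
    1/4) = 4.\<close>
  proof (rule Infinite_Sum.abs_summable_on_comparison_test'[OF summable_on_int_pairs_inverse[of "4 / \<delta>^2 + 4"]], clarify)
    fix m n :: int
    let ?w = "of_int m * \<tau> + of_int n" and ?s = "real_of_int m ^ 2 + real_of_int n ^ 2"
    show "norm (1 / ?w^2 - 1 / (?w^2 - 1/4)) \<le>
      (4 / \<delta>^2 + 4) * (1 / ((1 + (real_of_int m)^2) * (1 + (real_of_int n)^2)))"
    proof (cases "(m, n) = (0, 0)")
      case False
      have s: "\<delta> * ?s > 0" using False \<delta> by (auto simp: sum_power2_gt_zero_iff)
      have w: "\<delta> * ?s \<le> norm ?w ^ 2" using \<delta>(2)[of "of_int m" "of_int n"] by simp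
      \<comment> \<open>For an integer n, moving by 1/2 at most halves the absolute value; hence the
        loss of a factor 4 in the lower bound.\<close>
      have n: "(real_of_int n)^2 / 4 \<le> (real_of_int n + h)^2" if "h = 1/2 \<or> h = -1/2" for h
      proof -
        have "\<bar>real_of_int n\<bar> / 2 \<le> \<bar>real_of_int n + h\<bar>"
          using that by (cases "n \<ge> 1"; cases "n \<le> -1") auto
        from power_mono[OF this, of 2] show ?thesis by (simp add: power_divide)
      qed
      have h: "\<delta> / 4 * ?s \<le> norm (?w + of_real h) ^ 2" if "h = 1/2 \<or> h = -1/2" for h
      proof -
        have "\<delta> / 4 * ?s \<le> \<delta> * ((real_of_int m)^2 + (real_of_int n + h)^2)"
        proof -
          have "1 / 4 * ?s \<le> (real_of_int m)^2 + (real_of_int n + h)^2"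
          proof -
            have "1 / 4 * (M + N) \<le> M + K" if "N / 4 \<le> K" "0 \<le> M" for M N K :: real
              using that by (simp add: field_simps)
            from this[OF n[OF that]] show ?thesis by simp
          qed
          from mult_left_mono[OF this, of \<delta>] show ?thesis using \<delta>(1) by simp
        qed
        also have "\<dots> \<le> norm (?w + of_real h) ^ 2"
          using \<delta>(2)[of "of_int m" "of_int n + h"] by (simp add: add_ac)
        finally show ?thesis .
      qed
      have e: "?w^2 - 1/4 = (?w + of_real (1/2)) * (?w + of_real (-1/2))"
        by (simp add: power2_eq_square algebra_simps)
      have "(\<delta> / 4 * ?s) * (\<delta> / 4 * ?s) \<le> norm (?w + of_real (1/2)) ^ 2 * norm (?w + of_real (-1/2)) ^ 2"
        using s by (intro mult_mono h[OF disjI1[OF refl]] h[OF disjI2[OF refl]]) auto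
      also have "\<dots> = norm (?w^2 - 1/4)^2"
        unfolding e norm_mult by (simp add: power_mult_distrib)
      finally have "(\<delta> / 4 * ?s)^2 \<le> norm (?w^2 - 1/4)^2" by (simp add: power2_eq_square)
      then have q: "\<delta> / 4 * ?s \<le> norm (?w^2 - 1/4)" by (rule power2_le_imp_le) simp
      have s4: "0 < \<delta> / 4 * ?s" using s by simp
      have nz: "?w \<noteq> 0" "?w^2 - 1/4 \<noteq> 0"
        using less_le_trans[OF s w] less_le_trans[OF s4 q] by auto
      have "1 / ?w^2 - 1 / (?w^2 - 1/4) = - (1/4) / (?w^2 * (?w^2 - 1/4))"
        using nz by (simp add: divide_simps) (simp add: algebra_simps)?
      then have "norm (1 / ?w^2 - 1 / (?w^2 - 1/4)) = (1/4) / (norm ?w^2 * norm (?w^2 - 1/4))"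
        by (simp add: norm_divide norm_mult norm_power)
      also have "\<dots> \<le> (1/4) / (\<delta> * ?s * (\<delta> / 4 * ?s))"
        using mult_mono[OF w q] mult_pos_pos[OF s s4] s4 by (intro frac_le) auto
      also have "\<dots> = 1 / (\<delta> * ?s)^2" by (simp add: power2_eq_square field_simps)
      also have "\<dots> \<le> 4 / \<delta>^2 * (1 / ((1 + (real_of_int m)^2) * (1 + (real_of_int n)^2)))"
        by (rule lattice_inverse_bound[OF \<delta>(1) False])
      also have "\<dots> \<le> (4 / \<delta>^2 + 4) * (1 / ((1 + (real_of_int m)^2) * (1 + (real_of_int n)^2)))"
        by (intro mult_right_mono) auto
      finally show ?thesis .
    qed (use \<delta> in auto)
  qed
  then show ?thesis using summable_on_iff_abs_summable_on_complex by blast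
qed

section \<open>Elementary properties of the nome, divisor sums and Lambert series\<close>

lemma norm_nome: "norm (nome \<tau>) = exp (- 2 * pi * Im \<tau>)"
  by (simp add: nome_def norm_exp_eq_Re)

lemma norm_nome_less_1: "Im \<tau> > 0 \<Longrightarrow> norm (nome \<tau>) < 1"
  by (simp add: norm_nome)

lemma nome_add: "nome (a + b) = nome a * nome b"
  by (simp add: nome_def exp_add algebra_simps)

lemma nome_of_int [simp]: "nome (of_int n) = 1"
  by (simp add: nome_eq_1_iff)

lemma nome_1 [simp]: "nome 1 = 1"
  using nome_of_int[of 1] by simp

lemma nome_power: "nome (of_nat n * \<tau>) = nome \<tau> ^ n"
  by (simp add: nome_def exp_of_nat_mult [symmetric] algebra_simps)

lemma nome_minus: "nome (- \<tau>) = inverse (nome \<tau>)"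
  by (simp add: nome_def exp_minus)

lemma Im_neg_inverse_pos: "Im \<tau> > 0 \<Longrightarrow> Im (- 1 / \<tau>) > 0"
  by (cases \<tau>) (simp add: Im_divide sum_power2_gt_zero_iff divide_pos_pos add_nonneg_pos)

lemma not_Ints_of_Im_nonzero: "Im z \<noteq> 0 \<Longrightarrow> z \<notin> \<int>"
  by (auto elim: Ints_cases)

lemma has_sum_int_even:
  fixes g :: "int \<Rightarrow> complex"
  assumes "(g has_sum S) UNIV" "\<And>n. g (- n) = g n"
  shows "((\<lambda>k. g (int (Suc k))) has_sum ((S - g 0) / 2)) UNIV"
proof -
  have inj: "inj (\<lambda>k. int (Suc k))" by (auto simp: inj_def)
  have r: "range (\<lambda>k. int (Suc k)) = {1..}"
  proof safe
    fix x :: int assume "x \<ge> 1"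
    then have "x = int (Suc (nat (x - 1)))" by simp
    then show "x \<in> range (\<lambda>k. int (Suc k))" by blast
  qed auto
  define P where "P = infsum g {1..}"
  have P: "(g has_sum P) {1..}"
    unfolding P_def using assms(1) has_sum_imp_summable summable_on_subset_banach
    by (intro has_sum_infsum) blast
  have N: "(g has_sum P) {..-1}"
    using P by (rule has_sum_reindex_bij_witness[of _ uminus uminus, THEN iffD1, rotated -1])
      (auto simp: assms(2))
  have "(g has_sum g 0) {0}" by (rule has_sum_finiteI) auto
  from has_sum_Un_disjoint[OF this P] have "(g has_sum (g 0 + P)) ({0} \<union> {1..})" by auto
  moreover have "({0} \<union> {1..}) \<inter> {..-1::int} = {}" by auto
  ultimately have "(g has_sum (g 0 + P + P)) ({0} \<union> {1..} \<union> {..-1})"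
    using N has_sum_Un_disjoint by blast
  moreover have "{0} \<union> {1..} \<union> {..-1::int} = UNIV" by auto
  ultimately have "S = g 0 + P + P" using assms(1) has_sum_unique by metis
  moreover have "((\<lambda>k. g (int (Suc k))) has_sum P) UNIV"
    using P unfolding r[symmetric] by (subst (asm) has_sum_reindex[OF inj]) (simp add: o_def)
  ultimately show ?thesis by simp
qed

text \<open>The exponent 4 suffices throughout: sigma_k(n) is at most n^(k + 1), and only k <= 3
  occurs.\<close>

lemma summable_polynomial_times_power:
  assumes "0 \<le> x" "x < 1"
  shows "summable (\<lambda>n. real n ^ 4 * x ^ n)"
proof -
  have "conv_radius (\<lambda>n. real (Suc n) ^ 4) = ereal 1"
  proof (rule conv_radius_ratio_limit[OF refl])
    have "(\<lambda>n. norm (real (Suc n) ^ 4) / norm (real (Suc (Suc n)) ^ 4)) =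
        (\<lambda>n. (real n + 1) ^ 4 / (real n + 2) ^ 4)"
      by (simp add: add_ac)
    also have "\<dots> \<longlonglongrightarrow> 1" by real_asymp
    finally show "(\<lambda>n. norm (real (Suc n) ^ 4) / norm (real (Suc (Suc n)) ^ 4)) \<longlonglongrightarrow> 1" .
  qed auto
  then have "summable (\<lambda>n. norm (real (Suc n) ^ 4 * x ^ n))"
    using assms by (intro abs_summable_in_conv_radius) auto
  then have "summable (\<lambda>n. x * (real (Suc n) ^ 4 * x ^ n))"
    using assms by (intro summable_mult) auto
  then have "summable (\<lambda>n. real (Suc n) ^ 4 * x ^ Suc n)"
    by (simp add: algebra_simps)
  then show ?thesis by (subst (asm) summable_Suc_iff) simp
qed

text \<open>At n = 0 the index set is infinite, so the value there is 0.\<close>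

definition divisor_sigma :: "nat \<Rightarrow> nat \<Rightarrow> nat" where
  "divisor_sigma k n = (\<Sum>d | d dvd n. d ^ k)"

lemma divisor_sigma_le: "n > 0 \<Longrightarrow> divisor_sigma k n \<le> n ^ Suc k"
proof -
  assume n: "n > 0"
  have "{d. d dvd n} \<subseteq> {1..n}" using n by (auto intro: Suc_leI dvd_imp_le dest: dvd_pos_nat)
  then have "divisor_sigma k n \<le> (\<Sum>d\<in>{1..n}. d ^ k)"
    unfolding divisor_sigma_def by (intro sum_mono2) auto
  also have "\<dots> \<le> (\<Sum>d\<in>{1..n}. n ^ k)" by (intro sum_mono power_mono) auto
  finally show ?thesis by simp
qed

text \<open>The pairs (n, d) with d dividing n correspond to the pairs (m, r) by d = r and n = (m +
  1) r. Summing first over d gives the divisor sum, summing first over r gives the Lambert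
  form.\<close>

lemma Lambert_series:
  fixes x :: complex
  assumes x: "norm x < 1" and k: "k \<le> 3"
  shows "summable (\<lambda>n. norm (of_nat (divisor_sigma k (Suc n)) * x ^ Suc n))"
    and "((\<lambda>m. infsum (\<lambda>r. of_nat r ^ k * (x ^ Suc m) ^ r) {1..}) has_sum
      (\<Sum>n. of_nat (divisor_sigma k (Suc n)) * x ^ Suc n)) UNIV"
proof -
  have s4: "summable (\<lambda>n. real (Suc n) ^ 4 * norm x ^ Suc n)"
    using summable_polynomial_times_power[of "norm x"] x by (subst summable_Suc_iff) simp
  have le: "real (divisor_sigma k (Suc n)) \<le> real (Suc n) ^ 4" for n
  proof -
    have "divisor_sigma k (Suc n) \<le> Suc n ^ Suc k" by (rule divisor_sigma_le) simp
    also have "\<dots> \<le> Suc n ^ 4" using k by (intro power_increasing) auto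
    finally show ?thesis by (simp only: of_nat_power [symmetric] of_nat_le_iff)
  qed
  have ev: "\<forall>\<^sub>F n in sequentially. norm (norm (of_nat (divisor_sigma k (Suc n)) * x ^ Suc n)) \<le> real (Suc n) ^ 4 * norm x ^ Suc n"
    using le by (auto simp: norm_mult norm_power intro!: always_eventually mult_right_mono simp del: power_Suc)
  show s: "summable (\<lambda>n. norm (of_nat (divisor_sigma k (Suc n)) * x ^ Suc n))"
    by (rule summable_comparison_test_ev[OF ev s4])
  define T where "T = (\<Sum>n. of_nat (divisor_sigma k (Suc n)) * x ^ Suc n)"
  let ?g = "\<lambda>(n, d). of_nat d ^ k * x ^ n" and ?D = "Sigma {1..} (\<lambda>n::nat. {d. d dvd n})"
  have r: "range Suc = {1..}" using not0_implies_Suc by (force simp: image_iff)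
  have T: "((\<lambda>n. of_nat (divisor_sigma k n) * x ^ n) has_sum T) {1..}"
    using norm_summable_imp_has_sum[OF s summable_sums[OF summable_norm_cancel[OF s], folded T_def]]
    unfolding r[symmetric] by (subst has_sum_reindex) (auto simp: o_def)
  have "(\<lambda>z. norm (?g z)) summable_on ?D"
  proof (rule summable_on_SigmaI[where g = "\<lambda>n. of_nat (divisor_sigma k n) * norm x ^ n"])
    fix n :: nat assume "n \<in> {1..}"
    then have "finite {d. d dvd n}" by auto
    then show "((\<lambda>d. norm (?g (n, d))) has_sum of_nat (divisor_sigma k n) * norm x ^ n) {d. d dvd n}"
      by (intro has_sum_finiteI) (auto simp: divisor_sigma_def norm_mult norm_power sum_distrib_right)
  next
    show "(\<lambda>n. of_nat (divisor_sigma k n) * norm x ^ n) summable_on {1..}"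
      using s unfolding r[symmetric] by (subst summable_on_reindex)
        (auto simp: o_def norm_mult norm_power summable_on_UNIV_nonneg_real_iff simp del: power_Suc)
  qed auto
  then have gs: "?g summable_on ?D" using summable_on_iff_abs_summable_on_complex by blast
  have "((\<lambda>n. of_nat (divisor_sigma k n) * x ^ n) has_sum infsum ?g ?D) {1..}"
  proof (rule has_sum_SigmaD[OF has_sum_infsum[OF gs]])
    fix n :: nat assume "n \<in> {1..}"
    then have "finite {d. d dvd n}" by auto
    then show "((\<lambda>d. ?g (n, d)) has_sum of_nat (divisor_sigma k n) * x ^ n) {d. d dvd n}"
      by (intro has_sum_finiteI) (auto simp: divisor_sigma_def sum_distrib_right)
  qed
  then have "infsum ?g ?D = T" using T has_sum_unique by blast
  then have "(?g has_sum T) ?D" using has_sum_infsum[OF gs] by simp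
  then have A: "((\<lambda>(m, r). of_nat r ^ k * (x ^ Suc m) ^ r) has_sum T) (UNIV \<times> {1..})"
  proof (rule has_sum_reindex_bij_witness[of _ "\<lambda>(m, r). (Suc m * r, r)" "\<lambda>(n, d). (n div d - 1, d)", THEN iffD1, rotated -1])
    fix a assume "a \<in> ?D"
    then obtain n d where a: "a = (n, d)" "n \<ge> 1" "d dvd n" by auto
    then obtain e where e: "n = d * e" by auto
    then have de: "d > 0" "e > 0" using a by auto
    then obtain e' where e': "e = Suc e'" by (cases e) auto
    show "(case (case a of (n, d) \<Rightarrow> (n div d - 1, d)) of (m, r) \<Rightarrow> (Suc m * r, r)) = a"
      using e de a e' by simp
    show "(case a of (n, d) \<Rightarrow> (n div d - 1, d)) \<in> UNIV \<times> {1..}" using de a by auto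
    show "(case (case a of (n, d) \<Rightarrow> (n div d - 1, d)) of (m, r) \<Rightarrow> of_nat r ^ k * (x ^ Suc m) ^ r) = ?g a"
      using e de a e' by (simp add: power_mult [symmetric] mult.commute del: power_Suc)
  next
    fix b :: "nat \<times> nat" assume "b \<in> UNIV \<times> {1..}"
    then obtain m r where b: "b = (m, r)" "r \<ge> 1" by auto
    show "(case (case b of (m, r) \<Rightarrow> (Suc m * r, r)) of (n, d) \<Rightarrow> (n div d - 1, d)) = b"
      "(case b of (m, r) \<Rightarrow> (Suc m * r, r)) \<in> ?D"
      using b by auto
  qed (rule refl)
  show "((\<lambda>m. infsum (\<lambda>r. of_nat r ^ k * (x ^ Suc m) ^ r) {1..}) has_sum
      (\<Sum>n. of_nat (divisor_sigma k (Suc n)) * x ^ Suc n)) UNIV"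
    unfolding T_def[symmetric]
  proof (rule has_sum_SigmaD[OF A])
    fix m :: nat
    have "(\<lambda>r. of_nat r ^ k * (x ^ Suc m) ^ r) summable_on {1..}"
      using summable_on_SigmaD1[of "\<lambda>m r. of_nat r ^ k * (x ^ Suc m) ^ r" UNIV "\<lambda>_. {1..}" m] has_sum_imp_summable[OF A] by simp
    then show "((\<lambda>r. case (m, r) of (m, r) \<Rightarrow> of_nat r ^ k * (x ^ Suc m) ^ r) has_sum
        infsum (\<lambda>r. of_nat r ^ k * (x ^ Suc m) ^ r) {1..}) {1..}" by simp
  qed
qed

definition E2_fun :: "complex \<Rightarrow> complex" where
  "E2_fun \<tau> = 1 - 24 * (\<Sum>n. of_nat (divisor_sigma 1 (Suc n)) * nome \<tau> ^ Suc n)"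

definition E4_fun :: "complex \<Rightarrow> complex" where
  "E4_fun \<tau> = 1 + 240 * (\<Sum>n. of_nat (divisor_sigma 3 (Suc n)) * nome \<tau> ^ Suc n)"

text \<open>Closed forms of the inner Lambert sums, matching the right-hand sides of the Lipschitz
  formulas. An index shift expresses (1 - x) times the sum with n^k through the sums with smaller
  exponents.\<close>

lemma infsum_n_power:
  fixes x :: complex
  assumes "norm x < 1"
  shows "infsum (\<lambda>r. of_nat r * x ^ r) {1..} = x / (1 - x)^2"
    and "infsum (\<lambda>r. of_nat r ^ 3 * x ^ r) {1..} = x * (1 + 4 * x + x^2) / (1 - x)^4"
proof -
  have x: "1 - x \<noteq> 0" using assms by auto
  have s: "summable (\<lambda>n. norm (of_nat n ^ k * x ^ n))" if "k \<le> 3" for k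
  proof (rule summable_comparison_test_ev[OF _ summable_polynomial_times_power[of "norm x"]])
    show "\<forall>\<^sub>F n in sequentially. norm (norm (of_nat n ^ k * x ^ n)) \<le> real n ^ 4 * norm x ^ n"
      using eventually_ge_at_top[of 1]
      by eventually_elim (use that in \<open>auto simp: norm_mult norm_power intro!: mult_right_mono power_increasing\<close>)
  qed (use assms in auto)
  have hs: "((\<lambda>n. of_nat n ^ k * x ^ n) has_sum (\<Sum>n. of_nat n ^ k * x ^ n)) UNIV" if "k \<le> 3" for k
    using norm_summable_imp_has_sum[OF s[OF that]] summable_norm_cancel[OF s[OF that]] by blast
  have inf: "infsum (\<lambda>n. of_nat n ^ k * x ^ n) {1..} = (\<Sum>n. of_nat n ^ k * x ^ n)" if "k \<le> 3" "k > 0" for k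
  proof -
    have "infsum (\<lambda>n. of_nat n ^ k * x ^ n) {1..} = infsum (\<lambda>n. of_nat n ^ k * x ^ n) UNIV"
      by (rule infsum_cong_neutral) (use that in auto)
    then show ?thesis using hs[OF that(1)] infsumI by metis
  qed
  let ?S = "\<lambda>k. (\<Sum>n. of_nat n ^ k * x ^ n)"
  have su: "summable (\<lambda>n. of_nat n ^ k * x ^ n)" if "k \<le> 3" for k by (rule summable_norm_cancel[OF s[OF that]])
  have S0: "?S 0 = 1 / (1 - x)" using suminf_geometric[OF assms] by simp
  \<comment> \<open>\<open>0 ^ k\<close> is the term n = 0 that the shift splits off; it is nonzero
    only for k = 0.\<close>
  have shift: "?S k = (0::complex) ^ k + x * (\<Sum>n. (of_nat n + 1) ^ k * x ^ n)" if "k \<le> 3" for k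
  proof -
    have "(\<lambda>n. of_nat (Suc n) ^ k * x ^ Suc n) sums (?S k - 0 ^ k)"
      using sums_split_initial_segment[OF summable_sums[OF su[OF that]], of 1] by (simp add: power_0_left)
    then have "(\<Sum>n. x * ((of_nat n + 1) ^ k * x ^ n)) = ?S k - 0 ^ k"
      by (intro sums_unique[symmetric]) (simp add: algebra_simps)
    moreover have "summable (\<lambda>n. (of_nat n + 1) ^ k * x ^ n)"
    proof (cases "x = 0")
      case False
      from su[OF that] have "summable (\<lambda>n. of_nat (Suc n) ^ k * x ^ Suc n)" by (subst summable_Suc_iff)
      then have "summable (\<lambda>n. inverse x * (of_nat (Suc n) ^ k * x ^ Suc n))" by (rule summable_mult)
      then show ?thesis using False by (simp add: field_simps)
    next
      case True
      show ?thesis unfolding True by (rule summable_finite[of "{0}"]) auto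
    qed
    ultimately show ?thesis by (simp add: suminf_mult)
  qed
  have b1: "(\<Sum>n. (of_nat n + 1) ^ 1 * x ^ n) = ?S 1 + ?S 0"
    using suminf_add[OF su[of 1] su[of 0]] by (simp add: algebra_simps)
  have b2: "(\<Sum>n. (of_nat n + 1) ^ 2 * x ^ n) = ?S 2 + 2 * ?S 1 + ?S 0"
  proof -
    have "(\<Sum>n. (of_nat n + 1) ^ 2 * x ^ n) = (\<Sum>n. of_nat n ^ 2 * x ^ n + 2 * (of_nat n ^ 1 * x ^ n) + of_nat n ^ 0 * x ^ n)"
      by (intro suminf_cong) (simp add: power2_eq_square algebra_simps)
    also have "\<dots> = ?S 2 + 2 * ?S 1 + ?S 0"
      by (intro sums_unique[symmetric] sums_add sums_mult summable_sums su) auto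
    finally show ?thesis .
  qed
  have b3: "(\<Sum>n. (of_nat n + 1) ^ 3 * x ^ n) = ?S 3 + 3 * ?S 2 + 3 * ?S 1 + ?S 0"
  proof -
    have "(\<Sum>n. (of_nat n + 1) ^ 3 * x ^ n) = (\<Sum>n. of_nat n ^ 3 * x ^ n + 3 * (of_nat n ^ 2 * x ^ n) + 3 * (of_nat n ^ 1 * x ^ n) + of_nat n ^ 0 * x ^ n)"
      by (intro suminf_cong) (simp add: power2_eq_square power3_eq_cube algebra_simps)
    also have "\<dots> = ?S 3 + 3 * ?S 2 + 3 * ?S 1 + ?S 0"
      by (intro sums_unique[symmetric] sums_add sums_mult summable_sums su) auto
    finally show ?thesis .
  qed
  define u where "u = 1 - x"
  have u: "u \<noteq> 0" using x by (auto simp: u_def)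
  have canc: "S = T / u" if "(1 - x) * S = T" for S T
    using that u unfolding u_def[symmetric] by (simp add: field_simps)
  have "(1 - x) * ?S 1 = x * ?S 0" using shift[of 1] unfolding b1 by (simp add: algebra_simps)
  from canc[OF this] have S1: "?S 1 = x / u^2" unfolding S0 by (simp add: u_def power2_eq_square)
  have "(1 - x) * ?S 2 = x * (2 * ?S 1 + ?S 0)" using shift[of 2] unfolding b2 by (simp add: algebra_simps)
  from canc[OF this] have "?S 2 = x * (2 * x / u^2 + 1 / u) / u" unfolding S0 S1 by (simp add: u_def)
  also have "2 * x / u^2 + 1 / u = (2 * x + u) / u^2" using u by (simp add: field_simps power2_eq_square)
  finally have S2: "?S 2 = x * (1 + x) / u^3" by (simp add: u_def power2_eq_square power3_eq_cube)
  have "(1 - x) * ?S 3 = x * (3 * ?S 2 + 3 * ?S 1 + ?S 0)" using shift[of 3] unfolding b3 by (simp add: algebra_simps)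
  from canc[OF this] have "?S 3 = x * (3 * (x * (1 + x) / u^3) + 3 * (x / u^2) + 1 / u) / u" unfolding S0 S1 S2 by (simp add: u_def)
  also have "3 * (x * (1 + x) / u^3) + 3 * (x / u^2) + 1 / u = (3 * x * (1 + x) + 3 * x * u + u^2) / u^3"
    using u by (simp add: divide_simps power2_eq_square power3_eq_cube)
  also have "3 * x * (1 + x) + 3 * x * u + u^2 = 1 + 4 * x + x^2"
    by (simp add: u_def power2_eq_square algebra_simps)
  finally have S3: "?S 3 = x * (1 + 4 * x + x^2) / (1 - x)^4" by (simp add: u_def eval_nat_numeral)
  show "infsum (\<lambda>r. of_nat r * x ^ r) {1..} = x / (1 - x)^2" using inf[of 1] S1 by (simp add: u_def)
  show "infsum (\<lambda>r. of_nat r ^ 3 * x ^ r) {1..} = x * (1 + 4 * x + x^2) / (1 - x)^4" using inf[of 3] S3 by simp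
qed

section \<open>Eisenstein series of weight 4 as lattice sums\<close>

lemma lattice_not_Ints:
  assumes "Im \<tau> > 0" "m \<noteq> 0"
  shows "of_int m * \<tau> \<notin> \<int>"
  using assms by (intro not_Ints_of_Im_nonzero) auto

lemma has_sum_lattice_row_even:
  fixes \<tau> :: complex
  assumes "\<And>m. ((\<lambda>n. 1 / (of_int m * \<tau> + of_int n)^p) has_sum g m) (UNIV :: int set)" "even p"
  shows "g (- m) = g (m :: int)"
proof -
  have "((\<lambda>n. 1 / (of_int m * \<tau> + of_int n)^p) has_sum g (- m)) (UNIV :: int set)"
  proof (rule has_sum_reindex_bij_witness[of _ uminus uminus, THEN iffD1, OF _ _ _ _ _ _ assms(1)[of "- m"]])
    fix n :: int
    have "of_int m * \<tau> + of_int (- n) = - (of_int (- m) * \<tau> + of_int n)" by simp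
    then show "1 / (of_int m * \<tau> + of_int (- n))^p = 1 / (of_int (- m) * \<tau> + of_int n)^p"
      using \<open>even p\<close> by (metis power_minus_even)
  qed auto
  then show ?thesis by (rule has_sum_unique) (rule assms(1))
qed

lemma has_sum_inverse_powers_int:
  "((\<lambda>n::int. 1 / of_int n ^ 2) has_sum (of_real pi ^ 2 / 3 :: complex)) (UNIV :: int set)" (is ?thesis2)
  "((\<lambda>n::int. 1 / of_int n ^ 4) has_sum (of_real pi ^ 4 / 45 :: complex)) (UNIV :: int set)" (is ?thesis4)
proof -
  \<comment> \<open>The sum over half integers is known; it is the sum over all odd multiples of \<open>1/2\<close>.\<close>
  have half: "(1/2 :: complex) \<notin> \<int>" using fraction_not_in_Ints[of 2 1] by simp
  have n: "nome (1/2) = - 1" by (simp add: nome_def)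
  have main: "((\<lambda>n::int. 1 / of_int n ^ p) has_sum S) (UNIV :: int set)"
    if h: "((\<lambda>n::int. 1 / (1/2 + of_int n)^p) has_sum H) UNIV" and p: "p \<ge> 2" "even p"
      and S: "S * (2 ^ p - 1) = H" for p :: nat and S H :: complex
  proof -
    define f where "f = (\<lambda>n::int. 1 / (of_int n :: complex) ^ p)"
    have odd: "(f has_sum (H / 2 ^ p)) {n. odd n}"
    proof (rule has_sum_reindex_bij_witness[of _ "\<lambda>n. (n - 1) div 2" "\<lambda>n. 2 * n + 1", THEN iffD1,
          OF _ _ _ _ _ _ has_sum_cmult_right[OF h, of "1 / 2 ^ p"]])
      fix n :: int
      have "(2 :: complex) * (1/2 + of_int n) = of_int (2 * n + 1)" by simp
      then show "f (2 * n + 1) = 1 / 2 ^ p * (1 / (1/2 + of_int n)^p)"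
        unfolding f_def by (metis mult_1 times_divide_times_eq power_mult_distrib)
    qed auto
    define A where "A = infsum f UNIV"
    have "f summable_on UNIV"
    proof -
      have "(\<lambda>n. norm (f n)) summable_on UNIV - {0}"
      proof (rule Infinite_Sum.abs_summable_on_comparison_test')
        show "(\<lambda>n. 2 * norm (1 / (\<i> + of_int n) ^ 2)) summable_on UNIV - {0}"
          by (intro summable_on_cmult_right summable_on_subset_banach[OF summable_on_int_shifted_inverse_power(1)]) auto
        fix n :: int assume "n \<in> UNIV - {0}"
        then have n: "n \<noteq> 0" by simp
        then have "1 \<le> \<bar>real_of_int n\<bar>" by linarith
        then have "\<bar>real_of_int n\<bar> ^ 2 \<le> \<bar>real_of_int n\<bar> ^ p" "1 \<le> \<bar>real_of_int n\<bar> ^ 2"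
          using p by (intro power_increasing one_le_power; simp)+
        then have "1 + (\<bar>real_of_int n\<bar>)^2 \<le> 2 * \<bar>real_of_int n\<bar> ^ p" "1 \<le> \<bar>real_of_int n\<bar> ^ p" by linarith+
        moreover have "b > 0 \<Longrightarrow> a \<ge> 1 \<Longrightarrow> b \<le> 2 * a \<Longrightarrow> 1 / a \<le> 2 * (1 / b)" for a b :: real
          by (simp add: divide_simps)
        ultimately have "1 / \<bar>real_of_int n\<bar> ^ p \<le> 2 * (1 / (1 + (\<bar>real_of_int n\<bar>)^2))"
          by (metis add_pos_nonneg zero_less_one zero_le_power2)
        then show "norm (f n) \<le> 2 * norm (1 / (\<i> + of_int n) ^ 2)"
          unfolding f_def by (simp add: norm_divide norm_power cmod_power2 add.commute)
      qed
      then have "f summable_on UNIV - {0}" using summable_on_iff_abs_summable_on_complex by blast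
      then have "f summable_on insert 0 (UNIV - {0})" by (subst summable_on_insert_iff)
      moreover have "insert 0 (UNIV - {0}) = (UNIV :: int set)" by auto
      ultimately show ?thesis by simp
    qed
    then have A: "(f has_sum A) UNIV" by (simp add: A_def)
    have even: "(f has_sum (A / 2 ^ p)) {n. even n}"
    proof (rule has_sum_reindex_bij_witness[of _ "\<lambda>n. n div 2" "\<lambda>n. 2 * n", THEN iffD1,
          OF _ _ _ _ _ _ has_sum_cmult_right[OF A, of "1 / 2 ^ p"]])
      fix n :: int
      show "f (2 * n) = 1 / 2 ^ p * f n" unfolding f_def by (simp add: power_mult_distrib)
    qed auto
    have "(f has_sum (A / 2 ^ p + H / 2 ^ p)) ({n. even n} \<union> {n. odd n})"
      by (rule has_sum_Un_disjoint[OF even odd]) auto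
    moreover have "{n::int. even n} \<union> {n. odd n} = UNIV" by auto
    ultimately have "A = A / 2 ^ p + H / 2 ^ p" using A has_sum_unique by metis
    then have "A * (2 ^ p - 1) = H" by (simp add: field_simps)
    moreover have "(2 :: complex) ^ p - 1 \<noteq> 0"
    proof -
      have "(2 :: nat) ^ p \<noteq> 1" using p by simp
      then have "(of_nat (2 ^ p) :: complex) \<noteq> of_nat 1" using of_nat_eq_iff by blast
      then show ?thesis by simp
    qed
    ultimately have "A = S" using S by (metis mult_right_cancel)
    then show ?thesis using A unfolding f_def by simp
  qed
  show ?thesis2 by (rule main[OF Lipschitz_formula(1)[OF half]]) (simp_all add: n)
  show ?thesis4 by (rule main[OF Lipschitz_formula(2)[OF half]]) (simp_all add: n)
qed

text \<open>The row m = 0 contributes 2 zeta(4) = pi^4 / 45. The rows m and - m agree, and the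
  Lipschitz formula turns a row m > 0 into a power series in q^m; their sum over m is a Lambert
  series.\<close>

lemma E4_lattice:
  assumes "Im \<tau> > 0"
  shows "infsum (\<lambda>(m, n). 1 / (of_int m * \<tau> + of_int n)^4) (UNIV :: (int \<times> int) set) =
    of_real pi ^ 4 / 45 * E4_fun \<tau>"
proof -
  define F where "F = infsum (\<lambda>(m, n). 1 / (of_int m * \<tau> + of_int n)^4) (UNIV :: (int \<times> int) set)"
  have F: "((\<lambda>(m, n). 1 / (of_int m * \<tau> + of_int n)^4) has_sum F) ((UNIV :: int set) \<times> (UNIV :: int set))"
    unfolding F_def using summable_on_G4[OF assms] by simp
  define g where "g = (\<lambda>m::int. infsum (\<lambda>n::int. 1 / (of_int m * \<tau> + of_int n)^4) UNIV)"
  have g: "((\<lambda>n. 1 / (of_int m * \<tau> + of_int n)^4) has_sum g m) UNIV" for m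
    unfolding g_def using summable_on_SigmaD1[OF has_sum_imp_summable[OF F], of m] by simp
  have "(g has_sum F) UNIV"
    by (rule has_sum_SigmaD[OF F]) (use g in auto)
  from has_sum_int_even[OF this has_sum_lattice_row_even[OF g]]
  have 1: "((\<lambda>k. g (int (Suc k))) has_sum (F - g 0) / 2) UNIV" by simp
  have g0: "g 0 = of_real pi ^ 4 / 45"
    by (rule has_sum_unique[OF _ has_sum_inverse_powers_int(2)]) (use g[of 0] in simp)
  have "g (int (Suc k)) = 8 / 3 * of_real pi ^ 4 * infsum (\<lambda>r. of_nat r ^ 3 * (nome \<tau> ^ Suc k) ^ r) {1..}" for k
  proof -
    let ?z = "of_int (int (Suc k)) * \<tau>"
    have "?z \<notin> \<int>" by (rule lattice_not_Ints[OF assms]) simp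
    note L = Lipschitz_formula(2)[OF this]
    have "g (int (Suc k)) = 8 / 3 * of_real pi ^ 4 * nome ?z * (1 + 4 * nome ?z + nome ?z ^ 2) / (1 - nome ?z)^4"
      by (rule has_sum_unique[OF g L])
    moreover have "nome ?z = nome \<tau> ^ Suc k" using nome_power[of "Suc k" \<tau>] by simp
    moreover have "norm (nome \<tau> ^ Suc k) < 1"
      using norm_nome_less_1[OF assms] by (simp add: norm_power power_less_one_iff del: power_Suc)
    ultimately show ?thesis using infsum_n_power(2)[of "nome \<tau> ^ Suc k"] by (simp only: times_divide_eq_right mult.assoc)
  qed
  then have "((\<lambda>k. 8 / 3 * of_real pi ^ 4 * infsum (\<lambda>r. of_nat r ^ 3 * (nome \<tau> ^ Suc k) ^ r) {1..}) has_sum (F - g 0) / 2) UNIV"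
    using 1 by presburger
  moreover have "((\<lambda>k. 8 / 3 * of_real pi ^ 4 * infsum (\<lambda>r. of_nat r ^ 3 * (nome \<tau> ^ Suc k) ^ r) {1..}) has_sum
     8 / 3 * of_real pi ^ 4 * (\<Sum>n. of_nat (divisor_sigma 3 (Suc n)) * nome \<tau> ^ Suc n)) UNIV"
    by (intro has_sum_cmult_right Lambert_series norm_nome_less_1 assms) simp
  ultimately have "(F - g 0) / 2 = 8 / 3 * of_real pi ^ 4 * (\<Sum>n. of_nat (divisor_sigma 3 (Suc n)) * nome \<tau> ^ Suc n)"
    by (rule has_sum_unique)
  moreover have "F = g 0 + 16 / 3 * of_real pi ^ 4 * T" if "(F - g 0) / 2 = 8 / 3 * of_real pi ^ 4 * T" for T
    using that by (simp add: field_simps)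
  ultimately have "F = g 0 + 16 / 3 * of_real pi ^ 4 * (\<Sum>n. of_nat (divisor_sigma 3 (Suc n)) * nome \<tau> ^ Suc n)"
    by blast
  then show ?thesis unfolding F_def[symmetric] E4_fun_def g0 by (simp add: algebra_simps)
qed

text \<open>The lattice of - 1 / tau is the lattice of tau divided by tau, and absolute convergence
  permits the reindexing.\<close>

lemma E4_fun_neg_inverse:
  assumes "Im \<tau> > 0"
  shows "E4_fun (- 1 / \<tau>) = \<tau> ^ 4 * E4_fun \<tau>"
proof -
  have t: "\<tau> \<noteq> 0" using assms by auto
  have "infsum (\<lambda>(m, n). 1 / (of_int m * (- 1 / \<tau>) + of_int n)^4) (UNIV :: (int \<times> int) set) =
     infsum (\<lambda>(m, n). \<tau> ^ 4 * (1 / (of_int m * \<tau> + of_int n)^4)) UNIV"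
  proof (rule infsum_reindex_bij_witness[of _ "\<lambda>(m, n). (- n, m)" "\<lambda>(m, n). (n, - m)"], goal_cases)
    case (5 a)
    obtain m n where a: "a = (m, n)" by force
    have "of_int m * (- 1 / \<tau>) + of_int n = (of_int n * \<tau> + of_int (- m)) / \<tau>"
      using t by (simp add: field_simps)
    then show ?case unfolding a by (simp only: prod.case power_divide) simp
  qed auto
  also have "\<dots> = \<tau> ^ 4 * infsum (\<lambda>(m, n). 1 / (of_int m * \<tau> + of_int n)^4) UNIV"
    by (subst infsum_cmult_right'[symmetric]) (simp add: case_prod_unfold)
  finally show ?thesis
    unfolding E4_lattice[OF assms] E4_lattice[OF Im_neg_inverse_pos[OF assms]] by simp
qed

section \<open>The transformation law of E_2\<close>

lemma nome_half_shift: "nome (z - 1/2) = nome (z + 1/2)"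
  using nome_add[of "z - 1/2" 1] by (simp add: algebra_simps)

lemma has_sum_diff:
  fixes f g :: "'a \<Rightarrow> complex"
  assumes "(f has_sum a) A" "(g has_sum b) A"
  shows "((\<lambda>x. f x - g x) has_sum (a - b)) A"
  using has_sum_add[OF assms(1), of "\<lambda>x. - g x" "- b"] assms(2) by (simp add: has_sum_uminus)

lemma not_Ints_add_nonzero:
  fixes z :: complex
  assumes "z \<notin> \<int>"
  shows "z + of_int n \<noteq> 0"
proof
  assume "z + of_int n = 0"
  then have "z = of_int (- n)" by (simp add: eq_neg_iff_add_eq_0)
  with assms show False by simp
qed

lemma inverse_square_minus_quarter:
  fixes w :: complex
  assumes "w - 1/2 \<noteq> 0" "w + 1/2 \<noteq> 0"
  shows "1 / (w^2 - 1/4) = 1 / (w - 1/2) - 1 / (w + 1/2)"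
proof -
  have "w^2 - 1/4 = (w - 1/2) * (w + 1/2)" by (simp add: power2_eq_square algebra_simps)
  then show ?thesis using assms by (simp only:) (simp add: divide_simps)
qed

text \<open>Along a row the subtracted terms telescope to 0, because the nome agrees at z - 1/2 and
  z + 1/2. So the correction makes the double series absolutely convergent without changing its row
  sums.\<close>

lemma E2_lattice:
  assumes "Im \<tau> > 0"
  defines "b \<equiv> (\<lambda>m n :: int. 1 / (of_int m * \<tau> + of_int n)^2 - 1 / ((of_int m * \<tau> + of_int n)^2 - 1/4))"
  shows "((\<lambda>(m, n). b m n) has_sum (of_real pi ^ 2 / 3 * E2_fun \<tau>)) (UNIV \<times> UNIV)"
    and "((\<lambda>m. infsum (\<lambda>n. 1 / (of_int m * \<tau> + of_int n)^2) (UNIV :: int set)) has_sum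
      (of_real pi ^ 2 / 3 * E2_fun \<tau>)) (UNIV :: int set)"
proof -
  define F where "F = infsum (\<lambda>(m, n). b m n) (UNIV \<times> UNIV)"
  have F: "((\<lambda>(m, n). b m n) has_sum F) (UNIV \<times> UNIV)"
    unfolding F_def using summable_on_G2[OF assms(1)] by (simp add: b_def)
  define g where "g = (\<lambda>m::int. infsum (\<lambda>n::int. 1 / (of_int m * \<tau> + of_int n)^2) UNIV)"
  have ni: "of_int m * \<tau> - 1/2 \<notin> \<int>" "of_int m * \<tau> + 1/2 \<notin> \<int>" for m :: int
  proof -
    have h: "(1/2 :: complex) \<notin> \<int>" using fraction_not_in_Ints[of 2 1] by simp
    show "of_int m * \<tau> + 1/2 \<notin> \<int>"
    proof (cases "m = 0")
      case False
      then show ?thesis using assms(1) by (intro not_Ints_of_Im_nonzero) auto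
    qed (use h in simp)
    then show "of_int m * \<tau> - 1/2 \<notin> \<int>"
      using Ints_add[of "of_int m * \<tau> - 1/2" 1] by (auto simp: algebra_simps)
  qed
  have a: "((\<lambda>n. 1 / ((of_int m * \<tau> + of_int n)^2 - 1/4)) has_sum 0) (UNIV :: int set)" for m :: int
  proof -
    have "((\<lambda>n::int. 1 / (of_int m * \<tau> - 1/2 + of_int n) - 1 / (of_int m * \<tau> + 1/2 + of_int n)) has_sum 0) UNIV"
      using cot_difference_has_sum[OF ni[of m]] unfolding nome_half_shift by simp
    moreover have "1 / ((of_int m * \<tau> + of_int n)^2 - 1/4) =
        1 / (of_int m * \<tau> - 1/2 + of_int n) - 1 / (of_int m * \<tau> + 1/2 + of_int n)" for n :: int
    proof -
      have "of_int m * \<tau> + of_int n - 1/2 \<noteq> 0" "of_int m * \<tau> + of_int n + 1/2 \<noteq> 0"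
        using not_Ints_add_nonzero[OF ni(1)[of m], of n] not_Ints_add_nonzero[OF ni(2)[of m], of n]
        by (simp_all add: algebra_simps)
      from inverse_square_minus_quarter[OF this] show ?thesis by (simp add: algebra_simps)
    qed
    ultimately show ?thesis by simp
  qed
  have gs: "((\<lambda>n. 1 / (of_int m * \<tau> + of_int n)^2) has_sum g m) UNIV" for m
  proof -
    have "b m summable_on UNIV"
      using summable_on_SigmaD1[OF has_sum_imp_summable[OF F], of m] by simp
    from summable_on_add[OF this has_sum_imp_summable[OF a[of m]]]
    show ?thesis unfolding b_def g_def by simp
  qed
  have "((\<lambda>n. b m n) has_sum g m) UNIV" for m
    using has_sum_diff[OF gs[of m] a[of m]] unfolding b_def by simp
  then have gF: "(g has_sum F) UNIV"
    by (intro has_sum_SigmaD[OF F]) auto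
  from has_sum_int_even[OF this has_sum_lattice_row_even[OF gs]]
  have 1: "((\<lambda>k. g (int (Suc k))) has_sum (F - g 0) / 2) UNIV" by simp
  have g0: "g 0 = of_real pi ^ 2 / 3"
    by (rule has_sum_unique[OF _ has_sum_inverse_powers_int(1)]) (use gs[of 0] in simp)
  have "g (int (Suc k)) = - 4 * of_real pi ^ 2 * infsum (\<lambda>r. of_nat r ^ 1 * (nome \<tau> ^ Suc k) ^ r) {1..}" for k
  proof -
    let ?z = "of_int (int (Suc k)) * \<tau>"
    have "?z \<notin> \<int>" by (rule lattice_not_Ints[OF assms(1)]) simp
    note L = Lipschitz_formula(1)[OF this]
    have "g (int (Suc k)) = - 4 * of_real pi ^ 2 * nome ?z / (1 - nome ?z)^2"
      by (rule has_sum_unique[OF gs L])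
    moreover have "nome ?z = nome \<tau> ^ Suc k" using nome_power[of "Suc k" \<tau>] by simp
    moreover have "norm (nome \<tau> ^ Suc k) < 1"
      using norm_nome_less_1[OF assms(1)] by (simp add: norm_power power_less_one_iff del: power_Suc)
    ultimately show ?thesis using infsum_n_power(1)[of "nome \<tau> ^ Suc k"] by (simp only: times_divide_eq_right mult.assoc power_one_right)
  qed
  then have "((\<lambda>k. - 4 * of_real pi ^ 2 * infsum (\<lambda>r. of_nat r ^ 1 * (nome \<tau> ^ Suc k) ^ r) {1..}) has_sum (F - g 0) / 2) UNIV"
    using 1 by presburger
  moreover have "((\<lambda>k. - 4 * of_real pi ^ 2 * infsum (\<lambda>r. of_nat r ^ 1 * (nome \<tau> ^ Suc k) ^ r) {1..}) has_sum
     - 4 * of_real pi ^ 2 * (\<Sum>n. of_nat (divisor_sigma 1 (Suc n)) * nome \<tau> ^ Suc n)) UNIV"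
    by (intro has_sum_cmult_right Lambert_series norm_nome_less_1 assms) simp
  ultimately have "(F - g 0) / 2 = - 4 * of_real pi ^ 2 * (\<Sum>n. of_nat (divisor_sigma 1 (Suc n)) * nome \<tau> ^ Suc n)"
    by (rule has_sum_unique)
  then have "F = g 0 - 8 * of_real pi ^ 2 * (\<Sum>n. of_nat (divisor_sigma 1 (Suc n)) * nome \<tau> ^ Suc n)"
    by (simp add: diff_eq_eq)
  then have Feq: "F = of_real pi ^ 2 / 3 * E2_fun \<tau>" unfolding E2_fun_def g0 by (simp add: algebra_simps)
  show "((\<lambda>(m, n). b m n) has_sum (of_real pi ^ 2 / 3 * E2_fun \<tau>)) (UNIV \<times> UNIV)"
    "((\<lambda>m. infsum (\<lambda>n. 1 / (of_int m * \<tau> + of_int n)^2) (UNIV :: int set)) has_sum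
      (of_real pi ^ 2 / 3 * E2_fun \<tau>)) (UNIV :: int set)"
    using F gF unfolding g_def Feq by - (assumption+)
qed

text \<open>An unconditional sum may be evaluated along symmetric intervals, on which a telescoping
  series has explicit partial sums.\<close>

lemma has_sum_int_symmetric_limit:
  fixes f :: "int \<Rightarrow> complex"
  assumes "(f has_sum S) UNIV"
  shows "(\<lambda>N. \<Sum>n\<in>{- int N..int N}. f n) \<longlonglongrightarrow> S"
proof -
  have "filterlim (\<lambda>N. {- int N..int N}) (finite_subsets_at_top UNIV) sequentially"
    unfolding filterlim_finite_subsets_at_top
  proof (intro allI impI)
    fix X :: "int set" assume X: "finite X \<and> X \<subseteq> UNIV"
    define M where "M = Max (insert 0 ((\<lambda>x. nat \<bar>x\<bar>) ` X))"
    have M: "nat \<bar>x\<bar> \<le> M" if "x \<in> X" for x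
      unfolding M_def using X that by (intro Max_ge) auto
    show "\<forall>\<^sub>F N in sequentially. finite {- int N..int N} \<and> X \<subseteq> {- int N..int N} \<and> {- int N..int N} \<subseteq> UNIV"
      using eventually_ge_at_top[of M]
    proof eventually_elim
      case (elim N)
      have "- int N \<le> x \<and> x \<le> int N" if "x \<in> X" for x
        using M[OF that] elim by linarith
      then show ?case by auto
    qed
  qed
  from filterlim_compose[OF assms[unfolded has_sum_def] this] show ?thesis by simp
qed

text \<open>The same double series is now summed by columns. There the subtracted terms no longer
  cancel within each column; they telescope from one column to the next, and their total - 2 pi i /
  tau is the source of the non-modular term.\<close>

lemma E2_fun_neg_inverse:
  assumes t: "Im \<tau> > 0"
  shows "E2_fun (- 1 / \<tau>) = \<tau>^2 * E2_fun \<tau> - 6 * \<i> / of_real pi * \<tau>"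
proof -
  have t0: "\<tau> \<noteq> 0" using t by auto
  define W where "W = (\<lambda>z. - of_real pi * \<i> * (1 + nome z) / (1 - nome z))"
  define A where "A = of_real pi ^ 2 / 3 * E2_fun \<tau>"
  define A' where "A' = of_real pi ^ 2 / 3 * E2_fun (- 1 / \<tau>)"
  let ?b = "\<lambda>m n :: int. 1 / (of_int m * \<tau> + of_int n)^2 - 1 / ((of_int m * \<tau> + of_int n)^2 - 1/4)"
  \<comment> \<open>\<open>h n\<close> and \<open>h (n + 1)\<close> are the two end points (n - 1/2)
    / tau and (n + 1/2) / tau of the column n, so adjacent columns share an end point.\<close>
  define h where "h = (\<lambda>n::int. (of_int n - 1/2) / \<tau>)"
  have cross: "1 / (of_int m * \<tau> + of_int n)^2 = 1 / \<tau>^2 * (1 / (of_int n * (- 1 / \<tau>) + of_int (- m))^2)" for m n :: int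
  proof -
    have "of_int m * \<tau> + of_int n = - \<tau> * (of_int n * (- 1 / \<tau>) + of_int (- m))"
      using t0 by (simp add: field_simps)
    then have "(of_int m * \<tau> + of_int n)^2 = \<tau>^2 * (of_int n * (- 1 / \<tau>) + of_int (- m))^2"
      by (simp only: power_mult_distrib power2_minus)
    then show ?thesis by simp
  qed
  have swap: "((\<lambda>(n, m). ?b m n) has_sum A) (UNIV \<times> UNIV)"
    using E2_lattice(1)[OF t] unfolding A_def by (subst has_sum_swap) simp
  define r where "r = (\<lambda>n::int. infsum (\<lambda>m. 1 / (of_int n * (- 1 / \<tau>) + of_int m)^2) (UNIV :: int set))"
  have rA: "(r has_sum A') UNIV"
    unfolding r_def A'_def by (rule E2_lattice(2)[OF Im_neg_inverse_pos[OF t]])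
  have col: "((\<lambda>m. 1 / (of_int m * \<tau> + of_int n)^2) has_sum (1 / \<tau>^2 * r n)) (UNIV :: int set)" for n :: int
  proof -
    have "((\<lambda>m. 1 / (of_int n * (- 1 / \<tau>) + of_int m)^2) has_sum r n) (UNIV :: int set)"
      unfolding r_def by (intro has_sum_infsum has_sum_imp_summable[OF has_sum_int_shifted_inverse_power]) simp
    from has_sum_cmult_right[OF this, of "1 / \<tau>^2"]
    show ?thesis
    proof (rule has_sum_reindex_bij_witness[of _ uminus uminus, THEN iffD1, rotated -1])
      fix m :: int
      show "1 / (of_int (- m) * \<tau> + of_int n)^2 = 1 / \<tau>^2 * (1 / (of_int n * (- 1 / \<tau>) + of_int m)^2)"
        using cross[of "- m" n] by (simp only: minus_minus)
    qed auto
  qed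
  have hI: "h n \<notin> \<int>" for n
  proof (rule not_Ints_of_Im_nonzero)
    have "Re (of_int n - 1/2 :: complex) \<noteq> 0"
    proof
      assume "Re (of_int n - 1/2 :: complex) = 0"
      then have "2 * real_of_int n = 1" by simp
      then have "2 * n = 1" by linarith
      then show False by presburger
    qed
    then show "Im (h n) \<noteq> 0"
      using t t0 unfolding h_def by (auto simp: Im_divide sum_power2_eq_zero_iff complex_eq_iff)
  qed
  have a: "((\<lambda>m. 1 / ((of_int m * \<tau> + of_int n)^2 - 1/4)) has_sum (1 / \<tau> * (W (h n) - W (h (n + 1))))) (UNIV :: int set)" for n :: int
  proof -
    have "1 / \<tau> * (1 / (h n + of_int m) - 1 / (h (n + 1) + of_int m)) = 1 / ((of_int m * \<tau> + of_int n)^2 - 1/4)" for m :: int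
    proof -
      have e: "h n + of_int m = (of_int m * \<tau> + of_int n - 1/2) / \<tau>" "h (n + 1) + of_int m = (of_int m * \<tau> + of_int n + 1/2) / \<tau>"
        unfolding h_def using t0 by (simp_all add: field_simps)
      have "h n + of_int m \<noteq> 0" "h (n + 1) + of_int m \<noteq> 0"
        using hI by (simp_all add: not_Ints_add_nonzero)
      then have nz: "of_int m * \<tau> + of_int n - 1/2 \<noteq> 0" "of_int m * \<tau> + of_int n + 1/2 \<noteq> 0"
        unfolding e by auto
      show ?thesis
        unfolding e inverse_square_minus_quarter[OF nz] using t0 by (simp add: right_diff_distrib)
    qed
    then show ?thesis
      using has_sum_cmult_right[OF cot_difference_has_sum[OF hI[of n] hI[of "n + 1"]], of "1 / \<tau>"]
      unfolding W_def by simp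
  qed
  define \<alpha> where "\<alpha> = (\<lambda>n. 1 / \<tau> * (W (h n) - W (h (n + 1))))"
  have "((\<lambda>n. 1 / \<tau>^2 * r n - \<alpha> n) has_sum A) UNIV"
    by (rule has_sum_SigmaD[OF swap]) (use has_sum_diff[OF col a] in \<open>simp add: \<alpha>_def\<close>)
  from has_sum_diff[OF has_sum_cmult_right[OF rA, of "1 / \<tau>^2"] this]
  have "(\<alpha> has_sum (1 / \<tau>^2 * A' - A)) UNIV" by simp
  from has_sum_int_symmetric_limit[OF this]
  have lim1: "(\<lambda>N. \<Sum>n\<in>{- int N..int N}. \<alpha> n) \<longlonglongrightarrow> 1 / \<tau>^2 * A' - A" .
  \<comment> \<open>The nome at the outermost end point \<open>h (- N)\<close>; at the opposite end
    it is inverted. It tends to 0 because - 1 / tau lies in the upper half-plane.\<close>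
  define x where "x = (\<lambda>N::nat. nome ((of_nat N + 1/2) * (- 1 / \<tau>)))"
  have tele: "(\<Sum>n\<in>{- int N..int N}. \<alpha> n) = 1 / \<tau> * (W (h (- int N)) - W (h (int N + 1)))" for N
  proof (induction N)
    case (Suc N)
    have "{- int (Suc N)..int (Suc N)} = insert (- int (Suc N)) (insert (int (Suc N)) {- int N..int N})" by auto
    then have "(\<Sum>n\<in>{- int (Suc N)..int (Suc N)}. \<alpha> n) = \<alpha> (- int (Suc N)) + (\<alpha> (int (Suc N)) + (\<Sum>n\<in>{- int N..int N}. \<alpha> n))"
      by simp
    also have "\<dots> = 1 / \<tau> * (W (h (- int (Suc N))) - W (h (int (Suc N) + 1)))"
      unfolding Suc.IH by (simp add: \<alpha>_def algebra_simps)
    finally show ?case .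
  qed (simp add: \<alpha>_def)
  have Wx: "W (h (- int N)) - W (h (int N + 1)) = - 2 * of_real pi * \<i> * ((1 + x N) / (1 - x N))" for N
  proof -
    have n1: "nome (h (- int N)) = x N"
    proof -
      have e: "of_int (- int N) - 1/2 = - (of_nat N + 1/2 :: complex)" by simp
      have m: "(- a) / \<tau> = a * (- 1 / \<tau>)" for a by simp
      have "h (- int N) = (of_nat N + 1/2) * (- 1 / \<tau>)" unfolding h_def e by (rule m)
      then show ?thesis by (simp add: x_def)
    qed
    have n2: "nome (h (int N + 1)) = inverse (x N)"
    proof -
      have e: "of_int (int N + 1) - 1/2 = (of_nat N + 1/2 :: complex)" by simp
      have "h (int N + 1) = - ((of_nat N + 1/2) * (- 1 / \<tau>))" unfolding h_def e by simp
      then show ?thesis by (simp only: x_def nome_minus)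
    qed
    have x: "x N \<noteq> 0" "x N \<noteq> 1"
      using nome_eq_1_iff[of "h (- int N)"] hI unfolding n1 by (simp_all add: x_def nome_def)
    have "(1 + inverse (x N)) / (1 - inverse (x N)) = - ((1 + x N) / (1 - x N))"
      using x by (simp add: divide_simps) (simp add: algebra_simps)
    moreover have "W z = - of_real pi * \<i> * ((1 + nome z) / (1 - nome z))" for z
      by (simp add: W_def)
    ultimately show ?thesis by (simp only: n1 n2) simp
  qed
  have "x \<longlonglongrightarrow> 0"
  proof (rule tendsto_norm_zero_cancel)
    define c where "c = Im (- 1 / \<tau>)"
    have c: "c > 0" unfolding c_def by (rule Im_neg_inverse_pos[OF t])
    have "norm (x N) = exp (- 2 * pi * ((real N + 1/2) * c))" for N
    proof -
      have e: "(of_nat N + 1/2) * (- 1 / \<tau>) = of_real (real N + 1/2) * (- 1 / \<tau>)" by simp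
      have m: "Im (of_real r * z) = r * Im z" for r z by simp
      show ?thesis unfolding x_def norm_nome c_def e m ..
    qed
    moreover have "(\<lambda>N. exp (- 2 * pi * ((real N + 1/2) * c))) \<longlonglongrightarrow> 0"
      using c by real_asymp
    ultimately show "(\<lambda>N. norm (x N)) \<longlonglongrightarrow> 0" by simp
  qed
  then have "(\<lambda>N. 1 / \<tau> * (- 2 * of_real pi * \<i> * ((1 + x N) / (1 - x N)))) \<longlonglongrightarrow> 1 / \<tau> * (- 2 * of_real pi * \<i> * ((1 + 0) / (1 - 0)))"
    by (intro tendsto_intros) auto
  then have "(\<lambda>N. \<Sum>n\<in>{- int N..int N}. \<alpha> n) \<longlonglongrightarrow> - 2 * of_real pi * \<i> / \<tau>"
    unfolding tele Wx by simp
  with lim1 have "1 / \<tau>^2 * A' - A = - 2 * of_real pi * \<i> / \<tau>"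
    using LIMSEQ_unique by blast
  then have d: "1 / \<tau>^2 * A' = A + - 2 * of_real pi * \<i> / \<tau>" by (simp add: diff_eq_eq)
  have "A' = \<tau>^2 * (1 / \<tau>^2 * A')" using t0 by simp
  also have "\<dots> = \<tau>^2 * A - 2 * of_real pi * \<i> * \<tau>"
    unfolding d using t0 by (simp add: algebra_simps power2_eq_square)
  finally have "A' = \<tau>^2 * A - 2 * of_real pi * \<i> * \<tau>" .
  then have "of_real pi ^ 2 / 3 * E2_fun (- 1 / \<tau>) = of_real pi ^ 2 / 3 * (\<tau>^2 * E2_fun \<tau> - 6 * \<i> / of_real pi * \<tau>)"
    unfolding A_def A'_def by (simp add: algebra_simps power2_eq_square)
  then show ?thesis by simp
qed

section \<open>The logarithm of the eta function\<close>

lemma fps_conv_radius_ge_1I: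
  fixes f :: "complex fps"
  assumes "\<And>n. n > 0 \<Longrightarrow> norm (fps_nth f n) \<le> C * real n ^ 4"
  shows "fps_conv_radius f \<ge> 1"
  unfolding fps_conv_radius_def
proof (rule conv_radius_geI_ex)
  fix r :: real assume r: "0 < r" "ereal r < 1"
  have "summable (\<lambda>n. fps_nth f n * of_real r ^ n)"
  proof (rule summable_norm_cancel, rule summable_comparison_test_ev)
    show "\<forall>\<^sub>F n in sequentially. norm (norm (fps_nth f n * of_real r ^ n)) \<le> C * (real n ^ 4 * r ^ n)"
      using eventually_gt_at_top[of 0]
    proof eventually_elim
      case (elim n)
      have "norm (fps_nth f n) * r ^ n \<le> C * real n ^ 4 * r ^ n"
        by (intro mult_right_mono assms elim) (use r in auto)
      then show ?case using r by (simp add: norm_mult norm_power mult.assoc)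
    qed
    show "summable (\<lambda>n. C * (real n ^ 4 * r ^ n))"
      using r by (intro summable_mult summable_polynomial_times_power) auto
  qed
  then show "\<exists>z. norm z = r \<and> summable (\<lambda>n. fps_nth f n * z ^ n)"
    using r by (intro exI[of _ "of_real r"]) auto
qed

text \<open>The logarithm of the product of all 1 - q^n. Its constant coefficient is 0, since
  division by 0 gives 0.\<close>

definition log_phi_fps :: "complex fps" where
  "log_phi_fps = Abs_fps (\<lambda>n. - of_nat (divisor_sigma 1 n) / of_nat n)"

text \<open>A logarithm of eta that is holomorphic on the whole upper half-plane, so that every
  power eta^r is the exponential of r times it and needs no choice of a branch.\<close>

definition log_eta :: "complex \<Rightarrow> complex" where
  "log_eta \<tau> = of_real pi * \<i> * \<tau> / 12 + eval_fps log_phi_fps (nome \<tau>)"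

lemma fps_conv_radius_log_phi: "fps_conv_radius log_phi_fps \<ge> 1"
proof (rule fps_conv_radius_ge_1I[of _ 1])
  fix n :: nat assume n: "n > 0"
  have "divisor_sigma 1 n \<le> n ^ 2" using divisor_sigma_le[OF n, of 1] by (simp add: numeral_2_eq_2)
  then have "divisor_sigma 1 n \<le> n ^ 4 * n"
    by (rule order_trans) (use n in \<open>simp add: power2_eq_square eval_nat_numeral\<close>)
  then have "real (divisor_sigma 1 n) \<le> real n ^ 4 * real n"
    by (metis of_nat_le_iff of_nat_mult of_nat_power)
  then show "norm (fps_nth log_phi_fps n) \<le> 1 * real n ^ 4"
    using n by (simp add: log_phi_fps_def norm_divide field_simps)
qed

lemma fps_nth_deriv_log_phi: "fps_nth (fps_deriv log_phi_fps) n = - of_nat (divisor_sigma 1 (Suc n))"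
  by (simp add: log_phi_fps_def add.commute del: of_nat_Suc)

text \<open>This is how E_2 enters: applying q d/dq to the logarithm of the product gives minus the
  generating series of sigma_1.\<close>

lemma log_eta_deriv:
  assumes "Im \<tau> > 0"
  shows "(log_eta has_field_derivative of_real pi * \<i> / 12 * E2_fun \<tau>) (at \<tau>)"
proof -
  define q where "q = nome \<tau>"
  have q: "norm q < 1" unfolding q_def by (rule norm_nome_less_1[OF assms])
  have qr: "ereal (norm q) < fps_conv_radius log_phi_fps"
    using q fps_conv_radius_log_phi by (metis ereal_less(3) less_le_trans one_ereal_def)
  have "(eval_fps log_phi_fps has_field_derivative eval_fps (fps_deriv log_phi_fps) q) (at q)"
    by (rule has_field_derivative_eval_fps[OF qr])
  from DERIV_chain2[OF this[unfolded q_def] has_field_derivative_nome]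
  have 1: "((\<lambda>\<tau>. eval_fps log_phi_fps (nome \<tau>)) has_field_derivative
      eval_fps (fps_deriv log_phi_fps) q * (2 * of_real pi * \<i> * q)) (at \<tau>)"
    by (simp add: q_def)
  have eq: "eval_fps (fps_deriv log_phi_fps) q * q = - (\<Sum>n. of_nat (divisor_sigma 1 (Suc n)) * q ^ Suc n)"
  proof -
    have s: "summable (\<lambda>n. of_nat (divisor_sigma 1 (Suc n)) * q ^ Suc n)"
      by (rule summable_norm_cancel[OF Lambert_series(1)[OF q]]) simp
    have "eval_fps (fps_deriv log_phi_fps) q * q = (\<Sum>n. - of_nat (divisor_sigma 1 (Suc n)) * q ^ n) * q"
      unfolding eval_fps_def fps_nth_deriv_log_phi ..
    also have "\<dots> = (\<Sum>n. - of_nat (divisor_sigma 1 (Suc n)) * q ^ n * q)"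
    proof (rule suminf_mult2)
      show "summable (\<lambda>n. - of_nat (divisor_sigma 1 (Suc n)) * q ^ n)"
        using summable_fps[of q "fps_deriv log_phi_fps"] qr fps_conv_radius_deriv[of log_phi_fps]
        unfolding fps_nth_deriv_log_phi by (meson less_le_trans)
    qed
    also have "\<dots> = (\<Sum>n. - (of_nat (divisor_sigma 1 (Suc n)) * q ^ Suc n))"
      by (simp add: mult_ac)
    also have "\<dots> = - (\<Sum>n. of_nat (divisor_sigma 1 (Suc n)) * q ^ Suc n)"
      by (rule suminf_minus[OF s])
    finally show ?thesis .
  qed
  have A: "E * (2 * of_real pi * \<i> * q) = 2 * of_real pi * \<i> * (E * q)" for E
    by (simp only: mult_ac)
  have B: "of_real pi * \<i> / 12 + 2 * of_real pi * \<i> * (- S) = of_real pi * \<i> / 12 * (1 - 24 * S)" for S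
    by (simp add: algebra_simps)
  have "of_real pi * \<i> / 12 + eval_fps (fps_deriv log_phi_fps) q * (2 * of_real pi * \<i> * q) =
      of_real pi * \<i> / 12 * E2_fun \<tau>"
    unfolding A eq E2_fun_def q_def[symmetric] by (rule B)
  moreover have "(log_eta has_field_derivative of_real pi * \<i> / 12 + eval_fps (fps_deriv log_phi_fps) q * (2 * of_real pi * \<i> * q)) (at \<tau>)"
    unfolding log_eta_def by (intro DERIV_add 1) (auto intro!: derivative_eq_intros)
  ultimately show ?thesis by (simp only:)
qed

text \<open>By the law of E_2 the difference of the two sides has derivative 0 on the half-plane. At
  the fixed point i of the inversion the two sides agree, as Ln 1 = 0.\<close>

lemma log_eta_neg_inverse:
  assumes "Im \<tau> > 0"
  shows "log_eta (- 1 / \<tau>) = log_eta \<tau> + Ln (\<tau> / \<i>) / 2"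
proof -
  define D where "D = (\<lambda>\<tau>. log_eta (- 1 / \<tau>) - log_eta \<tau> - Ln (\<tau> / \<i>) / 2)"
  have "(D has_field_derivative 0) (at z within {z. Im z > 0})" if "z \<in> {z. Im z > 0}" for z
  proof -
    have z: "Im z > 0" "z \<noteq> 0" using that by auto
    have n: "z / \<i> \<notin> \<real>\<^sub>\<le>\<^sub>0" using z by (auto simp: complex_nonpos_Reals_iff Re_divide)
    have "((\<lambda>z. - 1 / z) has_field_derivative 1 / z^2) (at z)"
      using z by (auto intro!: derivative_eq_intros simp: power2_eq_square)
    from DERIV_chain2[OF log_eta_deriv[OF Im_neg_inverse_pos[OF z(1)]] this]
    have a: "((\<lambda>z. log_eta (- 1 / z)) has_field_derivative of_real pi * \<i> / 12 * E2_fun (- 1 / z) * (1 / z^2)) (at z)" .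
    have b: "((\<lambda>z. Ln (z / \<i>) / 2) has_field_derivative 1 / (2 * z)) (at z)"
      using n z by (auto intro!: derivative_eq_intros simp: field_simps)
    have "(D has_field_derivative of_real pi * \<i> / 12 * E2_fun (- 1 / z) * (1 / z^2) - of_real pi * \<i> / 12 * E2_fun z - 1 / (2 * z)) (at z)"
      unfolding D_def by (intro DERIV_diff a b log_eta_deriv z)
    moreover have "of_real pi * \<i> / 12 * E2_fun (- 1 / z) * (1 / z^2) - of_real pi * \<i> / 12 * E2_fun z - 1 / (2 * z) = 0"
      unfolding E2_fun_neg_inverse[OF z(1)] using z(2) by (simp add: field_simps power2_eq_square)
    ultimately show ?thesis by (metis has_field_derivative_at_within)
  qed
  then obtain c where c: "\<And>z. Im z > 0 \<Longrightarrow> D z = c"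
    using has_field_derivative_zero_constant[of "{z. Im z > 0}" D] convex_halfspace_Im_gt[of 0] by auto
  have "D \<i> = 0" by (simp add: D_def)
  then have "D \<tau> = 0" using c[OF assms] c[of \<i>] by simp
  then show ?thesis by (simp add: D_def algebra_simps)
qed

section \<open>Transformation laws along words in translations and inversions\<close>

lemma nome_add_int [simp]: "nome (\<tau> + of_int n) = nome \<tau>"
  by (simp add: nome_add)

lemma log_eta_add_int: "log_eta (\<tau> + of_int n) = log_eta \<tau> + of_real pi * \<i> * of_int n / 12"
  unfolding log_eta_def by (simp add: algebra_simps add_divide_distrib)

lemma E4_fun_add_int: "E4_fun (\<tau> + of_int n) = E4_fun \<tau>"
  unfolding E4_fun_def by simp

text \<open>The integer \<open>f\<close> is the value of the Rademacher function at the matrix.\<close>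

definition eta_law :: "int \<Rightarrow> int \<Rightarrow> int \<Rightarrow> int \<Rightarrow> int \<Rightarrow> bool" where
  "eta_law a b c d f \<longleftrightarrow> c > 0 \<and> (\<forall>\<tau>. Im \<tau> > 0 \<longrightarrow>
     Im ((of_int a * \<tau> + of_int b) / (of_int c * \<tau> + of_int d)) > 0 \<and>
     log_eta ((of_int a * \<tau> + of_int b) / (of_int c * \<tau> + of_int d)) =
       log_eta \<tau> + Ln ((of_int c * \<tau> + of_int d) / \<i>) / 2 + of_real pi * \<i> * of_int f / 12 \<and>
     E4_fun ((of_int a * \<tau> + of_int b) / (of_int c * \<tau> + of_int d)) = (of_int c * \<tau> + of_int d)^4 * E4_fun \<tau>)"

lemma linear_nonzero:
  assumes "Im \<tau> > 0" "c \<noteq> 0"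
  shows "of_int c * \<tau> + of_int d \<noteq> 0"
  using assms by (auto simp: complex_eq_iff)

text \<open>The condition c > 0 in \<open>eta_law\<close> excludes pure translations, so words are
  built up from an inversion preceded by a translation.\<close>

lemma eta_law_S_T: "eta_law 0 (- 1) 1 n n"
  unfolding eta_law_def
proof (intro conjI allI impI)
  fix \<tau> :: complex assume t: "Im \<tau> > 0"
  then have t': "Im (\<tau> + of_int n) > 0" by simp
  show "Im ((of_int 0 * \<tau> + of_int (- 1)) / (of_int 1 * \<tau> + of_int n)) > 0"
    using Im_neg_inverse_pos[OF t'] by simp
  show "log_eta ((of_int 0 * \<tau> + of_int (- 1)) / (of_int 1 * \<tau> + of_int n)) =
       log_eta \<tau> + Ln ((of_int 1 * \<tau> + of_int n) / \<i>) / 2 + of_real pi * \<i> * of_int n / 12"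
    using log_eta_neg_inverse[OF t'] by (simp add: log_eta_add_int)
  show "E4_fun ((of_int 0 * \<tau> + of_int (- 1)) / (of_int 1 * \<tau> + of_int n)) = (of_int 1 * \<tau> + of_int n)^4 * E4_fun \<tau>"
    using E4_fun_neg_inverse[OF t'] by (simp add: E4_fun_add_int)
qed auto

lemma eta_law_T:
  assumes "eta_law a b c d f"
  shows "eta_law (a + m * c) (b + m * d) c d (f + m)"
  unfolding eta_law_def
proof (intro conjI allI impI)
  show "c > 0" using assms by (simp add: eta_law_def)
  fix \<tau> :: complex assume t: "Im \<tau> > 0"
  let ?g = "(of_int a * \<tau> + of_int b) / (of_int c * \<tau> + of_int d)"
  have e: "(of_int (a + m * c) * \<tau> + of_int (b + m * d)) / (of_int c * \<tau> + of_int d) = ?g + of_int m"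
    using linear_nonzero[OF t, of c d] \<open>c > 0\<close> by (simp add: field_simps)
  have h: "Im ?g > 0" "log_eta ?g = log_eta \<tau> + Ln ((of_int c * \<tau> + of_int d) / \<i>) / 2 + of_real pi * \<i> * of_int f / 12"
    "E4_fun ?g = (of_int c * \<tau> + of_int d)^4 * E4_fun \<tau>"
    using assms t unfolding eta_law_def by blast+
  show "Im ((of_int (a + m * c) * \<tau> + of_int (b + m * d)) / (of_int c * \<tau> + of_int d)) > 0"
    unfolding e using h(1) by simp
  show "log_eta ((of_int (a + m * c) * \<tau> + of_int (b + m * d)) / (of_int c * \<tau> + of_int d)) =
       log_eta \<tau> + Ln ((of_int c * \<tau> + of_int d) / \<i>) / 2 + of_real pi * \<i> * of_int (f + m) / 12"
    unfolding e log_eta_add_int h(2) by (simp add: algebra_simps add_divide_distrib)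
  show "E4_fun ((of_int (a + m * c) * \<tau> + of_int (b + m * d)) / (of_int c * \<tau> + of_int d)) = (of_int c * \<tau> + of_int d)^4 * E4_fun \<tau>"
    unfolding e E4_fun_add_int h(3) ..
qed

text \<open>The condition a < 0 keeps the new lower left entry positive. The increment 3 stands for
  3 * pi i / 12 = pi i / 4: half of the pi i / 2 by which Ln z and Ln (z / i) differ at z = - (a tau
  + b).\<close>

lemma eta_law_S:
  assumes "eta_law a b c d f" "a < 0"
  shows "eta_law c d (- a) (- b) (f + 3)"
  unfolding eta_law_def
proof (intro conjI allI impI)
  show "- a > 0" using assms by simp
  have c: "c > 0" using assms by (simp add: eta_law_def)
  fix \<tau> :: complex assume t: "Im \<tau> > 0"
  let ?n = "of_int a * \<tau> + of_int b" and ?d = "of_int c * \<tau> + of_int d"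
  let ?g = "?n / ?d"
  have h: "Im ?g > 0" "log_eta ?g = log_eta \<tau> + Ln (?d / \<i>) / 2 + of_real pi * \<i> * of_int f / 12"
    "E4_fun ?g = ?d^4 * E4_fun \<tau>"
    using assms t unfolding eta_law_def by blast+
  have nz: "?n \<noteq> 0" "?d \<noteq> 0" using linear_nonzero[OF t] assms(2) c by auto
  have e: "(of_int c * \<tau> + of_int d) / (of_int (- a) * \<tau> + of_int (- b)) = - 1 / ?g"
  proof -
    have m: "of_int (- a) * \<tau> + of_int (- b) = - ?n" by simp
    have "y / (- x) = - 1 / (x / y)" for x y :: complex by simp
    then show ?thesis unfolding m .
  qed
  show "Im ((of_int c * \<tau> + of_int d) / (of_int (- a) * \<tau> + of_int (- b))) > 0"
    unfolding e by (rule Im_neg_inverse_pos[OF h(1)])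
  \<comment> \<open>The two logarithms have imaginary parts in \<open>(- \<pi> / 2, \<pi> / 2)\<close>, so their sum is
    again a principal value.\<close>
  have arg: "\<bar>Im (Ln (z / \<i>))\<bar> < pi / 2" if "Im z > 0" for z
    using that by (subst Re_Ln_pos_lt) (auto simp: Re_divide)
  have d: "Im ?d > 0" using t c by simp
  have prod: "?d / \<i> * (?g / \<i>) = - ?n" using nz by (simp add: field_simps)
  have "Ln (?d / \<i>) + Ln (?g / \<i>) = Ln (- ?n)"
  proof -
    have "exp (Ln (?d / \<i>) + Ln (?g / \<i>)) = - ?n"
    proof -
      have "exp (Ln (?d / \<i>)) = ?d / \<i>" "exp (Ln (?g / \<i>)) = ?g / \<i>"
        by (rule exp_Ln, use nz in auto)+
      then show ?thesis unfolding exp_add using prod by metis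
    qed
    moreover have "- pi < Im (Ln (?d / \<i>) + Ln (?g / \<i>))" "Im (Ln (?d / \<i>) + Ln (?g / \<i>)) \<le> pi"
      using arg[OF d] arg[OF h(1)] by auto
    ultimately show ?thesis using Ln_unique[of _ "- ?n"] Ln_exp by metis
  qed
  moreover have "Ln (- ?n) = Ln (- ?n / \<i>) + of_real pi * \<i> / 2"
  proof -
    have "Im (- ?n) > 0" using t assms(2) by (simp add: mult_neg_pos)
    note ar = arg[OF this]
    have "exp (Ln (- ?n / \<i>) + of_real pi * \<i> / 2) = - ?n"
    proof -
      have "exp (of_real pi * \<i> / 2) = cis (pi / 2)" by (simp add: cis_conv_exp mult.commute)
      then have i: "exp (of_real pi * \<i> / 2) = \<i>" by simp
      have "exp (Ln (- ?n / \<i>)) = - ?n / \<i>"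
        by (rule exp_Ln) (metis nz(1) complex_i_not_zero divide_eq_0_iff neg_equal_0_iff_equal)
      moreover have "z / \<i> * \<i> = z" for z by (simp add: complex_eq_iff)
      ultimately show ?thesis unfolding exp_add i by (simp only:)
    qed
    moreover have "- pi < Im (Ln (- ?n / \<i>) + of_real pi * \<i> / 2)" "Im (Ln (- ?n / \<i>) + of_real pi * \<i> / 2) \<le> pi"
      using ar by auto
    ultimately show ?thesis using Ln_exp by metis
  qed
  moreover have "- ?n / \<i> = (of_int (- a) * \<tau> + of_int (- b)) / \<i>" by simp
  ultimately have L: "Ln (?d / \<i>) + Ln (?g / \<i>) = Ln ((of_int (- a) * \<tau> + of_int (- b)) / \<i>) + of_real pi * \<i> / 2"
    by simp
  have "log_eta (- 1 / ?g) = log_eta \<tau> + (Ln (?d / \<i>) + Ln (?g / \<i>)) / 2 + of_real pi * \<i> * of_int f / 12"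
    unfolding log_eta_neg_inverse[OF h(1)] h(2) by (simp add: add_divide_distrib)
  then show "log_eta ((of_int c * \<tau> + of_int d) / (of_int (- a) * \<tau> + of_int (- b))) =
       log_eta \<tau> + Ln ((of_int (- a) * \<tau> + of_int (- b)) / \<i>) / 2 + of_real pi * \<i> * of_int (f + 3) / 12"
    unfolding e L by (simp add: add_divide_distrib algebra_simps)
  have "E4_fun (- 1 / ?g) = (?g * ?d)^4 * E4_fun \<tau>"
    unfolding E4_fun_neg_inverse[OF h(1)] h(3) by (simp only: power_mult_distrib mult.assoc)
  also have "?g * ?d = - (of_int (- a) * \<tau> + of_int (- b))" using nz by simp
  finally show "E4_fun ((of_int c * \<tau> + of_int d) / (of_int (- a) * \<tau> + of_int (- b))) =
      (of_int (- a) * \<tau> + of_int (- b))^4 * E4_fun \<tau>"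
    unfolding e by (simp only: power_minus_even[OF even_numeral])
qed

section \<open>The expansions of \<open>E\<^sub>4\<close> and \<open>\<eta>\<close>\<close>

definition cfps :: "int fps \<Rightarrow> complex fps" where
  "cfps f = Abs_fps (\<lambda>n. of_int (fps_nth f n))"

lemma cfps_nth [simp]: "fps_nth (cfps f) n = of_int (fps_nth f n)"
  by (simp add: cfps_def)

lemma cfps_mult: "cfps (f * g) = cfps f * cfps g"
  by (simp add: fps_eq_iff fps_mult_nth)

lemma cfps_1 [simp]: "cfps 1 = 1"
  by (simp add: fps_eq_iff)

lemma cfps_power: "cfps (f ^ n) = cfps f ^ n"
  by (induction n) (simp_all add: cfps_mult)

lemma sigma3_eq: "sigma3 n = divisor_sigma 3 n"
  by (simp add: sigma3_def divisor_sigma_def)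

lemma E4_nth: "fps_nth E4 n = (if n = 0 then 1 else 240 * int (divisor_sigma 3 n))"
  by (simp add: E4_def sigma3_eq)

lemma fps_conv_radius_E4: "fps_conv_radius (cfps E4) \<ge> 1"
proof (rule fps_conv_radius_ge_1I[of _ 240])
  fix n :: nat assume n: "n > 0"
  have "divisor_sigma 3 n \<le> n ^ 4" using divisor_sigma_le[OF n, of 3] by (simp add: eval_nat_numeral)
  then have "real (divisor_sigma 3 n) \<le> real n ^ 4" by (metis of_nat_le_iff of_nat_power)
  then show "norm (fps_nth (cfps E4) n) \<le> 240 * real n ^ 4"
    using n by (simp add: E4_nth norm_mult)
qed

lemma in_conv_radius:
  assumes "norm q < 1" "fps_conv_radius f \<ge> 1"
  shows "ereal (norm q) < fps_conv_radius f"
  using assms by (metis ereal_less(3) less_le_trans one_ereal_def)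

lemma eval_fps_E4:
  assumes "Im \<tau> > 0"
  shows "eval_fps (cfps E4) (nome \<tau>) = E4_fun \<tau>"
proof -
  define q where "q = nome \<tau>"
  have q: "norm q < 1" unfolding q_def by (rule norm_nome_less_1[OF assms])
  have s: "summable (\<lambda>n. of_nat (divisor_sigma 3 (Suc n)) * q ^ Suc n)"
    by (rule summable_norm_cancel[OF Lambert_series(1)[OF q]]) simp
  have "(\<lambda>n. fps_nth (cfps E4) n * q ^ n) sums eval_fps (cfps E4) q"
    by (rule sums_eval_fps[OF in_conv_radius[OF q fps_conv_radius_E4]])
  then have "(\<lambda>n. fps_nth (cfps E4) (Suc n) * q ^ Suc n) sums (eval_fps (cfps E4) q - 1)"
    using sums_split_initial_segment[of _ _ 1] by (fastforce simp: E4_nth)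
  moreover have "(\<lambda>n. fps_nth (cfps E4) (Suc n) * q ^ Suc n) sums (240 * (\<Sum>n. of_nat (divisor_sigma 3 (Suc n)) * q ^ Suc n))"
    using sums_mult[OF summable_sums[OF s], of 240] by (simp add: E4_nth mult.assoc)
  ultimately have "eval_fps (cfps E4) q - 1 = 240 * (\<Sum>n. of_nat (divisor_sigma 3 (Suc n)) * q ^ Suc n)"
    by (rule sums_unique2)
  then show ?thesis unfolding E4_fun_def q_def by (simp add: algebra_simps)
qed

text \<open>\<open>T N\<close> is the logarithmic derivative of the partial product
  \<open>P N\<close>, and its coefficients up to degree N already have their final values. The
  differential equation then passes to the limit coefficient by coefficient.\<close>

lemma qq_inf_deriv: "fps_deriv qq_inf = Abs_fps (\<lambda>n. - int (divisor_sigma 1 (Suc n))) * qq_inf"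
proof -
  define f where "f = (\<lambda>k. 1 - fps_X ^ Suc k :: int fps)"
  \<comment> \<open>\<open>G k\<close> is the inverse of \<open>f k\<close> over the integers, the
    geometric series in X^(k + 1).\<close>
  define G where "G = (\<lambda>k. Abs_fps (\<lambda>n. if Suc k dvd n then 1 else 0) :: int fps)"
  define P where "P = (\<lambda>N. \<Prod>k\<le>N. f k)"
  define T where "T = (\<lambda>N. \<Sum>k\<le>N. - (of_nat (Suc k) * (fps_X ^ k * G k)))"
  have fG: "f k * G k = 1" for k
  proof (rule fps_ext)
    fix n
    have "fps_nth (f k * G k) n = fps_nth (G k) n - fps_nth (fps_X ^ Suc k * G k) n"
      by (simp add: f_def algebra_simps)
    also have "\<dots> = fps_nth 1 n"
    proof -
      have "Suc k dvd n \<longleftrightarrow> Suc k dvd n - Suc k" if "Suc k \<le> n"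
        using that by (metis dvd_add_triv_right_iff le_add_diff_inverse2)
      then show ?thesis
        unfolding fps_X_power_mult_nth by (auto simp: G_def not_less dest: dvd_imp_le)
    qed
    finally show "fps_nth (f k * G k) n = fps_nth 1 n" .
  qed
  have df: "fps_deriv (f k) = - (of_nat (Suc k) * (fps_X ^ k * G k)) * f k" for k
  proof -
    have "fps_deriv (f k) = - (of_nat (Suc k) * fps_X ^ k)"
      by (rule fps_ext) (simp add: f_def fps_mult_of_nat_nth del: power_Suc of_nat_Suc)
    also have "\<dots> = - (of_nat (Suc k) * (fps_X ^ k * (f k * G k)))" by (simp only: fG mult_1_right)
    finally show ?thesis by (simp only: mult_ac mult_minus_left mult_minus_right)
  qed
  have dP: "fps_deriv (P N) = T N * P N" for N
  proof (induction N)
    case (Suc N)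
    have "fps_deriv (P (Suc N)) = fps_deriv (P N) * f (Suc N) + P N * fps_deriv (f (Suc N))"
      by (simp add: P_def algebra_simps)
    also have "\<dots> = T (Suc N) * P (Suc N)"
      unfolding Suc.IH df by (simp add: P_def T_def algebra_simps)
    finally show ?case .
  qed (simp add: P_def T_def df)
  have T: "fps_nth (T N) i = - int (divisor_sigma 1 (Suc i))" if "i \<le> N" for N i
  proof -
    have "fps_nth (T N) i = (\<Sum>k\<le>N. - int (Suc k) * fps_nth (fps_X ^ k * G k) i)"
      unfolding T_def fps_sum_nth by (intro sum.cong refl) (simp add: fps_mult_of_nat_nth del: of_nat_Suc)
    also have "\<dots> = (\<Sum>k\<le>N. if Suc k dvd Suc i then - int (Suc k) else 0)"
    proof (intro sum.cong refl)
      fix k assume "k \<in> {..N}"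
      show "- int (Suc k) * fps_nth (fps_X ^ k * G k) i = (if Suc k dvd Suc i then - int (Suc k) else 0)"
      proof (cases "k \<le> i")
        case True
        then have "Suc i = (i - k) + Suc k" by simp
        then have "Suc k dvd Suc i \<longleftrightarrow> Suc k dvd i - k" by (metis dvd_add_triv_right_iff)
        then show ?thesis using True by (simp add: fps_X_power_mult_nth G_def)
      next
        case False
        then have "\<not> Suc k dvd Suc i" by (auto dest: dvd_imp_le)
        then show ?thesis using False by (simp add: fps_X_power_mult_nth)
      qed
    qed
    also have "\<dots> = (\<Sum>k\<in>{k\<in>{..N}. Suc k dvd Suc i}. - int (Suc k))"
      by (subst sum.inter_filter) auto
    also have "\<dots> = (\<Sum>d | d dvd Suc i. - int d)"
    proof (rule sum.reindex_bij_witness[of _ "\<lambda>d. d - 1" Suc])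
      fix d assume d: "d \<in> {d. d dvd Suc i}"
      then have "d > 0" "d \<le> Suc i" by (auto intro: Nat.gr0I dest: dvd_imp_le)
      then show "Suc (d - 1) = d" "d - 1 \<in> {k \<in> {..N}. Suc k dvd Suc i}" using d that by auto
    qed auto
    finally show ?thesis by (simp add: divisor_sigma_def sum_negf)
  qed
  have lim: "P \<longlonglongrightarrow> qq_inf"
  proof -
    have "f n \<noteq> 0" for n
    proof -
      have "fps_nth (f n) 0 \<noteq> 0" by (simp add: f_def)
      then show ?thesis by auto
    qed
    then have "raw_has_prod f 0 qq_inf"
      using qq_inf_has_prod unfolding has_prod_def f_def by blast
    then show ?thesis by (simp add: raw_has_prod_def P_def)
  qed
  show ?thesis
  proof (rule fps_ext)
    fix n
    have "\<forall>\<^sub>F N in sequentially. \<forall>i\<in>{..Suc n}. fps_nth (P N) i = fps_nth qq_inf i"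
      using lim unfolding tendsto_fps_iff by (intro eventually_ball_finite) auto
    then have "\<forall>\<^sub>F N in sequentially. N \<ge> n \<and> (\<forall>i\<in>{..Suc n}. fps_nth (P N) i = fps_nth qq_inf i)"
      using eventually_ge_at_top[of n] by eventually_elim auto
    \<comment> \<open>Coefficient n of a derivative involves coefficient n + 1 of the series, so the
      partial product has to agree with the limit up to degree n + 1.\<close>
    then obtain N where N: "N \<ge> n" "\<And>i. i \<le> Suc n \<Longrightarrow> fps_nth (P N) i = fps_nth qq_inf i"
      unfolding eventually_sequentially by auto
    have "fps_nth (fps_deriv qq_inf) n = fps_nth (fps_deriv (P N)) n" by (simp add: N)
    also have "\<dots> = fps_nth (T N * P N) n" by (simp only: dP)
    also have "\<dots> = fps_nth (Abs_fps (\<lambda>n. - int (divisor_sigma 1 (Suc n))) * qq_inf) n"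
      unfolding fps_mult_nth using N by (intro sum.cong refl) (auto simp: T)
    finally show "fps_nth (fps_deriv qq_inf) n = fps_nth (Abs_fps (\<lambda>n. - int (divisor_sigma 1 (Suc n))) * qq_inf) n" .
  qed
qed

lemma fps_deriv_linear_unique:
  fixes F G L :: "complex fps"
  assumes "fps_deriv F = L * F" "fps_deriv G = L * G" "fps_nth F 0 = 1" "fps_nth G 0 = 1"
  shows "F = G"
proof -
  have "fps_nth F n = fps_nth G n" for n
  proof (induction n rule: less_induct)
    case (less n)
    show ?case
    proof (cases n)
      case (Suc m)
      have "of_nat (Suc m) * fps_nth F (Suc m) = (\<Sum>i=0..m. fps_nth L i * fps_nth F (m - i))"
        using arg_cong[OF assms(1), of "\<lambda>f. fps_nth f m"] by (simp add: fps_mult_nth)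
      also have "\<dots> = (\<Sum>i=0..m. fps_nth L i * fps_nth G (m - i))"
        using less Suc by (intro sum.cong refl) auto
      also have "\<dots> = of_nat (Suc m) * fps_nth G (Suc m)"
        using arg_cong[OF assms(2), of "\<lambda>f. fps_nth f m"] by (simp add: fps_mult_nth)
      finally show ?thesis unfolding Suc by (metis mult_left_cancel of_nat_neq_0)
    qed (use assms in simp)
  qed
  then show ?thesis by (rule fps_ext)
qed

text \<open>Both sides have constant term 1 and solve F' = L F with L the derivative of
  \<open>log_phi_fps\<close>. This identifies the formal product with the analytic function without
  any analytic infinite product.\<close>

lemma exp_log_phi_expansion: "(\<lambda>q. exp (eval_fps log_phi_fps q)) has_fps_expansion cfps qq_inf"
proof -
  let ?f = "\<lambda>q. exp (eval_fps log_phi_fps q)"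
  have cr: "fps_conv_radius log_phi_fps > 0"
    by (rule less_le_trans[OF _ fps_conv_radius_log_phi]) simp
  have sub: "ball 0 1 \<subseteq> eball 0 (fps_conv_radius log_phi_fps)"
    using fps_conv_radius_log_phi ball_eball_mono[of 1] by (simp add: one_ereal_def)
  have hol: "?f holomorphic_on ball 0 1"
    by (intro holomorphic_intros) (use sub in auto)
  define F where "F = fps_expansion ?f 0"
  have F: "?f has_fps_expansion F"
    unfolding F_def by (rule has_fps_expansion_fps_expansion[OF _ _ hol]) auto
  have e1: "deriv ?f has_fps_expansion fps_deriv F" by (rule has_fps_expansion_deriv[OF F])
  have e2: "(\<lambda>q. eval_fps (fps_deriv log_phi_fps) q * ?f q) has_fps_expansion fps_deriv log_phi_fps * F"
    by (intro has_fps_expansion_mult F eval_fps_has_fps_expansion)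
       (rule less_le_trans[OF cr fps_conv_radius_deriv])
  have "\<forall>\<^sub>F q in nhds (0::complex). q \<in> ball 0 1"
    by (rule eventually_nhds_in_open) auto
  then have ev: "\<forall>\<^sub>F q in nhds 0. deriv ?f q = eval_fps (fps_deriv log_phi_fps) q * ?f q"
  proof eventually_elim
    case (elim q)
    then have "ereal (norm q) < fps_conv_radius log_phi_fps"
      using in_conv_radius[OF _ fps_conv_radius_log_phi, of q] by simp
    then have "(?f has_field_derivative ?f q * eval_fps (fps_deriv log_phi_fps) q) (at q)"
      by (intro DERIV_chain2[OF DERIV_exp] has_field_derivative_eval_fps)
    then show ?case by (simp add: DERIV_imp_deriv mult.commute)
  qed
  have d1: "fps_deriv F = fps_deriv log_phi_fps * F"
    by (rule fps_expansion_unique_complex[OF e1]) (use e2 has_fps_expansion_cong[OF ev refl] in blast)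
  have "cfps (fps_deriv qq_inf) = fps_deriv (cfps qq_inf)" by (simp add: fps_eq_iff)
  moreover have "cfps (Abs_fps (\<lambda>n. - int (divisor_sigma 1 (Suc n)))) = fps_deriv log_phi_fps"
    unfolding fps_eq_iff fps_nth_deriv_log_phi by simp
  ultimately have d2: "fps_deriv (cfps qq_inf) = fps_deriv log_phi_fps * cfps qq_inf"
    using arg_cong[OF qq_inf_deriv, of cfps] by (simp add: cfps_mult)
  have "fps_nth F 0 = ?f 0" by (rule has_fps_expansion_imp_0_eq_fps_nth_0[OF F, symmetric])
  then have "fps_nth F 0 = 1" by (simp add: eval_fps_at_0 log_phi_fps_def)
  with fps_deriv_linear_unique[OF d1 d2] have "F = cfps qq_inf" by (simp add: qq_inf_nth_0)
  with F show ?thesis by simp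
qed

definition qq_inv :: "int fps" where "qq_inv = fps_right_inverse qq_inf 1"

lemma qq_inf_inv: "qq_inf * qq_inv = 1"
  unfolding qq_inv_def by (rule fps_right_inverse) (simp add: qq_inf_nth_0)

definition form_fps :: "nat \<Rightarrow> int \<Rightarrow> int fps" where
  "form_fps a r = E4 ^ a * (if r \<ge> 0 then qq_inf ^ nat r else qq_inv ^ nat (- r))"

lemma form_fps_expansion:
  "(\<lambda>q. eval_fps (cfps E4) q ^ a * exp (of_int r * eval_fps log_phi_fps q)) has_fps_expansion cfps (form_fps a r)"
proof -
  have e4: "eval_fps (cfps E4) has_fps_expansion cfps E4"
    by (rule eval_fps_has_fps_expansion, rule less_le_trans[OF _ fps_conv_radius_E4]) simp
  have "cfps qq_inf * cfps qq_inv = 1" using qq_inf_inv by (metis cfps_1 cfps_mult)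
  then have inv: "inverse (cfps qq_inf) = cfps qq_inv"
    by (metis fps_inverse_unique)
  have "(\<lambda>q. inverse (exp (eval_fps log_phi_fps q))) has_fps_expansion inverse (cfps qq_inf)"
    by (rule has_fps_expansion_inverse[OF exp_log_phi_expansion]) (simp add: qq_inf_nth_0)
  then have i: "(\<lambda>q. exp (- eval_fps log_phi_fps q)) has_fps_expansion cfps qq_inv"
    unfolding inv by (simp add: exp_minus)
  show ?thesis
  proof (cases "r \<ge> 0")
    case True
    have "(\<lambda>q. eval_fps (cfps E4) q ^ a * exp (eval_fps log_phi_fps q) ^ nat r) has_fps_expansion cfps E4 ^ a * cfps qq_inf ^ nat r"
      by (intro has_fps_expansion_mult has_fps_expansion_power e4 exp_log_phi_expansion)
    moreover have "exp (eval_fps log_phi_fps q) ^ nat r = exp (of_int r * eval_fps log_phi_fps q)" for q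
      using True by (simp add: exp_of_nat_mult [symmetric])
    ultimately show ?thesis using True by (simp add: form_fps_def cfps_mult cfps_power)
  next
    case False
    have "(\<lambda>q. eval_fps (cfps E4) q ^ a * exp (- eval_fps log_phi_fps q) ^ nat (- r)) has_fps_expansion cfps E4 ^ a * cfps qq_inv ^ nat (- r)"
      by (intro has_fps_expansion_mult has_fps_expansion_power e4 i)
    moreover have "exp (- eval_fps log_phi_fps q) ^ nat (- r) = exp (of_int r * eval_fps log_phi_fps q)" for q
      using False by (simp add: exp_of_nat_mult [symmetric])
    ultimately show ?thesis using False by (simp add: form_fps_def cfps_mult cfps_power)
  qed
qed

text \<open>The function is holomorphic on the unit disc, so its Taylor series converges there. This
  covers negative powers as well, with no estimate of the coefficients of
  \<open>qq_inv\<close>.\<close>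

lemma form_fps_sums:
  assumes "norm q < 1"
  shows "summable (\<lambda>n. norm (of_int (fps_nth (form_fps a r) n) * q ^ n))"
    and "(\<lambda>n. of_int (fps_nth (form_fps a r) n) * q ^ n) sums
      (eval_fps (cfps E4) q ^ a * exp (of_int r * eval_fps log_phi_fps q))"
proof -
  let ?f = "\<lambda>q. eval_fps (cfps E4) q ^ a * exp (of_int r * eval_fps log_phi_fps q)"
  have sub: "ball 0 1 \<subseteq> eball 0 (fps_conv_radius log_phi_fps)" "ball 0 1 \<subseteq> eball 0 (fps_conv_radius (cfps E4))"
    using fps_conv_radius_log_phi fps_conv_radius_E4 ball_eball_mono[of 1] by (simp_all add: one_ereal_def)
  have hol: "?f holomorphic_on ball 0 1"
    by (intro holomorphic_intros) (use sub in auto)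
  have n: "(deriv ^^ n) ?f 0 / fact n = of_int (fps_nth (form_fps a r) n)" for n
    using fps_nth_fps_expansion[OF form_fps_expansion[of a r], of n] by simp
  have s: "(\<lambda>n. of_int (fps_nth (form_fps a r) n) * q ^ n) sums ?f q" if "norm q < 1" for q
    using holomorphic_power_series[OF hol, of q] that unfolding n by simp
  \<comment> \<open>Convergence at a radius between |q| and 1 implies absolute convergence at
    q.\<close>
  obtain p where p: "norm q < p" "p < 1" using assms dense by blast
  then have "norm (of_real p :: complex) < 1" "norm q < norm (of_real p :: complex)"
  proof -
    have "p > 0" using p norm_ge_zero[of q] by linarith
    then show "norm (of_real p :: complex) < 1" "norm q < norm (of_real p :: complex)" using p by auto
  qed
  from powser_insidea[OF sums_summable[OF s[OF this(1)]] this(2)]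
  show "summable (\<lambda>n. norm (of_int (fps_nth (form_fps a r) n) * q ^ n))" .
  show "(\<lambda>n. of_int (fps_nth (form_fps a r) n) * q ^ n) sums ?f q" by (rule s[OF assms])
qed

section \<open>Vanishing of modular functions\<close>

text \<open>A point of the strip |Re| <= 1/2 below the height 1/2 has squared modulus at most 1/2,
  so the inversion at least doubles its imaginary part. The target is larger than the usual
  fundamental domain, but it stays away from the real line.\<close>

lemma exists_equivalent_point:
  fixes g :: "complex \<Rightarrow> complex"
  assumes T: "\<And>\<tau>. Im \<tau> > 0 \<Longrightarrow> g (\<tau> + 1) = g \<tau>"
    and S: "\<And>\<tau>. Im \<tau> > 0 \<Longrightarrow> g (- 1 / \<tau>) = g \<tau>"
    and t: "Im \<tau> > 0"
  shows "\<exists>\<tau>'. Im \<tau>' \<ge> 1/2 \<and> \<bar>Re \<tau>'\<bar> \<le> 1/2 \<and> g \<tau>' = g \<tau>"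
proof -
  have nat: "g (\<tau> + of_nat n) = g \<tau>" if "Im \<tau> > 0" for \<tau> n
  proof (induction n)
    case (Suc n)
    then show ?case using T[of "\<tau> + of_nat n"] that by (simp add: add_ac)
  qed simp
  have int: "g (\<tau> + of_int n) = g \<tau>" if "Im \<tau> > 0" for \<tau> n
  proof (cases "n \<ge> 0")
    case True
    then show ?thesis using nat[OF that, of "nat n"] by simp
  next
    case False
    then show ?thesis using nat[of "\<tau> + of_int n" "nat (- n)"] that by simp
  qed
  \<comment> \<open>Induction on the number n of doublings after which the height 1/2 is certainly
    reached.\<close>
  have "\<exists>\<tau>'. Im \<tau>' \<ge> 1/2 \<and> \<bar>Re \<tau>'\<bar> \<le> 1/2 \<and> g \<tau>' = g \<tau>"
    if "Im \<tau> > 0" "Im \<tau> * 2 ^ n \<ge> 1/2" for n \<tau>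
    using that
  proof (induction n arbitrary: \<tau>)
    case (0 \<tau>)
    define \<tau>' where "\<tau>' = \<tau> + of_int (- round (Re \<tau>))"
    have "\<bar>Re \<tau>'\<bar> \<le> 1/2" using of_int_round_abs_le[of "Re \<tau>"] by (simp add: \<tau>'_def abs_minus_commute)
    moreover have "g \<tau>' = g \<tau>" unfolding \<tau>'_def by (rule int) (use 0 in auto)
    ultimately show ?case using 0 by (intro exI[of _ \<tau>']) (auto simp: \<tau>'_def)
  next
    case (Suc n \<tau>)
    define \<tau>' where "\<tau>' = \<tau> + of_int (- round (Re \<tau>))"
    have re: "\<bar>Re \<tau>'\<bar> \<le> 1/2" using of_int_round_abs_le[of "Re \<tau>"] by (simp add: \<tau>'_def abs_minus_commute)
    have g: "g \<tau>' = g \<tau>" unfolding \<tau>'_def by (rule int) (use Suc in auto)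
    have im: "Im \<tau>' = Im \<tau>" by (simp add: \<tau>'_def)
    show ?case
    proof (cases "Im \<tau> \<ge> 1/2")
      case True
      then show ?thesis using re g im by (intro exI[of _ \<tau>']) auto
    next
      case False
      let ?N = "(Re \<tau>')\<^sup>2 + (Im \<tau>')\<^sup>2"
      have "(Re \<tau>')\<^sup>2 \<le> (1/2)\<^sup>2" using re abs_le_square_iff[of "Re \<tau>'" "1/2"] by simp
      moreover have "(Im \<tau>')\<^sup>2 \<le> (1/2)\<^sup>2" using False im Suc.prems by (intro power_mono) auto
      ultimately have N: "?N \<le> 1/2" by (simp add: power2_eq_square)
      have N0: "?N > 0" using im Suc.prems by (simp add: sum_power2_gt_zero_iff)
      have Im: "Im (- 1 / \<tau>') = Im \<tau> / ?N" by (simp add: Im_divide im)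
      have "Im \<tau> * 2 \<le> Im \<tau> / ?N"
        using N N0 Suc.prems(1) mult_left_mono[OF N, of "2 * Im \<tau>"] by (simp add: pos_le_divide_eq mult_ac)
      then have "Im (- 1 / \<tau>') * 2 ^ n \<ge> Im \<tau> * 2 * 2 ^ n"
        unfolding Im by (intro mult_right_mono) auto
      then have "Im (- 1 / \<tau>') * 2 ^ n \<ge> 1/2" using Suc.prems(2) by simp
      moreover have "Im (- 1 / \<tau>') > 0" using Im_neg_inverse_pos im Suc.prems by simp
      ultimately obtain \<tau>'' where "Im \<tau>'' \<ge> 1/2 \<and> \<bar>Re \<tau>''\<bar> \<le> 1/2 \<and> g \<tau>'' = g (- 1 / \<tau>')"
        using Suc.IH by blast
      then show ?thesis using S[of \<tau>'] im Suc.prems g by auto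
    qed
  qed
  moreover obtain n where "1 / (2 * Im \<tau>) < 2 ^ n" using real_arch_pow[of 2] by auto
  then have "Im \<tau> * 2 ^ n \<ge> 1/2" using t by (simp add: field_simps)
  ultimately show ?thesis using t by blast
qed

text \<open>Decay at the cusp confines the values of modulus at least |g tau| in the strip to a
  compact box. Hence the modulus has a global maximum inside the open half-plane, g is constant, and
  a nonzero constant does not decay.\<close>

lemma modular_function_vanishes:
  fixes g :: "complex \<Rightarrow> complex"
  assumes hol: "g holomorphic_on {\<tau>. Im \<tau> > 0}"
    and T: "\<And>\<tau>. Im \<tau> > 0 \<Longrightarrow> g (\<tau> + 1) = g \<tau>"
    and S: "\<And>\<tau>. Im \<tau> > 0 \<Longrightarrow> g (- 1 / \<tau>) = g \<tau>"
    and lim: "\<And>\<epsilon>. \<epsilon> > 0 \<Longrightarrow> \<exists>Y. \<forall>\<tau>. Im \<tau> > Y \<longrightarrow> norm (g \<tau>) < \<epsilon>"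
    and t: "Im \<tau> > 0"
  shows "g \<tau> = 0"
proof (rule ccontr)
  assume nz: "g \<tau> \<noteq> 0"
  obtain Y where Y: "\<And>z. Im z > Y \<Longrightarrow> norm (g z) < norm (g \<tau>)"
    using lim[of "norm (g \<tau>)"] nz by auto
  define K where "K = cbox (Complex (-1/2) (1/2)) (Complex (1/2) (max (1/2) Y))"
  have K: "compact K" "K \<subseteq> {\<tau>. Im \<tau> > 0}" unfolding K_def by (auto simp: in_cbox_complex_iff)
  obtain \<tau>0 where \<tau>0: "Im \<tau>0 \<ge> 1/2" "\<bar>Re \<tau>0\<bar> \<le> 1/2" "g \<tau>0 = g \<tau>"
    using exists_equivalent_point[of g, OF T S t] by blast
  have inK: "z \<in> K" if "Im z \<ge> 1/2" "\<bar>Re z\<bar> \<le> 1/2" "\<not> norm (g z) < norm (g \<tau>)" for z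
  proof -
    have "Im z \<le> Y" using that(3) Y[of z] by (cases "Im z \<le> Y") auto
    then show ?thesis using that unfolding K_def by (auto simp: in_cbox_complex_iff abs_le_iff le_max_iff_disj)
  qed
  have "\<tau>0 \<in> K" by (rule inK) (use \<tau>0 in auto)
  then have "K \<noteq> {}" by blast
  have "continuous_on K (\<lambda>z. norm (g z))"
    using holomorphic_on_imp_continuous_on[OF holomorphic_on_subset[OF hol K(2)]] by (intro continuous_intros)
  then obtain m where m: "m \<in> K" "\<And>z. z \<in> K \<Longrightarrow> norm (g z) \<le> norm (g m)"
    using continuous_attains_sup[OF K(1) \<open>K \<noteq> {}\<close>] by blast
  have max: "norm (g z) \<le> norm (g m)" if z: "z \<in> {\<tau>. Im \<tau> > 0}" for z
  proof -
    obtain z' where z': "Im z' \<ge> 1/2" "\<bar>Re z'\<bar> \<le> 1/2" "g z' = g z"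
      using exists_equivalent_point[of g, OF T S] z by blast
    have "norm (g \<tau>) \<le> norm (g m)" using m(2)[OF \<open>\<tau>0 \<in> K\<close>] \<tau>0 by simp
    then show ?thesis using inK[OF z'(1,2)] m(2)[of z'] z'(3) by (metis less_le_trans linear order_less_imp_le)
  qed
  have "open {\<tau>. Im \<tau> > 0}" "connected {\<tau>. Im \<tau> > 0}"
    using open_halfspace_Im_gt[of 0] convex_connected[OF convex_halfspace_Im_gt[of 0]] by auto
  from maximum_modulus_principle[OF hol this this(1) order_refl _ max]
  have "g constant_on {\<tau>. Im \<tau> > 0}" using m(1) K(2) by blast
  then obtain c where c: "\<And>z. Im z > 0 \<Longrightarrow> g z = c" unfolding constant_on_def by auto
  have "norm (g (Complex 0 (max 1 (Y + 1)))) < norm (g \<tau>)" by (rule Y) auto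
  then show False using c[of "Complex 0 (max 1 (Y + 1))"] c[OF t] by simp
qed

section \<open>Expansions at infinity\<close>

text \<open>The exponents are e + nu with one fixed fractional shift nu. With e an integer, forms
  that behave alike under translation are combined coefficientwise.\<close>

definition qexp :: "real \<Rightarrow> (int \<Rightarrow> complex) \<Rightarrow> (complex \<Rightarrow> complex) \<Rightarrow> bool" where
  "qexp \<nu> d f \<longleftrightarrow> (\<forall>\<tau>. Im \<tau> > 0 \<longrightarrow> ((\<lambda>e. d e * nome (of_real (of_int e + \<nu>) * \<tau>)) has_sum f \<tau>) UNIV)"

lemma qexp_add: "qexp \<nu> d f \<Longrightarrow> qexp \<nu> d' f' \<Longrightarrow> qexp \<nu> (\<lambda>e. d e + d' e) (\<lambda>\<tau>. f \<tau> + f' \<tau>)"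
  unfolding qexp_def by (auto simp: distrib_right intro!: has_sum_add)

lemma qexp_cmult: "qexp \<nu> d f \<Longrightarrow> qexp \<nu> (\<lambda>e. c * d e) (\<lambda>\<tau>. c * f \<tau>)"
  unfolding qexp_def by (auto simp: mult.assoc intro!: has_sum_cmult_right)

lemma qexp_diff: "qexp \<nu> d f \<Longrightarrow> qexp \<nu> d' f' \<Longrightarrow> qexp \<nu> (\<lambda>e. d e - d' e) (\<lambda>\<tau>. f \<tau> - f' \<tau>)"
  using qexp_add[of \<nu> d f "\<lambda>e. - 1 * d' e" "\<lambda>\<tau>. - 1 * f' \<tau>"] qexp_cmult[of \<nu> d' f' "- 1"] by simp

lemma qexp_sum:
  assumes "\<And>i. i \<in> I \<Longrightarrow> qexp \<nu> (d i) (f i)"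
  shows "qexp \<nu> (\<lambda>e. \<Sum>i\<in>I. d i e) (\<lambda>\<tau>. \<Sum>i\<in>I. f i \<tau>)"
  using assms
proof (induction I rule: infinite_finite_induct)
  case (insert i I)
  then show ?case by (auto intro!: qexp_add)
qed (auto simp: qexp_def)

text \<open>Comparison with tau = i: passing from height 1 to the height Im tau multiplies the
  modulus of term e by exp (- 2 pi (e + nu) (Im tau - 1)), which is largest at e = e0.\<close>

lemma qexp_bound:
  assumes q: "qexp \<nu> d f" and z: "\<And>e. e < e0 \<Longrightarrow> d e = 0"
  obtains C where "C \<ge> 0" "\<And>\<tau>. Im \<tau> \<ge> 1 \<Longrightarrow> norm (f \<tau>) \<le> C * exp (- 2 * pi * (of_int e0 + \<nu>) * Im \<tau>)"
proof -
  let ?a = "\<lambda>e. norm (d e * nome (of_real (of_int e + \<nu>) * \<i>))"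
  define C where "C = infsum ?a UNIV * exp (2 * pi * (of_int e0 + \<nu>))"
  have n: "norm (nome (of_real r * \<tau>)) = exp (- 2 * pi * r * Im \<tau>)" for r \<tau>
    by (simp add: norm_nome)
  have s: "?a summable_on UNIV"
  proof -
    have "((\<lambda>e. d e * nome (of_real (of_int e + \<nu>) * \<i>)) has_sum f \<i>) UNIV"
      using q unfolding qexp_def by simp
    from has_sum_imp_summable[OF this] show ?thesis
      by (subst (asm) summable_on_iff_abs_summable_on_complex)
  qed
  have "norm (f \<tau>) \<le> C * exp (- 2 * pi * (of_int e0 + \<nu>) * Im \<tau>)" if t: "Im \<tau> \<ge> 1" for \<tau>
  proof -
    let ?b = "\<lambda>e. d e * nome (of_real (of_int e + \<nu>) * \<tau>)"
    let ?x = "exp (- 2 * pi * (of_int e0 + \<nu>) * (Im \<tau> - 1))"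
    have hs: "(?b has_sum f \<tau>) UNIV" using q t unfolding qexp_def by auto
    have sb: "(\<lambda>e. norm (?b e)) summable_on UNIV"
      using has_sum_imp_summable[OF hs] by (subst (asm) summable_on_iff_abs_summable_on_complex)
    have le: "norm (?b e) \<le> ?x * ?a e" for e
    proof (cases "e < e0")
      case False
      have "(of_int e0 + \<nu>) * (Im \<tau> - 1) \<le> (of_int e + \<nu>) * (Im \<tau> - 1)"
        using False t by (intro mult_right_mono) auto
      then have "- 2 * pi * (of_int e + \<nu>) * Im \<tau> \<le> - 2 * pi * (of_int e0 + \<nu>) * (Im \<tau> - 1) + - 2 * pi * (of_int e + \<nu>) * Im \<i>"
        using mult_left_mono[of _ _ "2 * pi"] by (fastforce simp: algebra_simps)
      then have "exp (- 2 * pi * (of_int e + \<nu>) * Im \<tau>) \<le> ?x * exp (- 2 * pi * (of_int e + \<nu>) * Im \<i>)"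
        unfolding exp_add[symmetric] by (subst exp_le_cancel_iff)
      from mult_left_mono[OF this, of "norm (d e)"] show ?thesis
        unfolding norm_mult n by (simp add: mult_ac)
    qed (use z in simp)
    have "norm (f \<tau>) \<le> infsum (\<lambda>e. norm (?b e)) UNIV"
      using norm_infsum_bound[OF sb] hs by (simp add: infsumI)
    also have "\<dots> \<le> infsum (\<lambda>e. ?x * ?a e) UNIV"
      by (rule infsum_mono[OF sb]) (use s le in \<open>auto intro: summable_on_cmult_right\<close>)
    also have "\<dots> = ?x * infsum ?a UNIV" by (rule infsum_cmult_right) (use s in auto)
    also have "\<dots> = C * exp (- 2 * pi * (of_int e0 + \<nu>) * Im \<tau>)"
      by (simp add: C_def exp_add [symmetric] algebra_simps)
    finally show ?thesis .
  qed
  moreover have "C \<ge> 0" unfolding C_def by (intro mult_nonneg_nonneg infsum_nonneg) auto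
  ultimately show ?thesis using that by blast
qed

text \<open>If a coefficient were nonzero there would be a first one. Removing its term leaves a
  series that decays faster than this term, which is impossible on the imaginary axis.\<close>

lemma qexp_zero:
  assumes q: "qexp \<nu> d (\<lambda>_. 0)" and z: "\<And>e. e < e0 \<Longrightarrow> d e = 0"
  shows "d e = 0"
proof (rule ccontr)
  assume "d e \<noteq> 0"
  define P where "P = (\<lambda>n. d (e0 + int n) \<noteq> 0)"
  have "P (nat (e - e0))"
    unfolding P_def using \<open>d e \<noteq> 0\<close> z[of e] by (cases "e < e0") auto
  define m where "m = (LEAST n. P n)"
  define e1 where "e1 = e0 + int m"
  have d1: "d e1 \<noteq> 0" unfolding e1_def m_def using LeastI[of P, OF \<open>P (nat (e - e0))\<close>] by (simp add: P_def)
  have z1: "d e = 0" if "e < e1" for e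
  proof (cases "e < e0")
    case False
    then have "nat (e - e0) < m" using that by (simp add: e1_def)
    then have "\<not> P (nat (e - e0))" unfolding m_def by (rule not_less_Least)
    then show ?thesis using False by (simp add: P_def)
  qed (rule z)
  let ?t = "\<lambda>e. if e = e1 then d e1 else 0"
  have "qexp \<nu> ?t (\<lambda>\<tau>. d e1 * nome (of_real (of_int e1 + \<nu>) * \<tau>))"
    unfolding qexp_def
  proof (intro allI impI)
    fix \<tau> :: complex
    show "((\<lambda>e. ?t e * nome (of_real (of_int e + \<nu>) * \<tau>)) has_sum d e1 * nome (of_real (of_int e1 + \<nu>) * \<tau>)) UNIV"
      by (rule has_sum_finite_neutralI[of "{e1}"]) auto
  qed
  from qexp_diff[OF q this]
  have "qexp \<nu> (\<lambda>e. d e - ?t e) (\<lambda>\<tau>. - (d e1 * nome (of_real (of_int e1 + \<nu>) * \<tau>)))" by simp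
  moreover have "d e - ?t e = 0" if "e < e1 + 1" for e using that z1[of e] by (cases "e = e1") auto
  ultimately obtain C where C: "C \<ge> 0"
    "\<And>\<tau>. Im \<tau> \<ge> 1 \<Longrightarrow> norm (- (d e1 * nome (of_real (of_int e1 + \<nu>) * \<tau>))) \<le> C * exp (- 2 * pi * (of_int (e1 + 1) + \<nu>) * Im \<tau>)"
    using qexp_bound[of \<nu> "\<lambda>e. d e - ?t e" _ "e1 + 1"] by blast
  have "norm (d e1) \<le> C * exp (- 2 * pi * y)" if "y \<ge> 1" for y :: real
  proof -
    have "norm (d e1) * exp (- 2 * pi * (of_int e1 + \<nu>) * y) \<le> C * exp (- 2 * pi * (of_int (e1 + 1) + \<nu>) * y)"
      using C(2)[of "Complex 0 y"] that by (simp add: norm_mult norm_nome mult.assoc)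
    also have "exp (- 2 * pi * (of_int (e1 + 1) + \<nu>) * y) = exp (- 2 * pi * y) * exp (- 2 * pi * (of_int e1 + \<nu>) * y)"
      unfolding exp_add[symmetric] by (simp add: algebra_simps)
    finally show ?thesis by (simp add: mult.assoc[symmetric])
  qed
  moreover have "((\<lambda>y::real. C * exp (- 2 * pi * y)) \<longlongrightarrow> 0) at_top"
  proof -
    have "((\<lambda>y::real. exp (- 2 * pi * y)) \<longlongrightarrow> 0) at_top" by real_asymp
    from tendsto_mult_left[OF this, of C] show ?thesis by simp
  qed
  ultimately have "norm (d e1) \<le> 0"
    by (intro tendsto_lowerbound[of "\<lambda>y::real. C * exp (- 2 * pi * y)"])
       (auto simp: eventually_at_top_linorder intro!: exI[of _ 1])
  then show False using d1 by simp
qed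

text \<open>
  The form \<open>E\<^sub>4\<^sup>a \<eta>\<^sup>r\<close> with its automorphy factor under \<open>\<tau> \<mapsto> - 1 / \<tau>\<close>. In \<open>form_coeff a r m\<close> the
  number \<open>m\<close> is the index of the leading term, so the exponents are \<open>e\<close> plus the fractional shift
  \<open>r / 24 - m\<close>.
\<close>

definition eta_form :: "nat \<Rightarrow> int \<Rightarrow> complex \<Rightarrow> complex" where
  "eta_form a r \<tau> = E4_fun \<tau> ^ a * exp (of_int r * log_eta \<tau>)"

definition eta_factor :: "nat \<Rightarrow> int \<Rightarrow> complex \<Rightarrow> complex" where
  "eta_factor a r z = z ^ (4 * a) * exp (of_int r * Ln (z / \<i>) / 2)"

definition form_coeff :: "nat \<Rightarrow> int \<Rightarrow> int \<Rightarrow> int \<Rightarrow> int" where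
  "form_coeff a r m e = (if e \<ge> m then fps_nth (form_fps a r) (nat (e - m)) else 0)"

lemma log_eta_holomorphic: "log_eta holomorphic_on {\<tau>. Im \<tau> > 0}"
  using log_eta_deriv by (intro holomorphic_onI) (auto simp: field_differentiable_def intro: has_field_derivative_at_within)

lemma E4_fun_holomorphic: "E4_fun holomorphic_on {\<tau>. Im \<tau> > 0}"
proof -
  have "nome ` {\<tau>. Im \<tau> > 0} \<subseteq> eball 0 (fps_conv_radius (cfps E4))"
    using in_conv_radius[OF norm_nome_less_1 fps_conv_radius_E4] by auto
  moreover have "nome holomorphic_on {\<tau>. Im \<tau> > 0}"
    unfolding nome_def by (intro holomorphic_intros)
  ultimately have "(eval_fps (cfps E4) \<circ> nome) holomorphic_on {\<tau>. Im \<tau> > 0}"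
    by (intro holomorphic_on_compose_gen[of nome _ _ "eball 0 (fps_conv_radius (cfps E4))"] holomorphic_on_eval_fps) auto
  then have "(\<lambda>\<tau>. eval_fps (cfps E4) (nome \<tau>)) holomorphic_on {\<tau>. Im \<tau> > 0}"
    by (simp add: o_def)
  then show ?thesis
    by (rule holomorphic_transform) (simp add: eval_fps_E4)
qed

lemma eta_form_holomorphic: "eta_form a r holomorphic_on {\<tau>. Im \<tau> > 0}"
  unfolding eta_form_def
  by (intro holomorphic_intros E4_fun_holomorphic log_eta_holomorphic)

lemma eta_form_eta_law:
  assumes "eta_law a b c d f" "Im \<tau> > 0"
  shows "eta_form k r ((of_int a * \<tau> + of_int b) / (of_int c * \<tau> + of_int d)) =
    eta_factor k r (of_int c * \<tau> + of_int d) * exp (of_real pi * \<i> * of_int (r * f) / 12) * eta_form k r \<tau>"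
proof -
  have h: "log_eta ((of_int a * \<tau> + of_int b) / (of_int c * \<tau> + of_int d)) =
       log_eta \<tau> + Ln ((of_int c * \<tau> + of_int d) / \<i>) / 2 + of_real pi * \<i> * of_int f / 12"
     "E4_fun ((of_int a * \<tau> + of_int b) / (of_int c * \<tau> + of_int d)) = (of_int c * \<tau> + of_int d)^4 * E4_fun \<tau>"
    using assms unfolding eta_law_def by blast+
  have e: "of_int r * (log_eta \<tau> + L / 2 + of_real pi * \<i> * of_int f / 12) =
     of_int r * log_eta \<tau> + of_int r * L / 2 + of_real pi * \<i> * of_int (r * f) / 12" for L
    by (simp add: algebra_simps)
  show ?thesis
    unfolding eta_form_def eta_factor_def h e exp_add power_mult_distrib power_mult
    by (simp only: mult_ac)
qed

lemma eta_form_neg_inverse: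
  assumes "Im \<tau> > 0"
  shows "eta_form k r (- 1 / \<tau>) = eta_factor k r \<tau> * eta_form k r \<tau>"
  using eta_form_eta_law[OF eta_law_S_T[of 0] assms, of k r] by simp

lemma form_fps_coeff_qexp:
  "qexp (of_int r / 24 - of_int m) (\<lambda>e. of_int (form_coeff a r m e)) (eta_form a r)"
  unfolding qexp_def
proof (intro allI impI)
  fix \<tau> :: complex assume t: "Im \<tau> > 0"
  let ?\<nu> = "of_int r / 24 - of_int m :: real"
  let ?q = "nome \<tau>"
  define w where "w = nome (of_real (of_int r / 24) * \<tau>)"
  have q: "norm ?q < 1" by (rule norm_nome_less_1[OF t])
  have "((\<lambda>n. of_int (fps_nth (form_fps a r) n) * ?q ^ n) has_sum
      (eval_fps (cfps E4) ?q ^ a * exp (of_int r * eval_fps log_phi_fps ?q))) UNIV"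
    by (rule norm_summable_imp_has_sum[OF form_fps_sums[OF q]])
  from has_sum_cmult_left[OF this, of w]
  have "((\<lambda>n. of_int (fps_nth (form_fps a r) n) * ?q ^ n * w) has_sum
      (E4_fun \<tau> ^ a * exp (of_int r * eval_fps log_phi_fps ?q) * w)) UNIV"
    by (simp only: eval_fps_E4[OF t])
  moreover have "E4_fun \<tau> ^ a * exp (of_int r * eval_fps log_phi_fps ?q) * w = eta_form a r \<tau>"
  proof -
    have "w = exp (of_int r * (of_real pi * \<i> * \<tau> / 12))"
      unfolding w_def nome_def by (rule arg_cong[where f = exp]) simp
    then show ?thesis unfolding eta_form_def log_eta_def distrib_left exp_add by (simp only: mult_ac)
  qed
  ultimately have 1: "((\<lambda>n. of_int (fps_nth (form_fps a r) n) * ?q ^ n * w) has_sum eta_form a r \<tau>) UNIV"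
    by simp
  have "((\<lambda>e. of_int (form_coeff a r m e) * nome (of_real (of_int e + ?\<nu>) * \<tau>)) has_sum eta_form a r \<tau>) {m..}"
  proof (rule has_sum_reindex_bij_witness[of _ "\<lambda>e. nat (e - m)" "\<lambda>n. m + int n", THEN iffD1, OF _ _ _ _ _ _ 1])
    fix n :: nat
    have "nome (of_real (of_int (m + int n) + ?\<nu>) * \<tau>) = nome (of_nat n * \<tau> + of_real (of_int r / 24) * \<tau>)"
      by (rule arg_cong[where f = nome]) (simp add: algebra_simps)
    then show "of_int (form_coeff a r m (m + int n)) * nome (of_real (of_int (m + int n) + ?\<nu>) * \<tau>) =
        of_int (fps_nth (form_fps a r) n) * ?q ^ n * w"
      by (simp add: form_coeff_def nome_add nome_power w_def)
  qed auto
  then show "((\<lambda>e. of_int (form_coeff a r m e) * nome (of_real (of_int e + ?\<nu>) * \<tau>)) has_sum eta_form a r \<tau>) UNIV"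
    by (rule has_sum_cong_neutral[THEN iffD1, rotated -1]) (auto simp: form_coeff_def)
qed

lemma qexp_add_1:
  assumes "qexp \<nu> d f" "Im \<tau> > 0"
  shows "f (\<tau> + 1) = nome (of_real \<nu>) * f \<tau>"
proof -
  have "((\<lambda>e. d e * nome (of_real (of_int e + \<nu>) * (\<tau> + 1))) has_sum f (\<tau> + 1)) UNIV"
    using assms unfolding qexp_def by simp
  moreover have "d e * nome (of_real (of_int e + \<nu>) * (\<tau> + 1)) = nome (of_real \<nu>) * (d e * nome (of_real (of_int e + \<nu>) * \<tau>))" for e :: int
  proof -
    have "of_real (of_int e + \<nu>) * (\<tau> + 1) = of_int e + (of_real \<nu> + of_real (of_int e + \<nu>) * \<tau>)"
      by (simp add: algebra_simps)
    then show ?thesis by (simp only: nome_add nome_of_int) simp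
  qed
  ultimately have "((\<lambda>e. nome (of_real \<nu>) * (d e * nome (of_real (of_int e + \<nu>) * \<tau>))) has_sum f (\<tau> + 1)) UNIV"
    by (simp only:)
  moreover have "((\<lambda>e. nome (of_real \<nu>) * (d e * nome (of_real (of_int e + \<nu>) * \<tau>))) has_sum nome (of_real \<nu>) * f \<tau>) UNIV"
    using assms unfolding qexp_def by (intro has_sum_cmult_right) auto
  ultimately show ?thesis by (rule has_sum_unique)
qed

text \<open>Bounds the product part of eta^(- R) near the cusp, for either sign of R.\<close>

lemma log_phi_bounded:
  obtains B where "\<And>\<tau>. Im \<tau> \<ge> 1 \<Longrightarrow> norm (eval_fps log_phi_fps (nome \<tau>)) \<le> B"
proof -
  let ?K = "cball 0 (exp (- 2 * pi)) :: complex set"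
  have "?K \<subseteq> eball 0 (fps_conv_radius log_phi_fps)"
  proof
    fix q assume "q \<in> ?K"
    moreover have "exp (- 2 * pi) < 1" by simp
    ultimately have "norm q < 1" by (simp add: le_less_trans)
    from in_conv_radius[OF this fps_conv_radius_log_phi]
    show "q \<in> eball 0 (fps_conv_radius log_phi_fps)" by simp
  qed
  then have "continuous_on ?K (eval_fps log_phi_fps)"
    by (rule continuous_on_subset[OF continuous_on_eval_fps])
  then have "bounded (eval_fps log_phi_fps ` ?K)"
    by (intro compact_imp_bounded compact_continuous_image) auto
  then obtain B where "\<forall>y\<in>eval_fps log_phi_fps ` ?K. norm y \<le> B"
    unfolding bounded_iff by blast
  then have B: "\<And>q. q \<in> ?K \<Longrightarrow> norm (eval_fps log_phi_fps q) \<le> B" by blast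
  have "nome \<tau> \<in> ?K" if "Im \<tau> \<ge> 1" for \<tau>
    using that by (simp add: norm_nome)
  with B that show ?thesis by blast
qed

text \<open>D has the weight of eta^(R / 3), but the two may differ by a cube root of unity under
  translation; cubing removes it, and D^3 / eta^R is a modular function of weight 0. The hypothesis
  \<open>order\<close> says that D^3 vanishes at the cusp to higher order than eta^R, so the
  quotient tends to 0.\<close>

lemma eta_quotient_vanishes:
  fixes D :: "complex \<Rightarrow> complex" and R :: int
  assumes hol: "D holomorphic_on {\<tau>. Im \<tau> > 0}"
    and q: "qexp \<nu> d D" and z: "\<And>e. e < e0 \<Longrightarrow> d e = 0"
    and S: "\<And>\<tau>. Im \<tau> > 0 \<Longrightarrow> D (- 1 / \<tau>) ^ 3 = exp (of_int R * Ln (\<tau> / \<i>) / 2) * D \<tau> ^ 3"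
    and int: "3 * \<nu> - of_int R / 24 = of_int k" and order: "3 * (of_int e0 + \<nu>) > of_int R / 24"
    and t: "Im \<tau> > 0"
  shows "D \<tau> = 0"
proof -
  define g where "g = (\<lambda>\<tau>. D \<tau> ^ 3 * exp (- of_int R * log_eta \<tau>))"
  have "g \<tau> = 0"
  proof (rule modular_function_vanishes[OF _ _ _ _ t])
    show "g holomorphic_on {\<tau>. Im \<tau> > 0}"
      unfolding g_def by (intro holomorphic_intros hol log_eta_holomorphic)
  next
    fix \<tau> :: complex assume t: "Im \<tau> > 0"
    have "g (\<tau> + 1) = (nome (of_real \<nu>) ^ 3 * exp (- of_int R * (of_real pi * \<i> / 12))) * g \<tau>"
    proof -
      have l: "log_eta (\<tau> + 1) = log_eta \<tau> + of_real pi * \<i> / 12"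
        using log_eta_add_int[of \<tau> 1] by simp
      show ?thesis
        unfolding g_def qexp_add_1[OF q t] l distrib_left exp_add power_mult_distrib by (simp only: mult_ac)
    qed
    also have "nome (of_real \<nu>) ^ 3 = nome (of_real (3 * \<nu>))"
      using nome_power[of 3 "of_real \<nu>"] by simp
    also have "exp (- of_int R * (of_real pi * \<i> / 12)) = nome (of_real (- of_int R / 24))"
      unfolding nome_def by (rule arg_cong[where f = exp]) simp
    also have "nome (of_real (3 * \<nu>)) * nome (of_real (- of_int R / 24)) = nome (of_int k)"
      unfolding nome_add[symmetric] of_real_add[symmetric] using int by simp
    finally show "g (\<tau> + 1) = g \<tau>" by simp
    have "g (- 1 / \<tau>) = (exp (of_int R * Ln (\<tau> / \<i>) / 2) * exp (- of_int R * (Ln (\<tau> / \<i>) / 2))) * g \<tau>"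
      unfolding g_def S[OF t] log_eta_neg_inverse[OF t] distrib_left exp_add by (simp only: mult_ac)
    also have "exp (of_int R * Ln (\<tau> / \<i>) / 2) * exp (- of_int R * (Ln (\<tau> / \<i>) / 2)) = 1"
      unfolding exp_add[symmetric] by simp
    finally show "g (- 1 / \<tau>) = g \<tau>" by simp
  next
    fix \<epsilon> :: real assume e: "\<epsilon> > 0"
    obtain C where C: "C \<ge> 0" "\<And>\<tau>. Im \<tau> \<ge> 1 \<Longrightarrow> norm (D \<tau>) \<le> C * exp (- 2 * pi * (of_int e0 + \<nu>) * Im \<tau>)"
      using qexp_bound[OF q z] by blast
    obtain B where B: "\<And>\<tau>. Im \<tau> \<ge> 1 \<Longrightarrow> norm (eval_fps log_phi_fps (nome \<tau>)) \<le> B"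
      using log_phi_bounded by blast
    define \<beta> where "\<beta> = 2 * pi * (3 * (of_int e0 + \<nu>) - of_int R / 24)"
    have \<beta>: "\<beta> > 0" using order by (simp add: \<beta>_def)
    have bd: "norm (g \<tau>) \<le> C ^ 3 * exp (\<bar>of_int R\<bar> * B) * exp (- \<beta> * Im \<tau>)" if t: "Im \<tau> \<ge> 1" for \<tau>
    proof -
      have "norm (D \<tau>) ^ 3 \<le> (C * exp (- 2 * pi * (of_int e0 + \<nu>) * Im \<tau>)) ^ 3"
        by (intro power_mono C t) auto
      also have "\<dots> = C ^ 3 * exp (3 * (- 2 * pi * (of_int e0 + \<nu>) * Im \<tau>))"
        by (simp add: power_mult_distrib exp_of_nat_mult [symmetric])
      finally have 1: "norm (D \<tau>) ^ 3 \<le> C ^ 3 * exp (3 * (- 2 * pi * (of_int e0 + \<nu>) * Im \<tau>))" .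
      let ?v = "Re (eval_fps log_phi_fps (nome \<tau>))"
      have "\<bar>?v\<bar> \<le> B" using abs_Re_le_cmod B[OF t] order_trans by blast
      then have "\<bar>of_int R\<bar> * \<bar>?v\<bar> \<le> \<bar>of_int R\<bar> * B" by (intro mult_left_mono) auto
      then have "- of_int R * ?v \<le> \<bar>of_int R\<bar> * B"
        using abs_ge_minus_self[of "of_int R * ?v"] by (simp add: abs_mult)
      moreover have "norm (exp (- of_int R * log_eta \<tau>)) = exp (of_int R * pi * Im \<tau> / 12 + - of_int R * ?v)"
        unfolding norm_exp_eq_Re log_eta_def by (simp add: algebra_simps)
      ultimately have 2: "norm (exp (- of_int R * log_eta \<tau>)) \<le> exp (of_int R * pi * Im \<tau> / 12 + \<bar>of_int R\<bar> * B)" by simp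
      have "norm (g \<tau>) \<le> C ^ 3 * exp (3 * (- 2 * pi * (of_int e0 + \<nu>) * Im \<tau>)) * exp (of_int R * pi * Im \<tau> / 12 + \<bar>of_int R\<bar> * B)"
        unfolding g_def norm_mult norm_power by (intro mult_mono 1 2) (use C in auto)
      also have "\<dots> = C ^ 3 * exp (\<bar>of_int R\<bar> * B) * exp (- \<beta> * Im \<tau>)"
        unfolding mult.assoc exp_add[symmetric] by (simp add: \<beta>_def algebra_simps)
      finally show ?thesis .
    qed
    have "((\<lambda>y::real. C ^ 3 * exp (\<bar>of_int R\<bar> * B) * exp (- \<beta> * y)) \<longlongrightarrow> C ^ 3 * exp (\<bar>of_int R\<bar> * B) * 0) at_top"
    proof (rule tendsto_mult_left)
      show "((\<lambda>y::real. exp (- \<beta> * y)) \<longlongrightarrow> 0) at_top" using \<beta> by real_asymp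
    qed
    then have "\<forall>\<^sub>F y::real in at_top. C ^ 3 * exp (\<bar>of_int R\<bar> * B) * exp (- \<beta> * y) < \<epsilon>"
      using e by (intro order_tendstoD(2)) auto
    then obtain Y where Y: "\<And>y. y \<ge> Y \<Longrightarrow> C ^ 3 * exp (\<bar>of_int R\<bar> * B) * exp (- \<beta> * y) < \<epsilon>"
      unfolding eventually_at_top_linorder by blast
    show "\<exists>Y. \<forall>\<tau>. Im \<tau> > Y \<longrightarrow> norm (g \<tau>) < \<epsilon>"
    proof (intro exI[of _ "max 1 Y"] allI impI)
      fix \<tau> :: complex assume "Im \<tau> > max 1 Y"
      then have "Im \<tau> \<ge> 1" "Im \<tau> \<ge> Y" by auto
      then show "norm (g \<tau>) < \<epsilon>" using bd[of \<tau>] Y[of "Im \<tau>"] by linarith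
    qed
  qed
  then show ?thesis by (simp add: g_def)
qed

section \<open>Scaling, sieving and twisting of expansions\<close>

lemma has_sum_finite_sum:
  fixes f :: "'b \<Rightarrow> 'a \<Rightarrow> complex"
  assumes "\<And>i. i \<in> I \<Longrightarrow> (f i has_sum S i) A"
  shows "((\<lambda>x. \<Sum>i\<in>I. f i x) has_sum (\<Sum>i\<in>I. S i)) A"
  using assms
proof (induction I rule: infinite_finite_induct)
  case (insert i I)
  then show ?case by (auto intro!: has_sum_add)
qed auto

text \<open>The integer s absorbs the change of the fractional shift: p (e + nu) = (p e + s) +
  nu.\<close>

lemma qexp_scale:
  assumes q: "qexp \<nu> d f" and p: "p > 0" and s: "real p * \<nu> = \<nu> + of_int s"
  shows "qexp \<nu> (\<lambda>e. if int p dvd e - s then d ((e - s) div int p) else 0) (\<lambda>\<tau>. f (of_nat p * \<tau>))"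
  unfolding qexp_def
proof (intro allI impI)
  fix \<tau> :: complex assume t: "Im \<tau> > 0"
  let ?d = "\<lambda>e. if int p dvd e - s then d ((e - s) div int p) else 0"
  have "((\<lambda>e. d e * nome (of_real (of_int e + \<nu>) * (of_nat p * \<tau>))) has_sum f (of_nat p * \<tau>)) UNIV"
    using q t p unfolding qexp_def by simp
  then have "((\<lambda>e. ?d e * nome (of_real (of_int e + \<nu>) * \<tau>)) has_sum f (of_nat p * \<tau>)) {e. int p dvd e - s}"
  proof (rule has_sum_reindex_bij_witness[of _ "\<lambda>e. (e - s) div int p" "\<lambda>e. int p * e + s", THEN iffD1, rotated -1])
    fix e :: int
    have "of_int e * real p + \<nu> * real p = of_int (int p * e + s) + \<nu>" using s by (simp add: mult.commute)
    then have r: "(of_int e + \<nu>) * real p = of_int (int p * e + s) + \<nu>" by (simp only: distrib_right)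
    have "of_real (of_int e + \<nu>) * (of_nat p * \<tau>) = of_real ((of_int e + \<nu>) * real p) * \<tau>" by simp
    then show "?d (int p * e + s) * nome (of_real (of_int (int p * e + s) + \<nu>) * \<tau>) =
        d e * nome (of_real (of_int e + \<nu>) * (of_nat p * \<tau>))"
      unfolding r[symmetric] using p by (simp add: mult_ac)
  qed (use p in auto)
  then show "((\<lambda>e. ?d e * nome (of_real (of_int e + \<nu>) * \<tau>)) has_sum f (of_nat p * \<tau>)) UNIV"
    by (rule has_sum_cong_neutral[THEN iffD1, rotated -1]) auto
qed

lemma nome_of_int_divide_eq_1_iff:
  assumes "p > 0"
  shows "nome (of_int n / of_nat p) = 1 \<longleftrightarrow> int p dvd n"
proof
  assume "nome (of_int n / of_nat p) = 1"
  then obtain k where "of_int n / of_nat p = (of_int k :: complex)"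
    unfolding nome_eq_1_iff by (auto elim: Ints_cases)
  then have "of_int n = (of_int (k * int p) :: complex)" using assms by (simp add: field_simps)
  then have "n = k * int p" by (simp only: of_int_eq_iff)
  then show "int p dvd n" by simp
next
  assume "int p dvd n"
  then obtain k where "n = int p * k" by auto
  then have "of_int n / of_nat p = (of_int k :: complex)" using assms by simp
  then show "nome (of_int n / of_nat p) = 1" by simp
qed

lemma sum_nome_multiples:
  assumes p: "p > 0"
  shows "(\<Sum>b<p. nome (of_int (n * int b) / of_nat p)) = (if int p dvd n then of_nat p else 0)"
proof -
  let ?w = "nome (of_int n / of_nat p)"
  have "nome (of_int (n * int b) / of_nat p) = ?w ^ b" for b
    unfolding nome_power[symmetric] by (rule arg_cong[where f = nome]) simp
  then have "(\<Sum>b<p. nome (of_int (n * int b) / of_nat p)) = (\<Sum>b<p. ?w ^ b)" by simp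
  also have "\<dots> = (if int p dvd n then of_nat p else 0)"
  proof (cases "int p dvd n")
    case True
    then have "?w = 1" using nome_of_int_divide_eq_1_iff[OF p] by blast
    then show ?thesis using True by simp
  next
    case False
    then have "?w \<noteq> 1" using nome_of_int_divide_eq_1_iff[OF p] by simp
    moreover have "?w ^ p = 1"
      unfolding nome_power[symmetric] using p by simp
    ultimately show ?thesis using False geometric_sum[of ?w p] by simp
  qed
  finally show ?thesis .
qed

lemma nome_shift_split:
  "nome (of_real x * ((\<tau> + of_int b) / of_nat p)) = nome (of_real (x / real p) * \<tau>) * nome (of_real (x * of_int b) / of_nat p)"
  unfolding nome_add[symmetric] by (rule arg_cong[where f = nome]) (simp add: add_divide_distrib algebra_simps)

text \<open>Averaging over p translates keeps one class of exponents modulo p. The factor 24 clears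
  the denominator of nu, so that only p-th roots of unity occur; being coprime to p, it does not
  lose any residue class.\<close>

lemma qexp_U:
  assumes q: "qexp \<nu> d f" and p: "p > 0" "coprime (24 :: int) (int p)"
    and s: "real p * \<nu> = \<nu> + of_int s" and \<kappa>: "24 * \<nu> = of_int \<kappa>"
  shows "qexp \<nu> (\<lambda>e. d (int p * e + s)) (\<lambda>\<tau>. 1 / of_nat p * (\<Sum>b<p. f ((\<tau> + of_int (24 * int b)) / of_nat p)))"
  unfolding qexp_def
proof (intro allI impI)
  fix \<tau> :: complex assume t: "Im \<tau> > 0"
  let ?c = "\<lambda>e b. nome (of_int ((24 * e + \<kappa>) * int b) / of_nat p)"
  let ?S = "1 / of_nat p * (\<Sum>b<p. f ((\<tau> + of_int (24 * int b)) / of_nat p))"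
  \<comment> \<open>The relation 24 s = p kappa - kappa gives 24 e + kappa = 24 (e - s) + p
    kappa.\<close>
  have dvd: "int p dvd 24 * e + \<kappa> \<longleftrightarrow> int p dvd e - s" for e
  proof -
    have "of_int (24 * s) = real p * (24 * \<nu>) - 24 * \<nu>" using s by simp
    then have "of_int (24 * s) = (of_int (int p * \<kappa> - \<kappa>) :: real)" unfolding \<kappa> by simp
    then have "24 * s = int p * \<kappa> - \<kappa>" by (simp only: of_int_eq_iff)
    then have eq: "24 * e + \<kappa> = 24 * (e - s) + int p * \<kappa>" by (simp add: algebra_simps)
    have "int p dvd 24 * e + \<kappa> \<longleftrightarrow> int p dvd 24 * (e - s)"
      unfolding eq by (rule dvd_add_left_iff) simp
    also have "\<dots> \<longleftrightarrow> int p dvd e - s"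
      by (rule coprime_dvd_mult_right_iff) (use p(2) in \<open>simp add: coprime_commute\<close>)
    finally show ?thesis .
  qed
  have "((\<lambda>e. d e * nome (of_real (of_int e + \<nu>) * ((\<tau> + of_int (24 * int b)) / of_nat p))) has_sum
      f ((\<tau> + of_int (24 * int b)) / of_nat p)) UNIV" for b
  proof -
    have "Im ((\<tau> + of_int (24 * int b)) / of_nat p) > 0" using t p by simp
    then show ?thesis using q unfolding qexp_def by blast
  qed
  from has_sum_cmult_right[OF has_sum_finite_sum[of "{..<p}", OF this], of "1 / of_nat p"]
  have "((\<lambda>e. 1 / of_nat p * (\<Sum>b<p. d e * nome (of_real (of_int e + \<nu>) * ((\<tau> + of_int (24 * int b)) / of_nat p)))) has_sum ?S) UNIV" .
  moreover have "1 / of_nat p * (\<Sum>b<p. d e * nome (of_real (of_int e + \<nu>) * ((\<tau> + of_int (24 * int b)) / of_nat p))) =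
      (if int p dvd e - s then d e * nome (of_real ((of_int e + \<nu>) / real p) * \<tau>) else 0)" for e
  proof -
    have "(of_int e + \<nu>) * of_int (24 * int b) = of_int ((24 * e + \<kappa>) * int b)" for b
    proof -
      have "(of_int e + \<nu>) * of_int (24 * int b) = (24 * of_int e + 24 * \<nu>) * real b" by (simp add: algebra_simps)
      then show ?thesis unfolding \<kappa> by simp
    qed
    then have "(\<Sum>b<p. d e * nome (of_real (of_int e + \<nu>) * ((\<tau> + of_int (24 * int b)) / of_nat p))) =
      (\<Sum>b<p. d e * nome (of_real ((of_int e + \<nu>) / real p) * \<tau>) * ?c e b)"
      unfolding nome_shift_split by (simp only: of_real_of_int_eq mult.assoc)
    also have "\<dots> = d e * nome (of_real ((of_int e + \<nu>) / real p) * \<tau>) * (\<Sum>b<p. ?c e b)"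
      by (rule sum_distrib_left[symmetric])
    finally show ?thesis using p unfolding sum_nome_multiples[OF p(1)] dvd by simp
  qed
  ultimately have "((\<lambda>e. if int p dvd e - s then d e * nome (of_real ((of_int e + \<nu>) / real p) * \<tau>) else 0) has_sum ?S) UNIV"
    by simp
  then have "((\<lambda>e. d e * nome (of_real ((of_int e + \<nu>) / real p) * \<tau>)) has_sum ?S) {e. int p dvd e - s}"
    by (rule has_sum_cong_neutral[THEN iffD1, rotated -1]) auto
  then show "((\<lambda>e. d (int p * e + s) * nome (of_real (of_int e + \<nu>) * \<tau>)) has_sum ?S) UNIV"
  proof (rule has_sum_reindex_bij_witness[of _ "\<lambda>e. int p * e + s" "\<lambda>e. (e - s) div int p", THEN iffD1, rotated -1])
    fix e assume "e \<in> {e. int p dvd e - s}"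
    then have "int p dvd e - s" by simp
    then obtain k where "e - s = int p * k" ..
    then have k: "e = int p * k + s" by simp
    have "(of_int e + \<nu>) / real p = of_int k + \<nu>"
      using s p unfolding k by (simp add: field_simps)
    then show "d (int p * ((e - s) div int p) + s) * nome (of_real (of_int ((e - s) div int p) + \<nu>) * \<tau>) =
       d e * nome (of_real ((of_int e + \<nu>) / real p) * \<tau>)"
      using p k by simp
  qed (use p in auto)
qed

text \<open>A weighted sum of translates multiplies each coefficient by a finite exponential sum;
  for the Legendre symbol as weight this is a Gauss sum.\<close>

lemma qexp_twist:
  assumes q: "qexp \<nu> d f" and p: "p > 0" and \<kappa>: "24 * \<nu> = of_int \<kappa>"
  shows "qexp \<nu> (\<lambda>e. d e * (\<Sum>b\<in>I. s b * nome (of_int ((24 * e + \<kappa>) * b) / of_nat p)))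
    (\<lambda>\<tau>. \<Sum>b\<in>I. s b * f (\<tau> + of_int (24 * b) / of_nat p))"
  unfolding qexp_def
proof (intro allI impI)
  fix \<tau> :: complex assume t: "Im \<tau> > 0"
  have "((\<lambda>e. d e * nome (of_real (of_int e + \<nu>) * (\<tau> + of_int (24 * b) / of_nat p))) has_sum
      f (\<tau> + of_int (24 * b) / of_nat p)) UNIV" for b
  proof -
    have "(of_int (24 * b) / of_nat p :: complex) = of_real (of_int (24 * b) / real p)" by simp
    then have "Im (of_int (24 * b) / of_nat p) = 0" by (metis Im_complex_of_real)
    then show ?thesis using q t unfolding qexp_def by simp
  qed
  then have "((\<lambda>e. s b * (d e * nome (of_real (of_int e + \<nu>) * (\<tau> + of_int (24 * b) / of_nat p)))) has_sum
      s b * f (\<tau> + of_int (24 * b) / of_nat p)) UNIV" for b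
    by (rule has_sum_cmult_right)
  from has_sum_finite_sum[of I, OF this]
  have "((\<lambda>e. \<Sum>b\<in>I. s b * (d e * nome (of_real (of_int e + \<nu>) * (\<tau> + of_int (24 * b) / of_nat p)))) has_sum
      (\<Sum>b\<in>I. s b * f (\<tau> + of_int (24 * b) / of_nat p))) UNIV" .
  moreover have "(\<Sum>b\<in>I. s b * (d e * nome (of_real (of_int e + \<nu>) * (\<tau> + of_int (24 * b) / of_nat p)))) =
      d e * (\<Sum>b\<in>I. s b * nome (of_int ((24 * e + \<kappa>) * b) / of_nat p)) * nome (of_real (of_int e + \<nu>) * \<tau>)" for e
  proof -
    have "nome (of_real (of_int e + \<nu>) * (\<tau> + of_int (24 * b) / of_nat p)) =
        nome (of_int ((24 * e + \<kappa>) * b) / of_nat p) * nome (of_real (of_int e + \<nu>) * \<tau>)" for b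
    proof -
      have "(of_real (of_int e + \<nu>) :: complex) * of_int (24 * b) = of_real ((24 * of_int e + 24 * \<nu>) * of_int b)"
        by (simp add: algebra_simps)
      also have "\<dots> = of_int ((24 * e + \<kappa>) * b)" unfolding \<kappa> by simp
      finally have "of_real (of_int e + \<nu>) * (\<tau> + of_int (24 * b) / of_nat p) =
        of_int ((24 * e + \<kappa>) * b) / of_nat p + of_real (of_int e + \<nu>) * \<tau>"
        unfolding distrib_left times_divide_eq_right by (simp only: add.commute)
      then show ?thesis by (simp only: nome_add)
    qed
    then show ?thesis by (simp add: sum_distrib_left sum_distrib_right mult_ac)
  qed
  ultimately show "((\<lambda>e. d e * (\<Sum>b\<in>I. s b * nome (of_int ((24 * e + \<kappa>) * b) / of_nat p)) * nome (of_real (of_int e + \<nu>) * \<tau>)) has_sum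
      (\<Sum>b\<in>I. s b * f (\<tau> + of_int (24 * b) / of_nat p))) UNIV" by simp
qed

section \<open>Coset representatives for the Hecke operators\<close>

text \<open>Carries a matrix and its Rademacher value along a word: a letter m is a translation by m
  followed by an inversion and adds m + 3. The flag collects the sign conditions of
  \<open>eta_law_S\<close>, so a whole word is certified by one evaluation.\<close>

fun eta_run :: "int list \<Rightarrow> bool \<Rightarrow> int \<Rightarrow> int \<Rightarrow> int \<Rightarrow> int \<Rightarrow> int \<Rightarrow> bool \<times> int \<times> int \<times> int \<times> int \<times> int" where
  "eta_run [] ok a b c d f = (ok, a, b, c, d, f)"
| "eta_run (m # ms) ok a b c d f =
     eta_run ms (ok \<and> a + m * c < 0) c d (- (a + m * c)) (- (b + m * d)) (f + m + 3)"

lemma eta_run_sound: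
  "eta_run ms ok a b c d f = (ok', a', b', c', d', f') \<Longrightarrow> ok' \<Longrightarrow>
     ok \<and> (eta_law a b c d f \<longrightarrow> eta_law a' b' c' d' f')"
proof (induction ms arbitrary: ok a b c d f)
  case (Cons m ms)
  have "ok \<and> a + m * c < 0"
    and "eta_law c d (- (a + m * c)) (- (b + m * d)) (f + m + 3) \<longrightarrow> eta_law a' b' c' d' f'"
    using Cons.IH[of "ok \<and> a + m * c < 0" c d "- (a + m * c)" "- (b + m * d)" "f + m + 3"] Cons.prems by auto
  then show ?case using eta_law_S[OF eta_law_T, of a b c d f m] by blast
qed auto

text \<open>
  An entry \<open>(b, b', m\<^sub>0, [m\<^sub>1, \<dots>, m\<^sub>r], n)\<close> certifies that the matrix with rows
  \<open>(24 b, *)\<close> and \<open>(p, - 24 b')\<close> acts as the word with letters \<open>m\<^sub>0, m\<^sub>r, \<dots>, m\<^sub>1, n\<close>: these are the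
  exponents of the translation \<open>T\<close>, separated by single inversions \<open>S\<close>. Representatives divisible
  by \<open>24\<close> make \<open>\<tau> \<mapsto> \<tau> + 24\<close> fix \<open>\<eta>\<close>, and \<open>\<phi>\<close> records the \<open>24\<close>th root of unity
  in the transformation law.
\<close>

definition coset_check :: "int \<Rightarrow> (int \<Rightarrow> int) \<Rightarrow> int \<times> int \<times> int \<times> int list \<times> int \<Rightarrow> bool" where
  "coset_check p \<phi> x \<longleftrightarrow> (case x of (b, b', m0, ms, n) \<Rightarrow>
     (case eta_run ms True 0 (- 1) 1 n n of (ok, a, \<beta>, c, d, f) \<Rightarrow> ok \<and> a + m0 * c = 24 * b \<and> c = p \<and> d = - 24 * b' \<and>
       p * (\<beta> + m0 * d) = - 1 - 576 * b * b' \<and> (f + m0) mod 24 = \<phi> b'))"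

definition coset_pairs :: "(int \<times> int \<times> int \<times> int list \<times> int) list \<Rightarrow> (int \<times> int) list" where
  "coset_pairs = map (\<lambda>(b, b', m0, ms, n). (b, b'))"

text \<open>Determinant 1 pairs b with b' by 576 b b' = - 1 modulo p. In both tables m0 is the
  integer part of 24 b / p, and the list, read from its end, continues the expansion of 24 b / p as
  a continued fraction with minus signs. Its entries are at most - 2, which keeps the lower left
  entries positive.\<close>

definition table7 :: "(int \<times> int \<times> int \<times> int list \<times> int) list" where
  "table7 =
   [(1, 3, 3, [- 2, - 2, - 3], - 11),
    (2, 5, 6, [- 2, - 2, - 2, - 2, - 2, - 2], - 18),
    (3, 1, 10, [- 2, - 4], - 4),
    (4, 6, 13, [- 3, - 2, - 2], - 21),
    (5, 2, 17, [- 7], - 7),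
    (6, 4, 20, [- 4, - 2], - 14)]"

definition table49 :: "(int \<times> int \<times> int \<times> int list \<times> int) list" where
  "table49 =
   [(1, 45, 0, [- 2, - 2, - 2, - 2, - 2, - 2, - 2, - 2, - 2, - 2, - 2, - 2, - 2, - 2, - 2, - 2, - 2, - 2, - 2, - 2, - 2, - 2, - 2, - 3], - 23),
    (2, 47, 0, [- 2, - 2, - 2, - 2, - 2, - 2, - 2, - 2, - 2, - 2, - 2, - 2, - 2, - 2, - 2, - 2, - 2, - 2, - 2, - 2, - 2, - 2, - 2, - 2, - 2, - 2, - 2, - 2, - 2, - 2, - 2, - 2, - 2, - 2, - 2, - 2, - 2, - 2, - 2, - 2, - 2, - 2, - 2, - 2, - 2, - 2, - 2, - 2], - 24),
    (3, 15, 1, [- 2, - 3, - 2, - 2, - 2, - 2, - 2, - 2, - 3], - 8),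
    (4, 48, 1, [- 3, - 2, - 2, - 2, - 2, - 2, - 2, - 2, - 2, - 2, - 2, - 2, - 2, - 2, - 2, - 2, - 2, - 2, - 2, - 2, - 2, - 2, - 2, - 2], - 24),
    (5, 9, 2, [- 2, - 4, - 2, - 2, - 2, - 3], - 5),
    (6, 32, 2, [- 4, - 2, - 2, - 2, - 2, - 2, - 2, - 2, - 2, - 2, - 2, - 2, - 2, - 2, - 2, - 2], - 16),
    (8, 24, 3, [- 5, - 2, - 2, - 2, - 2, - 2, - 2, - 2, - 2, - 2, - 2, - 2], - 12),
    (9, 5, 4, [- 2, - 6, - 2, - 3], - 3),
    (10, 29, 4, [- 2, - 2, - 2, - 3, - 2, - 2, - 2, - 2, - 2, - 2, - 2, - 2], - 15),
    (11, 13, 5, [- 2, - 3, - 2, - 3, - 3], - 7),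
    (12, 16, 5, [- 7, - 2, - 2, - 2, - 2, - 2, - 2, - 2], - 8),
    (13, 11, 6, [- 2, - 3, - 4, - 3], - 6),
    (15, 3, 7, [- 2, - 9, - 3], - 2),
    (16, 12, 7, [- 9, - 2, - 2, - 2, - 2, - 2], - 6),
    (17, 43, 8, [- 2, - 2, - 2, - 2, - 2, - 2, - 2, - 2, - 2, - 2, - 2, - 2, - 2, - 2, - 2, - 4], - 22),
    (18, 27, 8, [- 2, - 2, - 2, - 4, - 2, - 2, - 2, - 2], - 14),
    (19, 23, 9, [- 2, - 2, - 3, - 2, - 2, - 4], - 12),
    (20, 39, 9, [- 2, - 2, - 2, - 2, - 2, - 2, - 2, - 2, - 3, - 2, - 2, - 2], - 20),
    (22, 31, 10, [- 2, - 2, - 2, - 2, - 4, - 2, - 2, - 2], - 16),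
    (23, 19, 11, [- 2, - 2, - 5, - 4], - 10),
    (24, 8, 11, [- 13, - 2, - 2, - 2], - 4),
    (25, 41, 12, [- 2, - 2, - 2, - 2, - 2, - 2, - 2, - 2, - 2, - 2, - 2, - 5], - 21),
    (26, 30, 12, [- 4, - 2, - 2, - 3, - 2, - 2], - 15),
    (27, 18, 13, [- 6, - 2, - 5], - 9),
    (29, 10, 14, [- 10, - 5], - 5),
    (30, 26, 14, [- 4, - 5, - 2, - 2], - 13),
    (31, 22, 15, [- 5, - 2, - 6], - 11),
    (32, 6, 15, [- 17, - 2, - 2], - 3),
    (33, 37, 16, [- 2, - 2, - 2, - 2, - 2, - 2, - 2, - 7], - 19),
    (34, 46, 16, [- 3, - 2, - 2, - 2, - 2, - 2, - 2, - 3, - 2], - 23),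
    (36, 38, 17, [- 3, - 3, - 2, - 3, - 2], - 19),
    (37, 33, 18, [- 2, - 2, - 2, - 2, - 2, - 9], - 17),
    (38, 36, 18, [- 3, - 4, - 3, - 2], - 18),
    (39, 20, 19, [- 5, - 10], - 10),
    (40, 44, 19, [- 3, - 2, - 2, - 2, - 4, - 2], - 22),
    (41, 25, 20, [- 2, - 2, - 2, - 13], - 13),
    (43, 17, 21, [- 2, - 2, - 17], - 9),
    (44, 40, 21, [- 3, - 2, - 6, - 2], - 20),
    (45, 1, 22, [- 2, - 25], - 1),
    (46, 34, 22, [- 3, - 9, - 2], - 17),
    (47, 2, 23, [- 49], - 1),
    (48, 4, 23, [- 25, - 2], - 2)]"

definition legendre7 :: "int \<Rightarrow> int" where
  "legendre7 b = (if b mod 7 = 0 then 0 else if b mod 7 \<in> {1, 2, 4} then 1 else - 1)"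

text \<open>The indices 6 and 18 stand for the 24th roots of unity i and - i: on these matrices the
  multiplier of eta is i times a Legendre symbol, which is the origin of the quadratic twist in the
  Hecke operator. For 49 the multiplier is trivial.\<close>

lemma table7_check: "list_all (coset_check 7 (\<lambda>b. if legendre7 b = 1 then 6 else 18)) table7"
  by (simp add: table7_def coset_check_def legendre7_def)

lemma table49_check: "list_all (coset_check 49 (\<lambda>b. 0)) table49"
  by (simp add: table49_def coset_check_def)

lemma coset_pairs7: "coset_pairs table7 = [(1, 3), (2, 5), (3, 1), (4, 6), (5, 2), (6, 4)]"
  by (simp add: coset_pairs_def table7_def)

lemma coset_pairs49: "coset_pairs table49 = [(1, 45), (2, 47), (3, 15), (4, 48), (5, 9), (6, 32), (8, 24), (9, 5), (10, 29), (11, 13), (12, 16), (13, 11), (15, 3), (16, 12), (17, 43), (18, 27), (19, 23), (20, 39), (22, 31), (23, 19), (24, 8), (25, 41), (26, 30), (27, 18), (29, 10), (30, 26), (31, 22), (32, 6), (33, 37), (34, 46), (36, 38), (37, 33), (38, 36), (39, 20), (40, 44), (41, 25), (43, 17), (44, 40), (45, 1), (46, 34), (47, 2), (48, 4)]"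
  by (simp add: coset_pairs_def table49_def)

text \<open>At z = (w + 24 b') / p the denominator p z - 24 b' is w itself, so the automorphy factor
  is the one of the plain inversion of w.\<close>

lemma coset_check_eta_form:
  assumes T: "list_all (coset_check p \<phi>) T" and b: "(b, b') \<in> set (coset_pairs T)"
    and w: "Im w > 0" and p: "p > 0"
  obtains f where "f mod 24 = \<phi> b'"
    "eta_form k r (of_int (24 * b) / of_int p - 1 / (of_int p * w)) =
      eta_factor k r w * exp (of_real pi * \<i> * of_int (r * f) / 12) * eta_form k r ((w + of_int (24 * b')) / of_int p)"
proof -
  obtain m0 ms n where x: "(b, b', m0, ms, n) \<in> set T" using b unfolding coset_pairs_def by auto
  then have "coset_check p \<phi> (b, b', m0, ms, n)" using T unfolding list_all_iff by blast
  moreover obtain ok a \<beta> c d f where wd: "eta_run ms True 0 (- 1) 1 n n = (ok, a, \<beta>, c, d, f)" using prod_cases6 by blast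
  ultimately have h: "ok" "a + m0 * c = 24 * b" "c = p" "d = - 24 * b'"
    "p * (\<beta> + m0 * d) = - 1 - 576 * b * b'" "(f + m0) mod 24 = \<phi> b'"
    by (auto simp: coset_check_def)
  have law: "eta_law (24 * b) (\<beta> + m0 * d) p (- 24 * b') (f + m0)"
    using eta_law_T[of a \<beta> c d f m0] eta_run_sound[OF wd h(1)] eta_law_S_T[of n] h(2-4) by simp
  let ?z = "(w + of_int (24 * b')) / of_int p"
  have z: "Im ?z > 0" using w p by simp
  have p0: "(of_int p :: complex) \<noteq> 0" and w0: "w \<noteq> 0" using p w by auto
  have d: "of_int p * ?z + of_int (- 24 * b') = w" using p0 by simp
  have "of_int p * of_int (\<beta> + m0 * d) = (- 1 - 576 * of_int b * of_int b' :: complex)"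
  proof -
    have "(of_int (p * (\<beta> + m0 * d)) :: complex) = of_int (- 1 - 576 * b * b')" unfolding h(5) ..
    then show ?thesis by (simp only: of_int_mult of_int_diff of_int_minus of_int_1 of_int_numeral)
  qed
  then have \<beta>: "of_int (\<beta> + m0 * d) = (- 1 - 576 * of_int b * of_int b' :: complex) / of_int p"
    using p0 by (simp only: nonzero_eq_divide_eq mult.commute not_False_eq_True)
  have "(of_int (24 * b) * ?z + of_int (\<beta> + m0 * d)) / w = of_int (24 * b) / of_int p - 1 / (of_int p * w)"
    unfolding \<beta> using p0 w0 by (simp add: field_simps)
  then show ?thesis
    using that[OF h(6)] eta_form_eta_law[OF law z, of k r] unfolding d by simp
qed

section \<open>Sums over residues, automorphy factors and the Gauss sum\<close>

lemma sum_int_1_6: "(\<Sum>b\<in>{1..6::int}. g b) = g 1 + g 2 + g 3 + g 4 + g 5 + g 6"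
proof -
  have "{1..6::int} = {1, 2, 3, 4, 5, 6}" by auto
  then show ?thesis by (simp add: add.assoc)
qed

lemma sum_pairs7:
  fixes g :: "int \<Rightarrow> complex"
  shows "(\<Sum>x\<leftarrow>coset_pairs table7. g (fst x)) = (\<Sum>b\<in>{1..6}. g b)"
    "(\<Sum>x\<leftarrow>coset_pairs table7. g (snd x)) = (\<Sum>b\<in>{1..6}. g b)"
  unfolding coset_pairs7 sum_int_1_6 by (simp_all add: ac_simps)

text \<open>The residues modulo 49 split into 0, the nonzero multiples of 7 and the units, which the
  inversion treats in three different ways. Both b and b' run through all units.\<close>

lemma sum_mod_49:
  fixes g :: "int \<Rightarrow> complex"
  shows "(\<Sum>b<49. g (int b)) = g 0 + (\<Sum>b\<in>{1..6}. g (7 * b)) + (\<Sum>x\<leftarrow>coset_pairs table49. g (fst x))"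
    "(\<Sum>x\<leftarrow>coset_pairs table49. g (fst x)) = (\<Sum>x\<leftarrow>coset_pairs table49. g (snd x))"
proof -
  let ?P = "coset_pairs table49"
  have d: "distinct (map fst ?P)" "distinct (map snd ?P)" "set (map fst ?P) = set (map snd ?P)"
    "distinct ([0, 7, 14, 21, 28, 35, 42] @ map fst ?P)"
    "set ([0, 7, 14, 21, 28, 35, 42] @ map fst ?P) = int ` {..<49}"
    unfolding coset_pairs49 by (simp_all add: lessThan_nat_numeral) (simp add: insert_commute, auto)?
  have s: "(\<Sum>x\<leftarrow>xs. g x) = sum g (set xs)" if "distinct xs" for xs
    using that by (simp add: sum_list_distinct_conv_sum_set)
  have "(\<Sum>x\<leftarrow>?P. g (fst x)) = (\<Sum>x\<leftarrow>map fst ?P. g x)" "(\<Sum>x\<leftarrow>?P. g (snd x)) = (\<Sum>x\<leftarrow>map snd ?P. g x)"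
    by (simp_all add: o_def)
  then show "(\<Sum>x\<leftarrow>?P. g (fst x)) = (\<Sum>x\<leftarrow>?P. g (snd x))"
    using s[OF d(1)] s[OF d(2)] d(3) by simp
  have "(\<Sum>b<49. g (int b)) = sum g (int ` {..<49})" by (simp add: sum.reindex)
  also have "\<dots> = (\<Sum>x\<leftarrow>[0, 7, 14, 21, 28, 35, 42] @ map fst ?P. g x)"
    unfolding s[OF d(4)] d(5) ..
  also have "\<dots> = g 0 + (\<Sum>b\<in>{1..6}. g (7 * b)) + (\<Sum>x\<leftarrow>?P. g (fst x))"
    unfolding sum_int_1_6 by (simp add: o_def)
  finally show "(\<Sum>b<49. g (int b)) = g 0 + (\<Sum>b\<in>{1..6}. g (7 * b)) + (\<Sum>x\<leftarrow>?P. g (fst x))" .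
qed

lemma sum_mod_7:
  fixes g :: "int \<Rightarrow> complex"
  shows "(\<Sum>b<7. g (int b)) = g 0 + (\<Sum>b\<in>{1..6}. g b)"
  unfolding sum_int_1_6 by (simp add: lessThan_nat_numeral ac_simps)

lemma eta_factor_scale:
  assumes "x > 0" "Im \<tau> > 0"
  shows "eta_factor k r (of_real x * \<tau>) = of_real (x ^ (4 * k) * exp (of_int r * ln x / 2)) * eta_factor k r \<tau>"
proof -
  have "Ln (of_real x * \<tau> / \<i>) = of_real (ln x) + Ln (\<tau> / \<i>)"
  proof -
    have "\<tau> / \<i> \<noteq> 0" using assms by auto
    from Ln_times_of_real[OF assms(1) this] show ?thesis
      using assms(1) by (simp only: times_divide_eq_right Ln_of_real)
  qed
  then have "exp (of_int r * Ln (of_real x * \<tau> / \<i>) / 2) = of_real (exp (of_int r * ln x / 2)) * exp (of_int r * Ln (\<tau> / \<i>) / 2)"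
    by (simp add: exp_of_real [symmetric] exp_add [symmetric] algebra_simps add_divide_distrib)
  then show ?thesis by (simp add: eta_factor_def power_mult_distrib mult_ac)
qed

text \<open>Two inversions cancel. This lets an exchange of terms proved in one direction be read in
  the other.\<close>

lemma eta_factor_neg_inverse:
  assumes "Im \<tau> > 0"
  shows "eta_factor k r \<tau> * eta_factor k r (- 1 / \<tau>) = 1"
proof -
  have t: "\<tau> \<noteq> 0" using assms by auto
  have n: "\<tau> / \<i> \<notin> \<real>\<^sub>\<le>\<^sub>0" using assms by (auto simp: complex_nonpos_Reals_iff Re_divide)
  have "- 1 / \<tau> / \<i> = inverse (\<tau> / \<i>)" using t by (simp add: field_simps)
  then have "Ln (- 1 / \<tau> / \<i>) = - Ln (\<tau> / \<i>)" using Ln_inverse[OF n] by simp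
  moreover have "\<tau> ^ (4 * k) * (- 1 / \<tau>) ^ (4 * k) = 1"
    using t by (simp add: power_mult_distrib [symmetric] power_mult)
  moreover have "exp (of_int r * Ln (\<tau> / \<i>) / 2) * exp (of_int r * - Ln (\<tau> / \<i>) / 2) = 1"
    by (simp add: exp_add [symmetric])
  ultimately show ?thesis unfolding eta_factor_def
    by (metis (no_types, lifting) mult.assoc mult.left_commute mult_1_right)
qed

lemma nome_sevenths: "nome (of_int k / 7) = nome (1 / 7) ^ nat (k mod 7)"
proof -
  have "nome (of_int k / 7) = nome (of_int (k div 7) + of_nat (nat (k mod 7)) * (1 / 7))"
  proof (rule arg_cong[where f = nome])
    have k: "(of_int k :: complex) = 7 * of_int (k div 7) + of_int (k mod 7)"
    proof -
      have "(of_int k :: complex) = of_int (7 * (k div 7) + k mod 7)" by simp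
      then show ?thesis by (simp only: of_int_add of_int_mult of_int_numeral)
    qed
    have m: "of_nat (nat (k mod 7)) = (of_int (k mod 7) :: complex)" by simp
    show "of_int k / 7 = (of_int (k div 7) + of_nat (nat (k mod 7)) * (1 / 7) :: complex)"
      unfolding m by (subst k) (simp add: add_divide_distrib)
  qed
  then show ?thesis by (simp only: nome_add nome_of_int nome_power mult_1_left)
qed

text \<open>The sign of the Gauss sum is left open as \<open>\<sigma>\<close>, since all that counts
  later is a middle term divisible by 49. Therefore the square of the sum, G^2 = - 7, is
  enough.\<close>

lemma Gauss_sum_7:
  obtains \<sigma> :: int where
    "\<And>n. 49 * exp (- of_real (ln 7) / 2) * (- \<i>) * (\<Sum>b\<in>{1..6}. of_int (legendre7 b) * nome (of_int (n * b) / 7)) =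
      of_int (49 * \<sigma> * legendre7 n)"
proof -
  define \<zeta> where "\<zeta> = nome (1 / 7)"
  define G where "G = \<zeta> + \<zeta>^2 - \<zeta>^3 + \<zeta>^4 - \<zeta>^5 - \<zeta>^6"
  define \<kappa> where "\<kappa> = 49 * exp (- of_real (ln 7) / 2) * (- \<i>)"
  have "\<zeta> ^ 7 = 1" unfolding \<zeta>_def nome_power[symmetric] by simp
  moreover have "\<zeta> \<noteq> 1" unfolding \<zeta>_def using nome_of_int_divide_eq_1_iff[of 7 1] by simp
  moreover have "(\<zeta> - 1) * (1 + \<zeta> + \<zeta>^2 + \<zeta>^3 + \<zeta>^4 + \<zeta>^5 + \<zeta>^6) = \<zeta> ^ 7 - 1"
    by (simp add: algebra_simps eval_nat_numeral)
  ultimately have c: "1 + \<zeta> + \<zeta>^2 + \<zeta>^3 + \<zeta>^4 + \<zeta>^5 + \<zeta>^6 = 0" by simp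
  \<comment> \<open>The second factor is the polynomial quotient of G^2 + 7 by the seventh
    cyclotomic polynomial.\<close>
  have "G^2 + 7 = (1 + \<zeta> + \<zeta>^2 + \<zeta>^3 + \<zeta>^4 + \<zeta>^5 + \<zeta>^6) * (7 - 7 * \<zeta> + \<zeta>^2 + \<zeta>^3 - 3 * \<zeta>^4 + \<zeta>^5 + \<zeta>^6)"
    unfolding G_def by (simp add: algebra_simps eval_nat_numeral)
  then have G2: "G^2 = - 7" unfolding c by (simp add: eq_neg_iff_add_eq_0)
  have "\<kappa>^2 = 49^2 * exp (- of_real (ln 7)) * (- 1)"
    unfolding \<kappa>_def power_mult_distrib by (simp add: exp_double [symmetric])
  also have "exp (- of_real (ln 7)) = (1 / 7 :: complex)"
    by (simp add: exp_minus exp_of_real inverse_eq_divide)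
  finally have "(\<kappa> * G)^2 = 49^2" unfolding power_mult_distrib G2 by simp
  then have "\<kappa> * G = 49 \<or> \<kappa> * G = - 49" unfolding power2_eq_iff .
  then obtain \<sigma> :: int where \<sigma>: "\<kappa> * G = of_int (49 * \<sigma>)"
    by (metis mult_1_right mult_minus_right of_int_minus of_int_numeral)
  have "(\<Sum>b\<in>{1..6}. of_int (legendre7 b) * nome (of_int (n * b) / 7)) = of_int (legendre7 n) * G" for n
  proof -
    have e: "nome (of_int (n * b) / 7) = \<zeta> ^ nat ((n mod 7) * b mod 7)" for b
      unfolding nome_sevenths \<zeta>_def[symmetric] by (simp add: mod_mult_left_eq)
    have "0 \<le> n mod 7" "n mod 7 < 7" by auto
    then consider "n mod 7 = 0" | "n mod 7 = 1" | "n mod 7 = 2" | "n mod 7 = 3" | "n mod 7 = 4" | "n mod 7 = 5" | "n mod 7 = 6"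
      by linarith
    then show ?thesis
      unfolding sum_int_1_6 e by cases (simp_all add: legendre7_def G_def)
  qed
  then have "\<kappa> * (\<Sum>b\<in>{1..6}. of_int (legendre7 b) * nome (of_int (n * b) / 7)) = of_int (49 * \<sigma> * legendre7 n)" for n
    using \<sigma> by (simp add: mult.left_commute[of \<kappa>])
  with that show ?thesis unfolding \<kappa>_def by blast
qed

section \<open>The Hecke operator of index 49 in weight 7/2\<close>

definition F_form :: "nat \<Rightarrow> complex \<Rightarrow> complex" where
  "F_form i = eta_form (3 * i + 1) (- 24 * int i - 1)"

text \<open>The leading index - i gives all these forms the same exponents e - 1/24; in particular
  the coefficients for i = 0 are the numbers e_4(e).\<close>

definition F_coeff :: "nat \<Rightarrow> int \<Rightarrow> int" where
  "F_coeff i = form_coeff (3 * i + 1) (- 24 * int i - 1) (- int i)"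

lemma F_coeff_eq_0: "e < - int i \<Longrightarrow> F_coeff i e = 0"
  by (simp add: F_coeff_def form_coeff_def)

lemma form_fps_nth_0: "fps_nth (form_fps a r) 0 = 1"
proof -
  have "fps_nth qq_inv 0 = 1"
    using arg_cong[OF qq_inf_inv, of "\<lambda>f. fps_nth f 0"] by (simp add: qq_inf_nth_0)
  then show ?thesis by (simp add: form_fps_def fps_nth_power_0 qq_inf_nth_0 E4_nth)
qed

lemma F_coeff_leading: "F_coeff i (- int i) = 1"
  by (simp add: F_coeff_def form_coeff_def form_fps_nth_0)

lemma F_form_qexp: "qexp (- 1 / 24) (\<lambda>e. of_int (F_coeff i e)) (F_form i)"
proof -
  have "of_int (- 24 * int i - 1) / 24 - of_int (- int i) = (- 1 / 24 :: real)" by (simp add: field_simps)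
  then show ?thesis
    using form_fps_coeff_qexp[of "- 24 * int i - 1" "- int i" "3 * i + 1"] unfolding F_form_def F_coeff_def by simp
qed

text \<open>As z^12 = (z / i)^12, the automorphy factors of E_4^3 and eta^24 cancel.\<close>

lemma eta_factor_F:
  assumes "Im \<tau> > 0"
  shows "eta_factor (3 * i + 1) (- 24 * int i - 1) \<tau> = eta_factor 1 (- 1) \<tau>"
proof -
  define L where "L = Ln (\<tau> / \<i>)"
  have "exp L = \<tau> / \<i>" unfolding L_def by (rule exp_Ln) (use assms in auto)
  then have t: "\<tau> = \<i> * exp L" by (simp add: field_simps)
  have "of_int (- 24 * int i - 1) * L / 2 = - (of_nat (12 * i) * L) + of_int (- 1) * L / 2" by (simp add: field_simps)
  then have "exp (of_int (- 24 * int i - 1) * L / 2) = inverse (exp L ^ (12 * i)) * exp (of_int (- 1) * L / 2)"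
    by (simp only: exp_add exp_minus exp_of_nat_mult)
  moreover have "\<tau> ^ (4 * (3 * i + 1)) = exp L ^ (12 * i) * \<tau> ^ (4 * 1)"
  proof -
    have "\<tau> ^ (4 * (3 * i + 1)) = (\<tau> ^ 12) ^ i * \<tau> ^ 4" by (simp add: power_add power_mult [symmetric] algebra_simps)
    also have "\<tau> ^ 12 = exp L ^ 12" unfolding t power_mult_distrib by (simp add: eval_nat_numeral)
    finally show ?thesis by (simp add: power_mult)
  qed
  ultimately show ?thesis unfolding eta_factor_def L_def[symmetric] by simp
qed

definition half_factor :: "complex \<Rightarrow> complex" where "half_factor = eta_factor 1 (- 1)"

lemma F_form_neg_inverse:
  assumes "Im \<tau> > 0"
  shows "F_form i (- 1 / \<tau>) = half_factor \<tau> * F_form i \<tau>"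
  unfolding F_form_def half_factor_def eta_form_neg_inverse[OF assms] eta_factor_F[OF assms] ..

lemma half_factor_scale:
  assumes "x > 0" "Im \<tau> > 0"
  shows "half_factor (of_real x * \<tau>) = of_real (x ^ 4 * exp (- ln x / 2)) * half_factor \<tau>"
  using eta_factor_scale[OF assms, of 1 "- 1"] unfolding half_factor_def by simp

lemma holomorphic_on_upper_half_affine:
  assumes "f holomorphic_on {\<tau>. Im \<tau> > 0}" "c > 0"
  shows "(\<lambda>\<tau>. f (of_real c * \<tau> + of_real d)) holomorphic_on {\<tau>. Im \<tau> > 0}"
proof -
  have "(f \<circ> (\<lambda>\<tau>. of_real c * \<tau> + of_real d)) holomorphic_on {\<tau>. Im \<tau> > 0}"
    by (rule holomorphic_on_compose_gen[OF _ assms(1)]) (use assms(2) in \<open>auto intro!: holomorphic_intros\<close>)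
  then show ?thesis by (simp add: o_def)
qed

text \<open>Each \<open>F_coeff j\<close> begins with the coefficient 1 at - j, so the system is
  unitriangular and has an integral solution. Without integrality the powers of 7 in front of the
  sums would say nothing.\<close>

lemma F_triangular:
  fixes g :: "int \<Rightarrow> int"
  assumes "\<And>e. e \<le> - int n \<Longrightarrow> g e = 0"
  shows "\<exists>c. \<forall>e\<le>0. (\<Sum>j<n. c j * F_coeff j e) = g e"
  using assms
proof (induction n arbitrary: g)
  case 0
  then show ?case by auto
next
  case (Suc n)
  define g' where "g' = (\<lambda>e. g e - g (- int n) * F_coeff n e)"
  have "g' e = 0" if "e \<le> - int n" for e
  proof (cases "e = - int n")
    case True
    then show ?thesis by (simp add: g'_def F_coeff_leading)
  next
    case False
    then show ?thesis using that Suc.prems[of e] F_coeff_eq_0[of e n] by (simp add: g'_def)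
  qed
  then obtain c where c: "\<And>e. e \<le> 0 \<Longrightarrow> (\<Sum>j<n. c j * F_coeff j e) = g' e" using Suc.IH by blast
  show ?case
  proof (intro exI[of _ "c(n := g (- int n))"] allI impI)
    fix e :: int assume "e \<le> 0"
    have "(\<Sum>j<n. (c(n := g (- int n))) j * F_coeff j e) = (\<Sum>j<n. c j * F_coeff j e)"
      by (intro sum.cong) auto
    then show "(\<Sum>j<Suc n. (c(n := g (- int n))) j * F_coeff j e) = g e"
      using c[OF \<open>e \<le> 0\<close>] by (simp add: g'_def)
  qed
qed

text \<open>
  The constant is normalised by the quadratic Gauss sum modulo 7, so that the middle term of the
  Hecke operator multiplies the coefficients by \<open>- 49\<close>, \<open>0\<close> or \<open>49\<close>.
\<close>

definition hecke_twist :: complex where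
  "hecke_twist = 49 * exp (- of_real (ln 7) / 2) * (- \<i>)"

text \<open>The three sums belong to the upper triangular coset representatives of determinant 49,
  with diagonal (49, 1), (7, 7) and (1, 49). All translations are by multiples of 24.\<close>

definition hecke :: "nat \<Rightarrow> complex \<Rightarrow> complex" where
  "hecke i \<tau> = 7 ^ 5 * F_form i (of_nat 49 * \<tau>) +
     hecke_twist * (\<Sum>b\<in>{1..6}. of_int (legendre7 b) * F_form i (\<tau> + of_int (24 * b) / of_nat 7)) +
     1 / of_nat 49 * (\<Sum>b<49. F_form i ((\<tau> + of_int (24 * int b)) / of_nat 49))"

text \<open>The inversion permutes the terms. It exchanges tau -> 49 tau with the translate 0 of the
  last sum, the translates by nonzero multiples of 7 with the twisted terms, and the unit translate
  b with b'. The three constants are those for which the exchanged terms match.\<close>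

lemma hecke_neg_inverse:
  assumes t: "Im \<tau> > 0"
  shows "hecke i (- 1 / \<tau>) = half_factor \<tau> * hecke i \<tau>"
proof -
  let ?J = half_factor and ?F = "F_form i" and ?r = "- 24 * int i - 1" and ?k = "3 * i + 1"
  have t0: "\<tau> \<noteq> 0" using t by auto
  have t': "Im (- 1 / \<tau>) > 0" by (rule Im_neg_inverse_pos[OF t])
  have ln49: "ln 49 = 2 * ln (7 :: real)"
    using ln_realpow[of 7 2] by simp
  have e49: "exp (- ln 49 / 2) = 1 / (7 :: real)" "exp (- ln (1 / 49) / 2) = (7 :: real)"
    unfolding ln_div[of 1 "49 :: real", simplified] ln49 by (simp_all add: exp_minus inverse_eq_divide)
  \<comment> \<open>In weight 7/2 the scaling by 1 / 49 costs 49^(- 7/2) = 7^(- 7), and 7^5 * 7^(-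
    7) is the constant 1 / 49 of the last sum.\<close>
  have V: "?F (of_nat 49 * (- 1 / \<tau>)) = 1 / 7 ^ 7 * (?J \<tau> * ?F ((\<tau> + of_int (24 * 0)) / of_nat 49))"
  proof -
    have t49: "Im (of_real (1 / 49) * \<tau>) > 0" using t by simp
    have "of_nat 49 * (- 1 / \<tau>) = - 1 / (of_real (1 / 49) * \<tau>)" by simp
    then have "?F (of_nat 49 * (- 1 / \<tau>)) = ?J (of_real (1 / 49) * \<tau>) * ?F (of_real (1 / 49) * \<tau>)"
      using F_form_neg_inverse[OF t49] by (simp only:)
    also have "?J (of_real (1 / 49) * \<tau>) = of_real ((1 / 49) ^ 4 * exp (- ln (1 / 49) / 2)) * ?J \<tau>"
      by (rule half_factor_scale) (use t in auto)
    also have "of_real ((1 / 49) ^ 4 * exp (- ln (1 / 49) / 2)) = (1 / 7 ^ 7 :: complex)"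
      unfolding e49 by (simp add: power_divide)
    finally show ?thesis by (simp add: mult.assoc)
  qed
  have U0: "?F ((- 1 / \<tau> + of_int (24 * 0)) / of_nat 49) = 7 ^ 7 * (?J \<tau> * ?F (of_nat 49 * \<tau>))"
  proof -
    have t49: "Im (of_real 49 * \<tau>) > 0" using t by simp
    have "(- 1 / \<tau> + of_int (24 * 0)) / of_nat 49 = - 1 / (of_real 49 * \<tau>)" by simp
    then have "?F ((- 1 / \<tau> + of_int (24 * 0)) / of_nat 49) = ?J (of_real 49 * \<tau>) * ?F (of_real 49 * \<tau>)"
      using F_form_neg_inverse[OF t49] by (simp only:)
    also have "?J (of_real 49 * \<tau>) = of_real (49 ^ 4 * exp (- ln 49 / 2)) * ?J \<tau>"
      by (rule half_factor_scale) (use t in auto)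
    also have "of_real (49 ^ 4 * exp (- ln 49 / 2)) = (7 ^ 7 :: complex)"
      unfolding e49 by simp
    finally show ?thesis by (simp add: mult.assoc)
  qed
  \<comment> \<open>The exponent of eta is - 1 modulo 24, so only the residue of \<open>f\<close>
    modulo 24 counts.\<close>
  have phase: "exp (of_real pi * \<i> * of_int (?r * f) / 12) = (if f mod 24 = 0 then 1 else if f mod 24 = 6 then - \<i> else \<i>)"
    if "f mod 24 \<in> {0, 6, 18}" for f
  proof -
    define m where "m = f mod 24"
    define k where "k = int i * f + f div 24"
    have "f = 24 * (f div 24) + m" unfolding m_def by simp
    then have f: "?r * f = - m - 24 * k" unfolding k_def by (simp add: algebra_simps)
    have "of_real pi * \<i> * of_int (?r * f) / 12 = of_real (- pi * of_int m / 12) * \<i> + - (2 * of_int k * of_real pi * \<i>)"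
      unfolding f by (simp add: algebra_simps add_divide_distrib diff_divide_distrib)
    then have "exp (of_real pi * \<i> * of_int (?r * f) / 12) = exp (of_real (- pi * of_int m / 12) * \<i>) * exp (- (2 * of_int k * of_real pi * \<i>))"
      by (simp only: exp_add)
    also have "exp (- (2 * of_int k * of_real pi * \<i>)) = 1"
      unfolding exp_eq_1 by (auto intro!: exI[of _ "- k"])
    also have "exp (of_real (- pi * of_int m / 12) * \<i>) = cis (- pi * of_int m / 12)"
      by (simp add: cis_conv_exp mult.commute)
    finally have *: "exp (of_real pi * \<i> * of_int (?r * f) / 12) = cis (- pi * of_int m / 12)" by simp
    have "cis (- pi * 6 / 12) = - \<i>" "cis (- pi * 18 / 12) = \<i>"
    proof -
      have "cis (- pi * 6 / 12) = inverse (cis (pi / 2))" unfolding cis_inverse by (rule arg_cong[where f = cis]) simp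
      then show "cis (- pi * 6 / 12) = - \<i>" by simp
      have "cis (- pi * 18 / 12) = cis (pi / 2) * cis (- (2 * pi))" unfolding cis_mult by (rule arg_cong[where f = cis]) simp
      also have "cis (- (2 * pi)) = 1" by (simp add: complex_eq_iff)
      finally show "cis (- pi * 18 / 12) = \<i>" by simp
    qed
    then show ?thesis using that unfolding * m_def by auto
  qed
  have U: "?F ((- 1 / \<tau> + of_int (24 * b)) / of_nat 49) = ?J \<tau> * ?F ((\<tau> + of_int (24 * b')) / of_nat 49)"
    if bb: "(b, b') \<in> set (coset_pairs table49)" for b b'
  proof -
    obtain f where f: "f mod 24 = 0"
      "eta_form ?k ?r (of_int (24 * b) / of_int 49 - 1 / (of_int 49 * \<tau>)) =
       eta_factor ?k ?r \<tau> * exp (of_real pi * \<i> * of_int (?r * f) / 12) * eta_form ?k ?r ((\<tau> + of_int (24 * b')) / of_int 49)"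
      using coset_check_eta_form[OF table49_check bb t, of ?k ?r] by auto
    have e1: "(- 1 / \<tau> + of_int (24 * b)) / of_nat 49 = of_int (24 * b) / of_int 49 - 1 / (of_int 49 * \<tau>)"
      using t0 by (simp add: field_simps)
    have ph: "exp (of_real pi * \<i> * of_int (?r * f) / 12) = 1" using phase[of f] f(1) by simp
    have m: "(of_nat 49 :: complex) = of_int 49" by simp
    show ?thesis
      unfolding e1 unfolding m F_form_def half_factor_def f(2) ph eta_factor_F[OF t] by (simp only: mult_1_right)
  qed
  \<comment> \<open>7^(7/2) from the scaling by 7 in weight 7/2, times - i from the phase.\<close>
  define K where "K = 7 ^ 4 * exp (- of_real (ln 7) / 2) * (- \<i>)"
  have W: "?F ((- 1 / z + of_int (24 * (7 * b))) / of_nat 49) = K * of_int (legendre7 b') * (?J z * ?F (z + of_int (24 * b') / of_nat 7))"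
    if b: "(b, b') \<in> set (coset_pairs table7)" and z: "Im z > 0" for b b' z
  proof -
    have z7: "Im (of_real 7 * z) > 0" using z by simp
    obtain f where f: "f mod 24 = (if legendre7 b' = 1 then 6 else 18)"
      "eta_form ?k ?r (of_int (24 * b) / of_int 7 - 1 / (of_int 7 * (of_real 7 * z))) =
       eta_factor ?k ?r (of_real 7 * z) * exp (of_real pi * \<i> * of_int (?r * f) / 12) * eta_form ?k ?r ((of_real 7 * z + of_int (24 * b')) / of_int 7)"
      using coset_check_eta_form[OF table7_check b z7, of ?k ?r] by auto
    have z0: "z \<noteq> 0" using z by auto
    have e1: "(- 1 / z + of_int (24 * (7 * b))) / of_nat 49 = of_int (24 * b) / of_int 7 - 1 / (of_int 7 * (of_real 7 * z))"
      using z0 by (simp add: field_simps)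
    have e2: "(of_real 7 * z + of_int (24 * b')) / of_int 7 = z + of_int (24 * b') / of_nat 7"
      by (simp add: add_divide_distrib)
    have "legendre7 b' = 1 \<or> legendre7 b' = - 1"
      using b unfolding coset_pairs7 by (auto simp: legendre7_def)
    then have ph: "exp (of_real pi * \<i> * of_int (?r * f) / 12) = - \<i> * of_int (legendre7 b')"
      using phase[of f] f(1) by auto
    have "eta_factor ?k ?r (of_real 7 * z) = 7 ^ 4 * exp (- of_real (ln 7) / 2) * ?J z"
      using half_factor_scale[of 7 z] z unfolding eta_factor_F[OF z7] half_factor_def[symmetric] by (simp add: exp_of_real [symmetric])
    then show ?thesis using f(2) unfolding e1 e2 ph F_form_def K_def by (simp only: mult_ac)
  qed
  have K: "hecke_twist = 1 / 49 * K" by (simp add: hecke_twist_def K_def)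
  have JJ: "?J (- 1 / \<tau>) * ?J \<tau> = 1"
    using eta_factor_neg_inverse[OF t] unfolding half_factor_def by (simp add: mult.commute)
  \<comment> \<open>The reverse exchange: \<open>W\<close> at - 1 / tau, where the two automorphy
    factors cancel by \<open>JJ\<close>.\<close>
  have W': "K * of_int (legendre7 b') * ?F (- 1 / \<tau> + of_int (24 * b') / of_nat 7) = ?J \<tau> * ?F ((\<tau> + of_int (24 * (7 * b))) / of_nat 49)"
    if b: "(b, b') \<in> set (coset_pairs table7)" for b b'
  proof -
    have "?F ((\<tau> + of_int (24 * (7 * b))) / of_nat 49) = K * of_int (legendre7 b') * (?J (- 1 / \<tau>) * ?F (- 1 / \<tau> + of_int (24 * b') / of_nat 7))"
      using W[OF b t'] t0 by simp
    then have "?J \<tau> * ?F ((\<tau> + of_int (24 * (7 * b))) / of_nat 49) = (?J (- 1 / \<tau>) * ?J \<tau>) * (K * of_int (legendre7 b') * ?F (- 1 / \<tau> + of_int (24 * b') / of_nat 7))"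
      by (simp only: mult_ac)
    then show ?thesis unfolding JJ by simp
  qed
  let ?G = "\<lambda>\<tau> b. ?F ((\<tau> + of_int (24 * b)) / of_nat 49)"
  let ?H = "\<lambda>\<tau> b. of_int (legendre7 b) * ?F (\<tau> + of_int (24 * b) / of_nat 7)"
  have s1: "(\<Sum>x\<leftarrow>coset_pairs table49. ?G (- 1 / \<tau>) (fst x)) = (\<Sum>x\<leftarrow>coset_pairs table49. ?J \<tau> * ?G \<tau> (snd x))"
    by (intro arg_cong[where f = sum_list] map_cong refl) (use U in auto)
  have s2: "(\<Sum>x\<leftarrow>coset_pairs table7. ?G (- 1 / \<tau>) (7 * fst x)) = (\<Sum>x\<leftarrow>coset_pairs table7. K * ?J \<tau> * ?H \<tau> (snd x))"
    by (intro arg_cong[where f = sum_list] map_cong refl) (use W[OF _ t] in \<open>auto simp: mult_ac\<close>)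
  have s3: "(\<Sum>x\<leftarrow>coset_pairs table7. K * ?H (- 1 / \<tau>) (snd x)) = (\<Sum>x\<leftarrow>coset_pairs table7. ?J \<tau> * ?G \<tau> (7 * fst x))"
    by (intro arg_cong[where f = sum_list] map_cong refl) (use W' in \<open>auto simp: mult.assoc\<close>)
  have T1: "(\<Sum>b<49. ?G (- 1 / \<tau>) (int b)) = 7 ^ 7 * (?J \<tau> * ?F (of_nat 49 * \<tau>)) +
      (\<Sum>b\<in>{1..6}. K * ?J \<tau> * ?H \<tau> b) + (\<Sum>x\<leftarrow>coset_pairs table49. ?J \<tau> * ?G \<tau> (snd x))"
    unfolding sum_mod_49(1)[of "?G (- 1 / \<tau>)"] s1 U0 sum_pairs7(1)[symmetric] s2 sum_pairs7(2)[of "\<lambda>b. K * ?J \<tau> * ?H \<tau> b"] ..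
  have T2: "(\<Sum>b\<in>{1..6}. K * ?H (- 1 / \<tau>) b) = (\<Sum>b\<in>{1..6}. ?J \<tau> * ?G \<tau> (7 * b))"
    using s3 unfolding sum_pairs7(1)[of "\<lambda>b. ?J \<tau> * ?G \<tau> (7 * b)"] sum_pairs7(2)[of "\<lambda>b. K * ?H (- 1 / \<tau>) b"] .
  have T3: "(\<Sum>b<49. ?J \<tau> * ?G \<tau> (int b)) = ?J \<tau> * ?G \<tau> 0 + (\<Sum>b\<in>{1..6}. ?J \<tau> * ?G \<tau> (7 * b)) + (\<Sum>x\<leftarrow>coset_pairs table49. ?J \<tau> * ?G \<tau> (snd x))"
    unfolding sum_mod_49(1)[of "\<lambda>b. ?J \<tau> * ?G \<tau> b"] sum_mod_49(2)[of "\<lambda>b. ?J \<tau> * ?G \<tau> b"] ..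
  define P Q R where "P = (\<Sum>b\<in>{1..6}. ?H \<tau> b)" and "Q = (\<Sum>b<49. ?G \<tau> (int b))" and "R = (\<Sum>x\<leftarrow>coset_pairs table49. ?J \<tau> * ?G \<tau> (snd x))"
  have T1': "(\<Sum>b<49. ?G (- 1 / \<tau>) (int b)) = 7 ^ 7 * (?J \<tau> * ?F (of_nat 49 * \<tau>)) + K * ?J \<tau> * P + R"
    unfolding T1 P_def R_def sum_distrib_left ..
  have T2': "K * (\<Sum>b\<in>{1..6}. ?H (- 1 / \<tau>) b) = ?J \<tau> * Q - ?J \<tau> * ?G \<tau> 0 - R"
    unfolding sum_distrib_left T2 Q_def T3 R_def by simp
  have "hecke i (- 1 / \<tau>) = 7 ^ 5 * (1 / 7 ^ 7 * (?J \<tau> * ?G \<tau> 0)) + 1 / 49 * (?J \<tau> * Q - ?J \<tau> * ?G \<tau> 0 - R)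
      + 1 / 49 * (7 ^ 7 * (?J \<tau> * ?F (of_nat 49 * \<tau>)) + K * ?J \<tau> * P + R)"
    unfolding hecke_def V T1' K mult.assoc[of _ K] T2' by simp
  also have "\<dots> = ?J \<tau> * (7 ^ 5 * ?F (of_nat 49 * \<tau>) + 1 / 49 * K * P + 1 / 49 * Q)"
    by (simp add: algebra_simps)
  also have "\<dots> = ?J \<tau> * hecke i \<tau>"
    unfolding hecke_def K P_def Q_def by simp
  finally show ?thesis .
qed

lemma coprime_24_49: "coprime (24 :: int) 49"
proof (rule coprimeI)
  fix c :: int assume "c dvd 24" "c dvd 49"
  then have "c dvd 49 - 2 * 24" by (intro dvd_diff dvd_mult)
  then show "is_unit c" by simp
qed

text \<open>The shift 2 in the indices comes from 49 * (- 1 / 24) = - 1 / 24 - 2. The middle factor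
  is a Legendre symbol of 24 e - 1 up to a sign, one function for all i.\<close>

lemma hecke_qexp:
  obtains \<epsilon> :: "int \<Rightarrow> int" where
    "\<And>i. qexp (- 1 / 24) (\<lambda>e. of_int (7 ^ 5 * (if 49 dvd e + 2 then F_coeff i ((e + 2) div 49) else 0) +
       49 * \<epsilon> e * F_coeff i e + F_coeff i (49 * e - 2))) (hecke i)"
proof -
  obtain \<sigma> :: int where \<sigma>: "\<And>n. hecke_twist * (\<Sum>b\<in>{1..6}. of_int (legendre7 b) * nome (of_int (n * b) / 7)) =
      of_int (49 * \<sigma> * legendre7 n)"
    using Gauss_sum_7 unfolding hecke_twist_def by blast
  define \<epsilon> where "\<epsilon> = (\<lambda>e. \<sigma> * legendre7 (24 * e - 1))"
  have "qexp (- 1 / 24) (\<lambda>e. of_int (7 ^ 5 * (if 49 dvd e + 2 then F_coeff i ((e + 2) div 49) else 0) +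
       49 * \<epsilon> e * F_coeff i e + F_coeff i (49 * e - 2))) (hecke i)" for i
  proof -
    note q = F_form_qexp[of i]
    have V: "qexp (- 1 / 24) (\<lambda>e. if int 49 dvd e - - 2 then of_int (F_coeff i ((e - - 2) div int 49)) else 0)
        (\<lambda>\<tau>. F_form i (of_nat 49 * \<tau>))"
      by (rule qexp_scale[OF q]) auto
    have W: "qexp (- 1 / 24) (\<lambda>e. of_int (F_coeff i e) * (\<Sum>b\<in>{1..6}. of_int (legendre7 b) * nome (of_int ((24 * e + - 1) * b) / of_nat 7)))
        (\<lambda>\<tau>. \<Sum>b\<in>{1..6}. of_int (legendre7 b) * F_form i (\<tau> + of_int (24 * b) / of_nat 7))"
      by (rule qexp_twist[OF q]) auto
    have U: "qexp (- 1 / 24) (\<lambda>e. of_int (F_coeff i (int 49 * e + - 2)))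
        (\<lambda>\<tau>. 1 / of_nat 49 * (\<Sum>b<49. F_form i ((\<tau> + of_int (24 * int b)) / of_nat 49)))"
      by (rule qexp_U[OF q, where \<kappa> = "- 1"]) (auto simp: coprime_24_49)
    have "qexp (- 1 / 24) (\<lambda>e. 7 ^ 5 * (if int 49 dvd e - - 2 then of_int (F_coeff i ((e - - 2) div int 49)) else 0) +
        hecke_twist * (of_int (F_coeff i e) * (\<Sum>b\<in>{1..6}. of_int (legendre7 b) * nome (of_int ((24 * e + - 1) * b) / of_nat 7))) +
        of_int (F_coeff i (int 49 * e + - 2))) (\<lambda>\<tau>. hecke i \<tau>)"
      unfolding hecke_def by (intro qexp_add qexp_cmult V W U)
    moreover have "7 ^ 5 * (if int 49 dvd e - - 2 then of_int (F_coeff i ((e - - 2) div int 49)) else 0) +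
        hecke_twist * (of_int (F_coeff i e) * (\<Sum>b\<in>{1..6}. of_int (legendre7 b) * nome (of_int ((24 * e + - 1) * b) / of_nat 7))) +
        of_int (F_coeff i (int 49 * e + - 2)) =
        (of_int (7 ^ 5 * (if 49 dvd e + 2 then F_coeff i ((e + 2) div 49) else 0) +
          49 * \<epsilon> e * F_coeff i e + F_coeff i (49 * e - 2)) :: complex)" for e
    proof -
      have "hecke_twist * (of_int (F_coeff i e) * (\<Sum>b\<in>{1..6}. of_int (legendre7 b) * nome (of_int ((24 * e + - 1) * b) / of_nat 7))) =
          of_int (49 * \<epsilon> e * F_coeff i e)"
        using \<sigma>[of "24 * e + - 1"] by (simp add: \<epsilon>_def mult.left_commute[of hecke_twist])
      then show ?thesis by (cases "49 dvd e + 2") simp_all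
    qed
    ultimately show ?thesis by (simp only:)
  qed
  with that show ?thesis by blast
qed

lemma hecke_holomorphic: "hecke i holomorphic_on {\<tau>. Im \<tau> > 0}"
proof -
  have h: "F_form i holomorphic_on {\<tau>. Im \<tau> > 0}" unfolding F_form_def by (rule eta_form_holomorphic)
  have "(\<lambda>\<tau>. F_form i (of_nat 49 * \<tau>)) holomorphic_on {\<tau>. Im \<tau> > 0}"
    using holomorphic_on_upper_half_affine[OF h, of 49 0] by simp
  moreover have "(\<lambda>\<tau>. F_form i (\<tau> + of_int (24 * b) / of_nat 7)) holomorphic_on {\<tau>. Im \<tau> > 0}" for b
    using holomorphic_on_upper_half_affine[OF h, of 1 "of_int (24 * b) / 7"] by simp
  moreover have "(\<lambda>\<tau>. F_form i ((\<tau> + of_int (24 * int b)) / of_nat 49)) holomorphic_on {\<tau>. Im \<tau> > 0}" for b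
    using holomorphic_on_upper_half_affine[OF h, of "1 / 49" "of_int (24 * int b) / 49"] by (simp add: add_divide_distrib)
  ultimately show ?thesis unfolding hecke_def by (intro holomorphic_intros)
qed

text \<open>The three terms are matched separately at all e <= 0, constant term included, so that
  each sum keeps its own factor 1, 49 or 7^5. What remains has exponents from 1 - 1/24 on and must
  vanish.\<close>

theorem hecke_relation:
  obtains \<epsilon> :: "int \<Rightarrow> int" where
    "\<And>i. \<exists>u v w. \<forall>e. 7 ^ 5 * (if 49 dvd e + 2 then F_coeff i ((e + 2) div 49) else 0) + 49 * \<epsilon> e * F_coeff i e + F_coeff i (49 * e - 2) =
      (\<Sum>j<(i + 47) div 49. u j * F_coeff j e) + 49 * (\<Sum>j<i + 1. v j * F_coeff j e) +
      7 ^ 5 * (\<Sum>j<49 * i + 3. w j * F_coeff j e)"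
proof -
  obtain \<epsilon> :: "int \<Rightarrow> int" where \<epsilon>: "\<And>i. qexp (- 1 / 24) (\<lambda>e. of_int (7 ^ 5 * (if 49 dvd e + 2 then F_coeff i ((e + 2) div 49) else 0) +
       49 * \<epsilon> e * F_coeff i e + F_coeff i (49 * e - 2))) (hecke i)"
    using hecke_qexp by blast
  define h where "h = (\<lambda>i e. 7 ^ 5 * (if 49 dvd e + 2 then F_coeff i ((e + 2) div 49) else 0) +
       49 * \<epsilon> e * F_coeff i e + F_coeff i (49 * e - 2))"
  have "\<exists>u v w. \<forall>e. h i e = (\<Sum>j<(i + 47) div 49. u j * F_coeff j e) + 49 * (\<Sum>j<i + 1. v j * F_coeff j e) +
      7 ^ 5 * (\<Sum>j<49 * i + 3. w j * F_coeff j e)" for i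
  proof -
    \<comment> \<open>\<open>F_coeff i (49 * e - 2)\<close> can be nonzero only if j = - e satisfies
      49 j <= i - 2, and \<open>(i + 47) div 49\<close> counts the j >= 0 with this
      property.\<close>
    have "\<exists>u. \<forall>e\<le>0. (\<Sum>j<(i + 47) div 49. u j * F_coeff j e) = F_coeff i (49 * e - 2)"
    proof (rule F_triangular)
      fix e assume "e \<le> - int ((i + 47) div 49)"
      then have "49 * e - 2 < - int i" by linarith
      then show "F_coeff i (49 * e - 2) = 0" by (rule F_coeff_eq_0)
    qed
    then obtain u where u: "\<And>e. e \<le> 0 \<Longrightarrow> (\<Sum>j<(i + 47) div 49. u j * F_coeff j e) = F_coeff i (49 * e - 2)" by blast
    have "\<exists>v. \<forall>e\<le>0. (\<Sum>j<i + 1. v j * F_coeff j e) = \<epsilon> e * F_coeff i e"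
      by (rule F_triangular) (simp add: F_coeff_eq_0)
    then obtain v where v: "\<And>e. e \<le> 0 \<Longrightarrow> (\<Sum>j<i + 1. v j * F_coeff j e) = \<epsilon> e * F_coeff i e" by blast
    have "\<exists>w. \<forall>e\<le>0. (\<Sum>j<49 * i + 3. w j * F_coeff j e) = (if 49 dvd e + 2 then F_coeff i ((e + 2) div 49) else 0)"
    proof (rule F_triangular)
      fix e assume "e \<le> - int (49 * i + 3)"
      then have "(e + 2) div 49 < - int i" by linarith
      then show "(if 49 dvd e + 2 then F_coeff i ((e + 2) div 49) else 0) = 0" by (simp add: F_coeff_eq_0)
    qed
    then obtain w where w: "\<And>e. e \<le> 0 \<Longrightarrow> (\<Sum>j<49 * i + 3. w j * F_coeff j e) = (if 49 dvd e + 2 then F_coeff i ((e + 2) div 49) else 0)" by blast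
    define s where "s = (\<lambda>e. (\<Sum>j<(i + 47) div 49. u j * F_coeff j e) + 49 * (\<Sum>j<i + 1. v j * F_coeff j e) +
      7 ^ 5 * (\<Sum>j<49 * i + 3. w j * F_coeff j e))"
    define S where "S = (\<lambda>\<tau>. (\<Sum>j<(i + 47) div 49. of_int (u j) * F_form j \<tau>) + 49 * (\<Sum>j<i + 1. of_int (v j) * F_form j \<tau>) +
      7 ^ 5 * (\<Sum>j<49 * i + 3. of_int (w j) * F_form j \<tau>))"
    have S: "qexp (- 1 / 24) (\<lambda>e. of_int (s e)) S"
    proof -
      have "qexp (- 1 / 24) (\<lambda>e. (\<Sum>j<(i + 47) div 49. of_int (u j) * of_int (F_coeff j e)) + 49 * (\<Sum>j<i + 1. of_int (v j) * of_int (F_coeff j e)) +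
        7 ^ 5 * (\<Sum>j<49 * i + 3. of_int (w j) * of_int (F_coeff j e))) S"
        unfolding S_def by (intro qexp_add qexp_cmult qexp_sum F_form_qexp)
      then show ?thesis by (simp add: s_def)
    qed
    define D where "D = (\<lambda>\<tau>. hecke i \<tau> - S \<tau>)"
    have D: "qexp (- 1 / 24) (\<lambda>e. of_int (h i e) - of_int (s e)) D"
      unfolding D_def h_def by (rule qexp_diff[OF \<epsilon> S])
    have z: "of_int (h i e) - of_int (s e) = (0 :: complex)" if "e < 1" for e
    proof -
      have "h i e = s e" unfolding h_def s_def using u[of e] v[of e] w[of e] that by (simp add: mult.assoc)
      then show ?thesis by simp
    qed
    have "F_form j holomorphic_on {\<tau>. Im \<tau> > 0}" for j unfolding F_form_def by (rule eta_form_holomorphic)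
    then have hol: "D holomorphic_on {\<tau>. Im \<tau> > 0}"
      unfolding D_def S_def by (intro holomorphic_intros hecke_holomorphic)
    have inv: "D (- 1 / \<tau>) = half_factor \<tau> * D \<tau>" if "Im \<tau> > 0" for \<tau>
      unfolding D_def S_def hecke_neg_inverse[OF that] F_form_neg_inverse[OF that]
      by (simp add: algebra_simps sum_distrib_left)
    \<comment> \<open>Since tau^12 = (tau / i)^12, the cube of the factor is that of a form of
      weight 21/2, namely of eta^21.\<close>
    have cube: "half_factor \<tau> ^ 3 = exp (of_int 21 * Ln (\<tau> / \<i>) / 2)" if "Im \<tau> > 0" for \<tau>
    proof -
      define L where "L = Ln (\<tau> / \<i>)"
      have "exp L = \<tau> / \<i>" unfolding L_def by (rule exp_Ln) (use that in auto)
      then have t: "\<tau> = \<i> * exp L" by (simp add: field_simps)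
      have "half_factor \<tau> ^ 3 = \<tau> ^ 12 * exp (- L / 2) ^ 3"
        unfolding half_factor_def eta_factor_def L_def[symmetric] power_mult_distrib by (simp add: power_mult [symmetric])
      also have "\<tau> ^ 12 = exp L ^ 12" unfolding t power_mult_distrib by (simp add: eval_nat_numeral)
      also have "exp L ^ 12 * exp (- L / 2) ^ 3 = exp (of_nat 12 * L + of_nat 3 * (- L / 2))"
        unfolding exp_add exp_of_nat_mult ..
      also have "of_nat 12 * L + of_nat 3 * (- L / 2) = of_int 21 * L / 2" by (simp add: field_simps)
      finally show ?thesis by (simp only: L_def)
    qed
    \<comment> \<open>The cube of \<open>D\<close> vanishes at the cusp to order at least 3 (1 -
      1/24) = 69/24, more than the order 21/24 of eta^21.\<close>
    have "D \<tau> = 0" if "Im \<tau> > 0" for \<tau>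
      by (rule eta_quotient_vanishes[OF hol D z, of 1 21 "- 1"])
         (use that inv cube in \<open>auto simp: power_mult_distrib\<close>)
    then have "qexp (- 1 / 24) (\<lambda>e. of_int (h i e) - of_int (s e)) (\<lambda>_. 0)"
      using D unfolding qexp_def by auto
    from qexp_zero[OF this z] have "of_int (h i e) - of_int (s e) = (0 :: complex)" for e by blast
    then have "h i e = s e" for e by simp
    then show ?thesis unfolding s_def by blast
  qed
  with that show ?thesis unfolding h_def by blast
qed

section \<open>Powers of 7 gained by the Hecke operator\<close>

text \<open>
  The weight \<open>wt i\<close> is the power of \<open>7\<close> by which \<open>F_form i\<close> has to be scaled for each
  application of the Hecke operator to gain a factor \<open>49\<close>.
\<close>

fun wt :: "nat \<Rightarrow> nat" where
  "wt i = (if i = 0 then 0 else if i = 1 then 2 else 2 + wt ((i - 2) div 49))"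

declare wt.simps [simp del]

lemma wt_mono: "i \<le> j \<Longrightarrow> wt i \<le> wt j"
proof (induction j arbitrary: i rule: less_induct)
  case (less j)
  show ?case
  proof (cases "i < 2")
    case True
    then have "i = 0 \<or> i = 1" by auto
    then show ?thesis using less.prems by (auto simp: wt.simps[of i] wt.simps[of j])
  next
    case False
    have "wt ((i - 2) div 49) \<le> wt ((j - 2) div 49)"
      by (rule less.IH) (use False less.prems in \<open>auto intro: div_le_mono le_less_trans[OF div_le_dividend]\<close>)
    then show ?thesis using False less.prems by (simp add: wt.simps[of i] wt.simps[of j])
  qed
qed

text \<open>These j index the sum that carries no power of 7; there the drop from i to j has to
  supply the factor 49 by itself.\<close>

lemma wt_lower: "j < (i + 47) div 49 \<Longrightarrow> wt j + 2 \<le> wt i"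
proof -
  assume j: "j < (i + 47) div 49"
  then have i: "i \<ge> 2" by (cases "i < 2") auto
  then have "(i + 47) div 49 = (i - 2) div 49 + 1"
    using div_add_self2[of 49 "i - 2"] by simp
  then have "j \<le> (i - 2) div 49" using j by simp
  from wt_mono[OF this] show ?thesis using i by (simp add: wt.simps[of i])
qed

text \<open>The largest index 49 i + 2 of the last sum demands only two more powers of 7. Together
  with the two to be gained these are four, within the available 7^5.\<close>

lemma wt_upper: "j < 49 * i + 3 \<Longrightarrow> wt j \<le> wt i + 2"
proof -
  assume "j < 49 * i + 3"
  then have "wt j \<le> wt (49 * i + 2)" by (intro wt_mono) simp
  also have "wt (49 * i + 2) = wt i + 2" by (subst wt.simps) simp
  finally show ?thesis .
qed

text \<open>From 24 (49 e' - 2) - 1 = 49 (24 e' - 1), passing from e to e' lowers k by 2, and every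
  term of the Hecke relation at e' makes up for these two powers. For k = 1 and i > 0 the scaling
  \<open>7 ^ wt i\<close> already contains a 7, so only i = 0 needs the assumption.\<close>

lemma F_coeff_dvd:
  assumes base: "\<And>e. 7 dvd 24 * e - 1 \<Longrightarrow> 7 dvd F_coeff 0 e"
  shows "7 ^ k dvd 24 * e - 1 \<Longrightarrow> 7 ^ k dvd 7 ^ wt i * F_coeff i e"
proof -
  obtain \<epsilon> :: "int \<Rightarrow> int" where rel: "\<And>i. \<exists>u v w. \<forall>e. 7 ^ 5 * (if 49 dvd e + 2 then F_coeff i ((e + 2) div 49) else 0) + 49 * \<epsilon> e * F_coeff i e + F_coeff i (49 * e - 2) =
      (\<Sum>j<(i + 47) div 49. u j * F_coeff j e) + 49 * (\<Sum>j<i + 1. v j * F_coeff j e) +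
      7 ^ 5 * (\<Sum>j<49 * i + 3. w j * F_coeff j e)"
    using hecke_relation by blast
  show "7 ^ k dvd 24 * e - 1 \<Longrightarrow> 7 ^ k dvd 7 ^ wt i * F_coeff i e"
  proof (induction k arbitrary: e i rule: less_induct)
    case (less k)
    consider "k = 0" | "k = 1" "i = 0" | "k = 1" "i > 0" | "k \<ge> 2" by linarith
    then show ?case
    proof cases
      case 2
      then show ?thesis using base less.prems by (simp add: wt.simps)
    next
      case 3
      then have "wt i \<noteq> 0" by (simp add: wt.simps[of i])
      then have "(7 :: int) dvd 7 ^ wt i" by (intro dvd_power) auto
      then show ?thesis using 3 by simp
    next
      case 4
      have step: "\<exists>e'. e = 49 * e' - 2 \<and> 7 ^ (l - 2) dvd 24 * e' - 1" if dv: "7 ^ l dvd 24 * e - 1" and l2: "l \<ge> 2" for l and e :: int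
      proof -
        have l: "(7 :: int) ^ l = 49 * 7 ^ (l - 2)"
        proof -
          obtain n where n: "l = 2 + n" using le_Suc_ex[OF l2] by blast
          show ?thesis unfolding n by (simp add: power_add)
        qed
        then have "49 dvd 24 * e - 1" using dv by (metis dvd_mult_left)
        then have "49 dvd e + 2" by presburger
        then obtain e' where "e + 2 = 49 * e'" ..
        then have e': "e = 49 * e' - 2" by simp
        have "49 * 7 ^ (l - 2) dvd 49 * (24 * e' - 1)"
          using dv unfolding l e' by (simp add: algebra_simps)
        then have "7 ^ (l - 2) dvd 24 * e' - 1"
          unfolding dvd_mult_cancel_left by simp
        then show ?thesis using e' by blast
      qed
      obtain e' where e': "e = 49 * e' - 2" "7 ^ (k - 2) dvd 24 * e' - 1"
        using step[OF less.prems 4] by blast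
      \<comment> \<open>The induction hypothesis at k - 2, with two powers of 7 to spare in the
        scaling.\<close>
      have main: "7 ^ k dvd 7 ^ s * F_coeff j e'" if "wt j + 2 \<le> s" for s j
      proof -
        have "7 ^ (k - 2) dvd 7 ^ wt j * F_coeff j e'"
          by (rule less.IH) (use 4 e'(2) in auto)
        then have "7 ^ (s - wt j) * 7 ^ (k - 2) dvd 7 ^ (s - wt j) * (7 ^ wt j * F_coeff j e')"
          by (rule mult_dvd_mono[OF dvd_refl])
        also have "7 ^ (s - wt j) * (7 ^ wt j * F_coeff j e') = 7 ^ s * F_coeff j e'"
          using that by (simp add: mult.assoc [symmetric] power_add [symmetric])
        finally have "7 ^ (s - wt j + (k - 2)) dvd 7 ^ s * F_coeff j e'" by (simp only: power_add)
        moreover have "(7 :: int) ^ k dvd 7 ^ (s - wt j + (k - 2))" using that by (intro le_imp_power_dvd) auto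
        ultimately show ?thesis by (rule dvd_trans[rotated])
      qed
      \<comment> \<open>This term goes back by a second factor 49, so it loses four powers of 7 in
        all; its factor 7^5 outweighs them.\<close>
      define X where "X = (if 49 dvd e' + 2 then F_coeff i ((e' + 2) div 49) else 0)"
      have X: "7 ^ k dvd 7 ^ (wt i + 5) * X"
      proof (cases "49 dvd e' + 2")
        case True
        then obtain e'' where "e' + 2 = 49 * e''" ..
        then have e'': "e' = 49 * e'' - 2" "(e' + 2) div 49 = e''" by auto
        \<comment> \<open>For k < 4 the subtraction is truncated to 0 and the claim is
          trivial.\<close>
        have "7 ^ (k - 4) dvd 24 * e'' - 1"
        proof (cases "k \<ge> 4")
          case True
          then have "k - 2 \<ge> 2" by simp
          from step[OF e'(2) this] show ?thesis using e''(1) by auto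
        qed simp
        then have "7 ^ (k - 4) dvd 7 ^ wt i * F_coeff i e''"
          by (intro less.IH) (use 4 in auto)
        then have "7 ^ 5 * 7 ^ (k - 4) dvd 7 ^ 5 * (7 ^ wt i * F_coeff i e'')"
          by (rule mult_dvd_mono[OF dvd_refl])
        moreover have "7 ^ 5 * (7 ^ wt i * F_coeff i e'') = 7 ^ (wt i + 5) * X"
          unfolding X_def e''(2) using True by (simp add: power_add mult_ac)
        moreover have "(7 :: int) ^ k dvd 7 ^ 5 * 7 ^ (k - 4)"
          unfolding power_add[symmetric] by (intro le_imp_power_dvd) auto
        ultimately show ?thesis by (metis dvd_trans)
      qed (simp add: X_def)
      have sum: "7 ^ k dvd 7 ^ s * (\<Sum>j\<in>A. c j * F_coeff j e')" if "\<And>j. j \<in> A \<Longrightarrow> wt j + 2 \<le> s" for s A and c :: "nat \<Rightarrow> int"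
      proof -
        have "7 ^ s * (\<Sum>j\<in>A. c j * F_coeff j e') = (\<Sum>j\<in>A. c j * (7 ^ s * F_coeff j e'))"
          by (simp add: sum_distrib_left mult_ac)
        then show ?thesis using main that by (auto intro!: dvd_sum)
      qed
      obtain u v w where "\<forall>e. 7 ^ 5 * (if 49 dvd e + 2 then F_coeff i ((e + 2) div 49) else 0) + 49 * \<epsilon> e * F_coeff i e + F_coeff i (49 * e - 2) =
          (\<Sum>j<(i + 47) div 49. u j * F_coeff j e) + 49 * (\<Sum>j<i + 1. v j * F_coeff j e) +
          7 ^ 5 * (\<Sum>j<49 * i + 3. w j * F_coeff j e)"
        using rel[of i] by blast
      from spec[OF this, of e'] have r: "7 ^ 5 * X + 49 * \<epsilon> e' * F_coeff i e' + F_coeff i e =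
          (\<Sum>j<(i + 47) div 49. u j * F_coeff j e') + 49 * (\<Sum>j<i + 1. v j * F_coeff j e') +
          7 ^ 5 * (\<Sum>j<49 * i + 3. w j * F_coeff j e')"
        unfolding X_def e'(1) .
      have "F_coeff i e = (\<Sum>j<(i + 47) div 49. u j * F_coeff j e') + 49 * (\<Sum>j<i + 1. v j * F_coeff j e') +
         7 ^ 5 * (\<Sum>j<49 * i + 3. w j * F_coeff j e') - 7 ^ 5 * X - 49 * \<epsilon> e' * F_coeff i e'"
        using r by linarith
      moreover have "7 ^ t * y = 7 ^ t * U + 7 ^ (t + 2) * V + 7 ^ (t + 5) * W - 7 ^ (t + 5) * x - \<eta> * (7 ^ (t + 2) * z)"
        if "y = U + 49 * V + 7 ^ 5 * W - 7 ^ 5 * x - 49 * \<eta> * z" for t and y z x \<eta> U V W :: int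
        unfolding that by (simp add: algebra_simps power_add)
      ultimately have "7 ^ wt i * F_coeff i e = 7 ^ wt i * (\<Sum>j<(i + 47) div 49. u j * F_coeff j e') +
          7 ^ (wt i + 2) * (\<Sum>j<i + 1. v j * F_coeff j e') +
          7 ^ (wt i + 5) * (\<Sum>j<49 * i + 3. w j * F_coeff j e') - 7 ^ (wt i + 5) * X - \<epsilon> e' * (7 ^ (wt i + 2) * F_coeff i e')"
        by blast
      moreover have "7 ^ k dvd \<dots>"
      proof -
        have 1: "7 ^ k dvd 7 ^ wt i * (\<Sum>j<(i + 47) div 49. u j * F_coeff j e')"
          by (rule sum) (use wt_lower in auto)
        have 2: "7 ^ k dvd 7 ^ (wt i + 2) * (\<Sum>j<i + 1. v j * F_coeff j e')"
          by (rule sum) (auto intro: wt_mono)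
        have 3: "7 ^ k dvd 7 ^ (wt i + 5) * (\<Sum>j<49 * i + 3. w j * F_coeff j e')"
          by (rule sum) (auto dest: wt_upper)
        have 4: "7 ^ k dvd 7 ^ (wt i + 2) * F_coeff i e'"
          by (rule main) simp
        show ?thesis
          by (rule dvd_diff[OF dvd_diff[OF dvd_add[OF dvd_add[OF 1 2] 3] X] dvd_mult[OF 4]])
      qed
      ultimately show ?thesis by (simp only:)
    qed auto
  qed
qed

section \<open>The congruence modulo 7\<close>

lemma coprime_24_7: "coprime (24 :: int) 7"
proof (rule coprimeI)
  fix c :: int assume "c dvd 24" "c dvd 7"
  then have "c dvd 7 * 7 - 2 * 24" by (intro dvd_diff dvd_mult)
  then show "is_unit c" by simp
qed

section \<open>The Hecke operator T_7 on cusp forms of weight 28\<close>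

text \<open>With Delta = eta^24, these are the coefficients of E_4^4 Delta = q + ... and E_4 Delta^2
  = q^2 + ..., a basis of the cusp forms of weight 28.\<close>

abbreviation cusp1 :: "int \<Rightarrow> int" where "cusp1 \<equiv> form_coeff 4 24 1"
abbreviation cusp2 :: "int \<Rightarrow> int" where "cusp2 \<equiv> form_coeff 1 48 2"

lemma eta_factor_weight_28:
  assumes "Im \<tau> > 0"
  shows "eta_factor 1 48 \<tau> = \<tau> ^ 28" "eta_factor 4 24 \<tau> = \<tau> ^ 28"
proof -
  define L where "L = Ln (\<tau> / \<i>)"
  have "exp L = \<tau> / \<i>" unfolding L_def by (rule exp_Ln) (use assms in auto)
  then have t: "\<tau> = \<i> * exp L" by (simp add: field_simps)
  have "exp (of_int 48 * L / 2) = exp (of_nat 24 * L)" "exp (of_int 24 * L / 2) = exp (of_nat 12 * L)"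
    by (rule arg_cong[where f = exp], simp)+
  moreover have "\<tau> ^ 24 = exp L ^ 24" "\<tau> ^ 12 = exp L ^ 12"
    unfolding t power_mult_distrib by (simp_all add: eval_nat_numeral)
  ultimately have e: "exp (of_int 48 * L / 2) = \<tau> ^ 24" "exp (of_int 24 * L / 2) = \<tau> ^ 12"
    unfolding exp_of_nat_mult by simp_all
  show "eta_factor 1 48 \<tau> = \<tau> ^ 28" "eta_factor 4 24 \<tau> = \<tau> ^ 28"
    unfolding eta_factor_def L_def[symmetric] e by (simp_all flip: power_add)
qed

text \<open>T_7 applied to E_4 Delta^2, with 7^27 for weight 28. The coordinates in the basis are
  read off at q and q^2. The difference then starts at q^3, beyond the possible order 28 / 12 of a
  nonzero form.\<close>

lemma hecke7_relation:
  "cusp2 (7 * e) + 7 ^ 27 * (if 7 dvd e then cusp2 (e div 7) else 0) =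
     cusp2 7 * cusp1 e + (cusp2 14 - cusp2 7 * cusp1 2) * cusp2 e"
proof -
  let ?f = "eta_form 1 48" and ?g = "eta_form 4 24"
  have f: "qexp 0 (\<lambda>e. of_int (cusp2 e)) ?f"
    using form_fps_coeff_qexp[of 48 2 1] by simp
  have g: "qexp 0 (\<lambda>e. of_int (cusp1 e)) ?g"
    using form_fps_coeff_qexp[of 24 1 4] by simp
  define c where "c = cusp2 14 - cusp2 7 * cusp1 2"
  define d where "d = (\<lambda>e. cusp2 (7 * e) + 7 ^ 27 * (if 7 dvd e then cusp2 (e div 7) else 0) -
     (cusp2 7 * cusp1 e + c * cusp2 e))"
  define D where "D = (\<lambda>\<tau>. 1 / of_nat 7 * (\<Sum>b<7. ?f ((\<tau> + of_int (24 * int b)) / of_nat 7)) + 7 ^ 27 * ?f (of_nat 7 * \<tau>) -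
     (of_int (cusp2 7) * ?g \<tau> + of_int c * ?f \<tau>))"
  have V: "qexp 0 (\<lambda>e. if int 7 dvd e - 0 then of_int (cusp2 ((e - 0) div int 7)) else 0) (\<lambda>\<tau>. ?f (of_nat 7 * \<tau>))"
    by (rule qexp_scale[OF f]) auto
  have U: "qexp 0 (\<lambda>e. of_int (cusp2 (int 7 * e + 0))) (\<lambda>\<tau>. 1 / of_nat 7 * (\<Sum>b<7. ?f ((\<tau> + of_int (24 * int b)) / of_nat 7)))"
    by (rule qexp_U[OF f, where \<kappa> = 0]) (auto simp: coprime_24_7)
  have q: "qexp 0 (\<lambda>e. of_int (d e)) D"
  proof -
    have "qexp 0 (\<lambda>e. of_int (cusp2 (int 7 * e + 0)) + 7 ^ 27 * (if int 7 dvd e - 0 then of_int (cusp2 ((e - 0) div int 7)) else 0) -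
       (of_int (cusp2 7) * of_int (cusp1 e) + of_int c * of_int (cusp2 e))) D"
      unfolding D_def by (intro qexp_diff qexp_add qexp_cmult U V f g)
    moreover have "of_int (cusp2 (int 7 * e + 0)) + 7 ^ 27 * (if int 7 dvd e - 0 then of_int (cusp2 ((e - 0) div int 7)) else 0) -
       (of_int (cusp2 7) * of_int (cusp1 e) + of_int c * of_int (cusp2 e)) = (of_int (d e) :: complex)" for e
      unfolding d_def by (cases "7 dvd e") simp_all
    ultimately show ?thesis by (simp only:)
  qed
  have small: "cusp2 e = 0" if "e < 2" for e using that by (simp add: form_coeff_def)
  have small': "cusp1 e = 0" if "e < 1" for e using that by (simp add: form_coeff_def)
  have one: "cusp2 2 = 1" "cusp1 1 = 1" by (simp_all add: form_coeff_def form_fps_nth_0)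
  have z: "of_int (d e) = (0 :: complex)" if e3: "e < 3" for e
  proof -
    consider "e \<le> 0" | "e = 1" | "e = 2" using e3 by linarith
    then have "d e = 0"
    proof cases
      case 1
      then have "7 * e < 2" "e div 7 < 2" "e < 1" "e < 2" by auto
      note this(1,2,4)[THEN small] this(3)[THEN small']
      then show ?thesis unfolding d_def by (simp only: mult_zero_right if_cancel diff_0_right add_0)
    next
      case 2
      then show ?thesis using small[of 1] by (simp add: d_def small one)
    next
      case 3
      then show ?thesis by (simp add: d_def c_def one del: One_nat_def)
    qed
    then show ?thesis by simp
  qed
  have hf: "?f holomorphic_on {\<tau>. Im \<tau> > 0}" and hg: "?g holomorphic_on {\<tau>. Im \<tau> > 0}"
    by (rule eta_form_holomorphic)+
  have "(\<lambda>\<tau>. ?f (of_nat 7 * \<tau>)) holomorphic_on {\<tau>. Im \<tau> > 0}"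
    using holomorphic_on_upper_half_affine[OF hf, of 7 0] by simp
  moreover have "(\<lambda>\<tau>. ?f ((\<tau> + of_int (24 * int b)) / of_nat 7)) holomorphic_on {\<tau>. Im \<tau> > 0}" for b
    using holomorphic_on_upper_half_affine[OF hf, of "1 / 7" "of_int (24 * int b) / 7"] by (simp add: add_divide_distrib)
  ultimately have hol: "D holomorphic_on {\<tau>. Im \<tau> > 0}"
    unfolding D_def by (intro holomorphic_intros hf hg)
  have Sf: "?f (- 1 / \<tau>) = \<tau> ^ 28 * ?f \<tau>" if "Im \<tau> > 0" for \<tau>
    using eta_form_neg_inverse[OF that, of 1 48] eta_factor_weight_28[OF that] by simp
  have Sg: "?g (- 1 / \<tau>) = \<tau> ^ 28 * ?g \<tau>" if "Im \<tau> > 0" for \<tau>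
    using eta_form_neg_inverse[OF that, of 4 24] eta_factor_weight_28[OF that] by simp
  have S: "D (- 1 / \<tau>) = \<tau> ^ 28 * D \<tau>" if t: "Im \<tau> > 0" for \<tau>
  proof -
    have t0: "\<tau> \<noteq> 0" using t by auto
    let ?G = "\<lambda>\<tau> b. ?f ((\<tau> + of_int (24 * b)) / of_nat 7)"
    have U0: "?G (- 1 / \<tau>) 0 = 7 ^ 28 * \<tau> ^ 28 * ?f (of_nat 7 * \<tau>)"
    proof -
      have "(- 1 / \<tau> + of_int (24 * 0)) / of_nat 7 = - 1 / (of_nat 7 * \<tau>)" by simp
      moreover have "Im (of_nat 7 * \<tau>) > 0" using t by simp
      ultimately show ?thesis using Sf[of "of_nat 7 * \<tau>"] by (simp only: power_mult_distrib of_nat_numeral)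
    qed
    have V0: "7 ^ 27 * ?f (of_nat 7 * (- 1 / \<tau>)) = 1 / 7 * (\<tau> ^ 28 * ?G \<tau> 0)"
    proof -
      have "of_nat 7 * (- 1 / \<tau>) = - 1 / (\<tau> / 7)" "(\<tau> + of_int (24 * 0)) / of_nat 7 = \<tau> / 7" by simp_all
      moreover have "Im (\<tau> / 7) > 0" using t by simp
      ultimately have eq: "?f (of_nat 7 * (- 1 / \<tau>)) = (\<tau> / 7) ^ 28 * ?G \<tau> 0" using Sf[of "\<tau> / 7"] by (simp only:)
      show ?thesis unfolding eq by (simp add: power_divide)
    qed
    have U: "?G (- 1 / \<tau>) b = \<tau> ^ 28 * ?G \<tau> b'" if bb: "(b, b') \<in> set (coset_pairs table7)" for b b'
    proof -
      obtain f where f: "eta_form 1 48 (of_int (24 * b) / of_int 7 - 1 / (of_int 7 * \<tau>)) =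
         eta_factor 1 48 \<tau> * exp (of_real pi * \<i> * of_int (48 * f) / 12) * eta_form 1 48 ((\<tau> + of_int (24 * b')) / of_int 7)"
        using coset_check_eta_form[OF table7_check bb t, of 1 48] by auto
      have e1: "(- 1 / \<tau> + of_int (24 * b)) / of_nat 7 = of_int (24 * b) / of_int 7 - 1 / (of_int 7 * \<tau>)"
        using t0 by (simp add: field_simps)
      have ph: "exp (of_real pi * \<i> * of_int (48 * f) / 12) = 1"
        unfolding exp_eq_1 by (auto intro!: exI[of _ "2 * f"])
      have m: "(of_nat 7 :: complex) = of_int 7" by simp
      show ?thesis
        unfolding e1 unfolding m f ph eta_factor_weight_28[OF t] by (simp only: mult_1_right)
    qed
    have s1: "(\<Sum>x\<leftarrow>coset_pairs table7. ?G (- 1 / \<tau>) (fst x)) = (\<Sum>x\<leftarrow>coset_pairs table7. \<tau> ^ 28 * ?G \<tau> (snd x))"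
      by (intro arg_cong[where f = sum_list] map_cong refl) (use U in auto)
    define P where "P = (\<Sum>b\<in>{1..6}. ?G \<tau> b)"
    have "(\<Sum>b\<in>{1..6}. ?G (- 1 / \<tau>) b) = \<tau> ^ 28 * P"
      using s1 unfolding sum_pairs7(1)[of "?G (- 1 / \<tau>)"] sum_pairs7(2)[of "\<lambda>b. \<tau> ^ 28 * ?G \<tau> b"] P_def sum_distrib_left .
    then have T1: "(\<Sum>b<7. ?G (- 1 / \<tau>) (int b)) = 7 ^ 28 * \<tau> ^ 28 * ?f (of_nat 7 * \<tau>) + \<tau> ^ 28 * P"
      unfolding sum_mod_7[of "?G (- 1 / \<tau>)"] U0 by simp
    have T2: "(\<Sum>b<7. ?G \<tau> (int b)) = ?G \<tau> 0 + P"
      unfolding sum_mod_7[of "?G \<tau>"] P_def ..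
    show ?thesis
      unfolding D_def T1 T2 V0 Sf[OF t] Sg[OF t] by (simp add: algebra_simps)
  qed
  have cube: "(\<tau> ^ 28) ^ 3 = exp (of_int 168 * Ln (\<tau> / \<i>) / 2)" if "Im \<tau> > 0" for \<tau> :: complex
  proof -
    define L where "L = Ln (\<tau> / \<i>)"
    have "exp L = \<tau> / \<i>" unfolding L_def by (rule exp_Ln) (use that in auto)
    then have t: "\<tau> = \<i> * exp L" by (simp add: field_simps)
    have "(\<tau> ^ 28) ^ 3 = (\<tau> ^ 4) ^ 21" by (simp flip: power_mult)
    also have "\<tau> ^ 4 = exp L ^ 4" unfolding t power_mult_distrib by (simp add: eval_nat_numeral)
    also have "(exp L ^ 4) ^ 21 = exp (of_nat 84 * L)" unfolding exp_of_nat_mult by (simp flip: power_mult)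
    also have "of_nat 84 * L = of_int 168 * L / 2" by simp
    finally show ?thesis by (simp only: L_def)
  qed
  \<comment> \<open>The cube has weight 84, like eta^168, whose order at the cusp is 7; the cube of
    \<open>D\<close> has order at least 9.\<close>
  have "D \<tau> = 0" if "Im \<tau> > 0" for \<tau>
    by (rule eta_quotient_vanishes[OF hol q z, of 3 168 "- 7"])
       (use that S cube in \<open>auto simp: power_mult_distrib\<close>)
  then have "qexp 0 (\<lambda>e. of_int (d e)) (\<lambda>_. 0)"
    using q unfolding qexp_def by auto
  from qexp_zero[OF this z] have "of_int (d e) = (0 :: complex)" by blast
  then have "d e = 0" by simp
  then show ?thesis by (simp add: d_def c_def)
qed

section \<open>Initial coefficients and the congruence modulo 7\<close>

lemma divisor_sigma_eq_sum_list:
  "n > 0 \<Longrightarrow> divisor_sigma k n = (\<Sum>d\<leftarrow>filter (\<lambda>d. d dvd n) [1..<Suc n]. d ^ k)"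
proof -
  assume n: "n > 0"
  have "set (filter (\<lambda>d. d dvd n) [1..<Suc n]) = {d. d dvd n}"
    using n by (auto dest: dvd_imp_le intro: Nat.gr0I simp: Suc_le_eq less_Suc_eq_le)
  then show ?thesis
    unfolding divisor_sigma_def by (subst sum_list_distinct_conv_sum_set) auto
qed

text \<open>The logarithmic derivative read as a recursion, which yields coefficients without
  expanding the infinite product.\<close>

lemma qq_inf_nth_Suc:
  "int (Suc n) * fps_nth qq_inf (Suc n) = - (\<Sum>i\<le>n. int (divisor_sigma 1 (Suc i)) * fps_nth qq_inf (n - i))"
proof -
  have "fps_nth (fps_deriv qq_inf) n = fps_nth (Abs_fps (\<lambda>n. - int (divisor_sigma 1 (Suc n))) * qq_inf) n"
    using qq_inf_deriv by simp
  then show ?thesis by (simp add: fps_mult_nth sum_negf atMost_atLeast0 del: of_nat_Suc)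
qed

lemma e4_eq: "e4 n = fps_nth (E4 * qq_inv) n"
  by (simp add: e4_def qq_inv_def)

lemma e4_recurrence: "(\<Sum>i\<le>n. fps_nth qq_inf i * e4 (n - i)) = fps_nth E4 n"
proof -
  have "qq_inf * (E4 * qq_inv) = E4 * (qq_inf * qq_inv)" by (simp only: mult_ac)
  then have "E4 = qq_inf * (E4 * qq_inv)" unfolding qq_inf_inv by simp
  then have "fps_nth E4 n = fps_nth (qq_inf * (E4 * qq_inv)) n" by (rule arg_cong)
  then show ?thesis by (simp add: fps_mult_nth e4_eq atMost_atLeast0)
qed

text \<open>Modulo 7 these two values control the coefficients of q^7 and q^14 in E_4 eta^48, which
  starts at q^2: 5 = 7 - 2 and 12 = 14 - 2.\<close>

lemma e4_5_12: "7 dvd e4 5" "7 dvd e4 12"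
proof -
  have s1: "divisor_sigma 1 1 = 1" "divisor_sigma 1 2 = 3" "divisor_sigma 1 3 = 4" "divisor_sigma 1 4 = 7"
    "divisor_sigma 1 5 = 6" "divisor_sigma 1 6 = 12" "divisor_sigma 1 7 = 8" "divisor_sigma 1 8 = 15"
    "divisor_sigma 1 9 = 13" "divisor_sigma 1 10 = 18" "divisor_sigma 1 11 = 12" "divisor_sigma 1 12 = 28"
    by (simp_all add: divisor_sigma_eq_sum_list upt_rec flip: numeral_2_eq_2)
  have s3: "divisor_sigma 3 1 = 1" "divisor_sigma 3 2 = 9" "divisor_sigma 3 3 = 28" "divisor_sigma 3 4 = 73"
    "divisor_sigma 3 5 = 126" "divisor_sigma 3 6 = 252" "divisor_sigma 3 7 = 344" "divisor_sigma 3 8 = 585"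
    "divisor_sigma 3 9 = 757" "divisor_sigma 3 10 = 1134" "divisor_sigma 3 11 = 1332" "divisor_sigma 3 12 = 2044"
    by (simp_all add: divisor_sigma_eq_sum_list upt_rec flip: numeral_2_eq_2)
  note q = qq_inf_nth_Suc[of 0] qq_inf_nth_Suc[of 1] qq_inf_nth_Suc[of 2] qq_inf_nth_Suc[of 3]
    qq_inf_nth_Suc[of 4] qq_inf_nth_Suc[of 5] qq_inf_nth_Suc[of 6] qq_inf_nth_Suc[of 7]
    qq_inf_nth_Suc[of 8] qq_inf_nth_Suc[of 9] qq_inf_nth_Suc[of 10] qq_inf_nth_Suc[of 11]
  let ?q = "fps_nth qq_inf"
  note [simp] = atMost_nat_numeral atMost_Suc s1[unfolded One_nat_def] s3[unfolded One_nat_def] E4_nth numeral_2_eq_2[symmetric]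
  have q0 [simp]: "?q 0 = 1" by (rule qq_inf_nth_0)
  have q1 [simp]: "?q (Suc 0) = - 1" using q(1) by simp
  have q2 [simp]: "?q 2 = - 1" using q(2) by simp
  have q3 [simp]: "?q 3 = 0" using q(3) by simp
  have q4 [simp]: "?q 4 = 0" using q(4) by simp
  have q5 [simp]: "?q 5 = 1" using q(5) by simp
  have q6 [simp]: "?q 6 = 0" using q(6) by simp
  have q7 [simp]: "?q 7 = 1" using q(7) by simp
  have q8 [simp]: "?q 8 = 0" using q(8) by simp
  have q9 [simp]: "?q 9 = 0" using q(9) by simp
  have q10 [simp]: "?q 10 = 0" using q(10) by simp
  have q11 [simp]: "?q 11 = 0" using q(11) by simp
  have q12 [simp]: "?q 12 = - 1" using q(12) by simp
  have e0 [simp]: "e4 0 = 1" using e4_recurrence[of 0] by simp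
  have e1 [simp]: "e4 (Suc 0) = 241" using e4_recurrence[of "Suc 0"] by simp
  have e2 [simp]: "e4 2 = 2402" using e4_recurrence[of 2] by simp
  have e3 [simp]: "e4 3 = 9363" using e4_recurrence[of 3] by simp
  have e4 [simp]: "e4 4 = 29285" using e4_recurrence[of 4] by simp
  have e5 [simp]: "e4 5 = 68887" using e4_recurrence[of 5] by simp
  have e6 [simp]: "e4 6 = 158411" using e4_recurrence[of 6] by simp
  have e7 [simp]: "e4 7 = 307455" using e4_recurrence[of 7] by simp
  have e8 [simp]: "e4 8 = 596662" using e4_recurrence[of 8] by simp
  have e9 [simp]: "e4 9 = 1054110" using e4_recurrence[of 9] by simp
  have e10 [simp]: "e4 10 = 1844682" using e4_recurrence[of 10] by simp
  have e11 [simp]: "e4 11 = 3030776" using e4_recurrence[of 11] by simp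
  have e12 [simp]: "e4 12 = 4989677" using e4_recurrence[of 12] by simp
  show "7 dvd e4 5" "7 dvd e4 12" by simp_all
qed

text \<open>n times the coefficient of index n is a coefficient of (f^7)' = 7 f' f^6, and n is
  invertible modulo 7.\<close>

lemma fps_power_7_nth_dvd:
  fixes f :: "int fps"
  assumes "\<not> 7 dvd n"
  shows "7 dvd fps_nth (f ^ 7) n"
proof -
  have n: "n > 0" using assms by (intro Nat.gr0I) auto
  have "fps_deriv (f ^ 7) = 7 * (fps_deriv f * f ^ 6)"
    by (subst fps_deriv_power') simp
  then have "fps_nth (fps_deriv (f ^ 7)) (n - 1) = 7 * fps_nth (fps_deriv f * f ^ 6) (n - 1)"
    by simp
  then have "7 dvd int n * fps_nth (f ^ 7) n"
    using n by simp
  moreover have "coprime (7 :: int) (int n)"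
  proof -
    have "prime (7 :: int)" by simp
    moreover have "\<not> (7 :: int) dvd int n" using assms by presburger
    ultimately show ?thesis by (rule prime_imp_coprime)
  qed
  ultimately show ?thesis by (simp add: coprime_dvd_mult_right_iff)
qed

lemma e4_dvd_7: "7 dvd e4 (7 * m + 5)"
proof -
  \<comment> \<open>The 49th power is the quotient of E_4 (q;q)^48 by E_4 / (q;q), and it is the
    seventh power of (q;q)^7.\<close>
  define K where "K = qq_inf ^ 49"
  have K7: "7 dvd fps_nth K n" if "\<not> 7 dvd n" for n
    using fps_power_7_nth_dvd[OF that, of "qq_inf ^ 7"] by (simp add: K_def flip: power_mult)
  have K0: "fps_nth K 0 = 1" by (simp add: K_def fps_nth_power_0 qq_inf_nth_0)
  have c: "cusp2 (int n + 2) = (\<Sum>i\<le>n. fps_nth K i * e4 (n - i))" for n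
  proof -
    have "E4 * qq_inf ^ 48 = K * (E4 * qq_inv)"
    proof -
      have "K = qq_inf ^ 48 * qq_inf" by (simp add: K_def flip: power_Suc2)
      then have "K * (E4 * qq_inv) = E4 * qq_inf ^ 48 * (qq_inf * qq_inv)" by (simp only: mult_ac)
      then have "K * (E4 * qq_inv) = E4 * qq_inf ^ 48" unfolding qq_inf_inv by simp
      then show ?thesis by (rule sym)
    qed
    moreover have "cusp2 (int n + 2) = fps_nth (E4 * qq_inf ^ 48) n"
      by (simp add: form_coeff_def form_fps_def)
    ultimately have "cusp2 (int n + 2) = fps_nth (K * (E4 * qq_inv)) n"
      by (simp only:)
    then show ?thesis by (simp add: fps_mult_nth e4_eq atMost_atLeast0)
  qed
  \<comment> \<open>Modulo 7 only the indices divisible by 7 survive in the convolution, so the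
    arguments of \<open>e4\<close> stay in the class 5.\<close>
  have mod: "7 dvd cusp2 (int (7 * m + 5) + 2) - (\<Sum>l\<le>m. fps_nth K (7 * l) * e4 (7 * (m - l) + 5))" for m
  proof -
    let ?n = "7 * m + 5"
    let ?A = "{i \<in> {..?n}. 7 dvd i}"
    have "(\<Sum>i\<le>?n. fps_nth K i * e4 (?n - i)) = (\<Sum>i\<in>?A. fps_nth K i * e4 (?n - i)) + (\<Sum>i\<in>{..?n} - ?A. fps_nth K i * e4 (?n - i))"
      by (subst sum.subset_diff[of ?A]) auto
    moreover have "(\<Sum>i\<in>?A. fps_nth K i * e4 (?n - i)) = (\<Sum>l\<le>m. fps_nth K (7 * l) * e4 (7 * (m - l) + 5))"
      by (rule sum.reindex_bij_witness[of _ "\<lambda>l. 7 * l" "\<lambda>i. i div 7"])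
         (auto elim!: dvdE simp: algebra_simps diff_mult_distrib2)
    moreover have "7 dvd (\<Sum>i\<in>{..?n} - ?A. fps_nth K i * e4 (?n - i))"
      by (intro dvd_sum dvd_mult2 K7) auto
    ultimately show ?thesis unfolding c by simp
  qed
  have c7: "7 dvd cusp2 7"
  proof -
    have "7 dvd cusp2 7 - e4 5" using mod[of 0] K0 by simp
    from dvd_add[OF this e4_5_12(1)] show ?thesis by simp
  qed
  have c14: "7 dvd cusp2 14"
  proof -
    have "7 dvd (\<Sum>l\<le>1. fps_nth K (7 * l) * e4 (7 * (1 - l) + 5))"
      using e4_5_12 by simp
    moreover have "7 dvd cusp2 14 - (\<Sum>l\<le>1. fps_nth K (7 * l) * e4 (7 * (1 - l) + 5))"
      using mod[of 1] by simp
    ultimately have "7 dvd (cusp2 14 - (\<Sum>l\<le>1. fps_nth K (7 * l) * e4 (7 * (1 - l) + 5))) +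
        (\<Sum>l\<le>1. fps_nth K (7 * l) * e4 (7 * (1 - l) + 5))"
      by (intro dvd_add)
    then show ?thesis by (simp only: diff_add_cancel)
  qed
  \<comment> \<open>Both coordinates in \<open>hecke7_relation\<close> are divisible by 7 by
    \<open>c7\<close> and \<open>c14\<close>, and so is 7^27.\<close>
  have all: "7 dvd cusp2 (7 * e)" for e
  proof -
    have "cusp2 (7 * e) = cusp2 7 * cusp1 e + (cusp2 14 - cusp2 7 * cusp1 2) * cusp2 e - 7 ^ 27 * (if 7 dvd e then cusp2 (e div 7) else 0)"
      using hecke7_relation[of e] by linarith
    also have "7 dvd \<dots>"
      by (intro dvd_diff dvd_add dvd_mult2 c7 c14) auto
    finally show ?thesis .
  qed
  show ?thesis
  \<comment> \<open>As \<open>K\<close> has constant term 1, the convolution can be solved for its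
    last term: modulo 7, \<open>e4 (7 * m + 5)\<close> is a combination of earlier values in the
    same class and the coefficient of q^(7 (m + 1)).\<close>
  proof (induction m rule: less_induct)
    case (less m)
    have "{..m} = insert 0 {1..m}" by auto
    then have "(\<Sum>l\<le>m. fps_nth K (7 * l) * e4 (7 * (m - l) + 5)) = e4 (7 * m + 5) + (\<Sum>l\<in>{1..m}. fps_nth K (7 * l) * e4 (7 * (m - l) + 5))"
      by (simp add: K0)
    moreover have "7 dvd (\<Sum>l\<in>{1..m}. fps_nth K (7 * l) * e4 (7 * (m - l) + 5))"
      by (intro dvd_sum dvd_mult less.IH) auto
    moreover have "7 dvd cusp2 (int (7 * m + 5) + 2)"
      using all[of "int m + 1"] by (simp add: algebra_simps)
    ultimately show ?case using mod[of m] by presburger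
  qed
qed

lemma F_coeff_0_int: "F_coeff 0 (int n) = e4 n"
  by (simp add: F_coeff_def form_coeff_def form_fps_def e4_eq)

theorem theorem5p5:
  fixes k n :: nat
  assumes "k \<ge> 1"
  shows "[e4 (7 ^ k * n + delta 7 k) = 0] (mod 7 ^ k)"
proof -
  have "7 dvd F_coeff 0 e" if "7 dvd 24 * e - 1" for e
  proof (cases "e < 0")
    case False
    then obtain m where m: "e = int m" using nonneg_int_cases by (metis not_less)
    \<comment> \<open>24 * 5 = 120 = 1 modulo 7, so the condition says that m is 5 modulo 7.\<close>
    then have "7 * (m div 7) + 5 = m" using that by presburger
    then show ?thesis using e4_dvd_7[of "m div 7"] by (simp add: F_coeff_0_int m)
  qed (simp add: F_coeff_def form_coeff_def)
  moreover have "7 ^ k dvd 24 * int (7 ^ k * n + delta 7 k) - 1"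
  proof -
    have "[24 * delta 7 k = 1] (mod 7 ^ k)" using delta_props[of 7 k] assms by simp
    then have "[int (24 * delta 7 k) = int 1] (mod int (7 ^ k))" by (simp only: cong_int_iff)
    then have "7 ^ k dvd 24 * int (delta 7 k) - 1" by (simp add: cong_iff_dvd_diff)
    then have "7 ^ k dvd 7 ^ k * (24 * int n) + (24 * int (delta 7 k) - 1)" by (intro dvd_add dvd_triv_left)
    then show ?thesis by (simp add: algebra_simps)
  qed
  ultimately have "7 ^ k dvd F_coeff 0 (int (7 ^ k * n + delta 7 k))" using F_coeff_dvd[of k _ 0] by (simp add: wt.simps[of 0])
  then show ?thesis unfolding F_coeff_0_int cong_0_iff .
qed

end
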